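(* For finite-dimensional $L$-weight $U_{v,1}$-modules $M,N$, the checked $R$-matrix $\widehat R_t^{M,N}$ of the transported modules $\Phi_t(M),\Phi_t(N)$, with source $\Phi_t(M)\otimes\Phi_t(N)$ and target $\Phi_t(N)\otimes\Phi_t(M)$, and its inverse, with source and target in the reverse order, satisfy $$\widehat R_t^{M,N}=J_{N,M}^{-1}\,\widehat R_1^{M,N}\,J_{M,N},\qquad (\widehat R_t^{M,N})^{-1}=J_{M,N}^{-1}\,(\widehat R_1^{M,N})^{-1}\,J_{N,M},$$ where $\widehat R_1^{M,N}:M\otimes N\to N\otimes M$ is the checked $R$-matrix of the $U_{v,1}$-modules $M,N$.
   Context: **Cartan data.** $I$ is a nonempty finite set and $\Omega=(\Omega_{ij})_{i,j\in I}$ an integer matrix with $\Omega_{ii}>0$; for $i\neq j$, $\Omega_{ij}\le 0$ and $(\Omega_{ij}+\Omega_{ji})/\Omega_{ii}\in\mathbb Z_{\le 0}$; and $\gcd_{i}\Omega_{ii}=1$. $Q=\mathbb Z[I]$ is the root lattice (free abelian on $I$). Bilinear forms on $Q$: $\langle i,j\rangle=\Omega_{ij}$ and $i\cdot j=\Omega_{ij}+\Omega_{ji}$. Put $d_i=\Omega_{ii}=(i\cdot i)/2$, $a_{ij}=(i\cdot j)/d_i$. Finite type is assumed: $\cdot$ is positive definite on $Q\otimes_{\mathbb Z}\mathbb Q$. $Q^+=\mathbb N[I]$, $0\in\mathbb N$. An admissible lattice is a free abelian group $L$ with $Q\subseteq L\subseteq Q\otimes_{\mathbb Z}\mathbb Q$,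 $[L:Q]<\infty$ (fixed throughout); both forms extend $\mathbb Q$-bilinearly. For $\lambda=\sum_i\lambda_ii\in L$, $\mathrm{ht}_d(\lambda)=\sum_id_i\lambda_i$. $D$ is a positive integer with $\lambda\cdot\mu,\langle\lambda,\mu\rangle,\mathrm{ht}_d(\lambda)\in D^{-1}\mathbb Z$ for all $\lambda,\mu\in L$; $v,t$ are algebraically independent variables and $\mathbb K_D=\mathbb Q(v^{1/D},t^{1/D})$. $v_i=v^{d_i}$, $t_i=t^{d_i}$. **The algebra.** $[p]_{v_i,t_i}=\frac{(v_it_i)^p-(v_it_i^{-1})^{-p}}{v_it_i-(v_it_i^{-1})^{-1}}$, $[p]_{v_i,t_i}!=\prod_{r=1}^p[r]_{v_i,t_i}$. $U_{v,t}$ is the $\mathbb K_D$-algebra generated by $E_i,F_i,K_i^{\pm1},(K_i')^{\pm1}$ ($i\in I$), all $K_i,K_i'$ commuting and invertible, with relations $K_iE_jK_i^{-1}=v^{i\cdot j}t^{\langle j,i\rangle-\langle i,j\rangle}E_j$, $K_i'E_jK_i'^{-1}=v^{-i\cdot j}t^{\langle j,i\rangle-\langle i,j\rangle}E_j$, $K_iF_jK_i^{-1}=v^{-i\cdot j}t^{\langle i,j\rangle-\langle j,i\rangle}F_j$, $K_i'F_jK_i'^{-1}=v^{i\cdot j}t^{\langle i,j\rangle-\langle j,i\rangle}F_j$, $E_iF_j-F_jE_i=\delta_{ij}\frac{K_i-K_i'}{v_i-v_i^{-1}}$, and for $i\ne j$, $N_{ij}=1-a_{ij}$, with $E_i^{(p)}=E_i^p/[p]_{v_i,t_i}!$,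 $F_i^{(p)}=F_i^p/[p]_{v_i,t_i}!$, $\kappa_{ij}(p,p')=(-1)^pt^{-d_ipp'+p\langle i,j\rangle-p\langle j,i\rangle}$: $\sum_{p+p'=N_{ij}}\kappa_{ij}(p,p')E_i^{(p)}E_jE_i^{(p')}=0$, $\sum_{p+p'=N_{ij}}\kappa_{ij}(p,p')F_i^{(p')}F_jF_i^{(p)}=0$. Coproduct and counit: $\Delta(K_i)=K_i\otimes K_i$, $\Delta(K_i')=K_i'\otimes K_i'$, $\Delta(E_i)=E_i\otimes1+K_i\otimes E_i$, $\Delta(F_i)=1\otimes F_i+F_i\otimes K_i'$; $\varepsilon(K_i)=\varepsilon(K_i')=1$, $\varepsilon(E_i)=\varepsilon(F_i)=0$. $U_{v,1}$ is obtained by evaluating all coefficients at $t=1$ and extending scalars from $\mathbb Q(v^{1/D})$ to $\mathbb K_D$. **Modules and transport.** An $L$-weight $U_{v,t}$-module is a finite-dimensional module $M=\bigoplus_{\lambda\in L}M_\lambda$ with $E_iM_\lambda\subseteq M_{\lambda+i}$, $F_iM_\lambda\subseteq M_{\lambda-i}$, and $K_i=v^{i\cdot\lambda}t^{\langle\lambda,i\rangle-\langle i,\lambda\rangle}$, $K_i'=v^{-i\cdot\lambda}t^{\langle\lambda,i\rangle-\langle i,\lambda\rangle}$ on $M_\lambda$; for $U_{v,1}$ put $t=1$. For an $L$-weight $U_{v,1}$-module $M$ (action denoted by superscript $(1)$), $\Phi_t(M)$ is the same weight-graded vector space with $U_{v,t}$-action, on $m_\lambda\in M_\lambda$: $K_i^{(t)}m_\lambda=v^{i\cdot\lambda}t^{\langle\lambda,i\rangle-\langle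 i,\lambda\rangle}m_\lambda$, $(K_i')^{(t)}m_\lambda=v^{-i\cdot\lambda}t^{\langle\lambda,i\rangle-\langle i,\lambda\rangle}m_\lambda$, $E_i^{(t)}m_\lambda=t^{\langle\lambda,i\rangle}E_i^{(1)}m_\lambda$, $F_i^{(t)}m_\lambda=t^{d_i-\langle i,\lambda\rangle}F_i^{(1)}m_\lambda$. Tensor comparison: $J_{M,N}:\Phi_t(M)\otimes_{\Delta_t}\Phi_t(N)\to\Phi_t(M\otimes_{\Delta_1}N)$, $J_{M,N}(m_\lambda\otimes n_\mu)=t^{\langle\mu,\lambda\rangle}m_\lambda\otimes n_\mu$ ($\Delta_t,\Delta_1$ indicate the coproduct used). Maps of $M\otimes N$ are viewed as maps of the underlying space of $\Phi_t(M\otimes N)$. **Quasi-$R$-matrix and checked $R$-matrix.** $U^+_{v,t,\nu}$ and $U^-_{v,t,-\nu}$ ($\nu\in Q^+$) are the root-degree $\nu$, $-\nu$ parts of the subalgebras generated by the $E_i$, resp. the $F_i$ ($\deg E_i=i$, $\deg F_i=-i$). $U^{\ge0}$ is generated by $E_i,K_i^{\pm1}$, $U^{\le0}$ by $F_i,(K_i')^{\pm1}$. There is a unique bilinear pairing $(\,,)_\phi:U^{\ge0}\times U^{\le0}\to\mathbb K_D$ with $(1,y)_\phi=\varepsilon(y)$, $(x,1)_\phi=\varepsilon(x)$, $(xx',y)_\phi=(x\otimes x',\Delta^{\mathrm{op}}(y))_\phi$, $(x,yy')_\phi=(\Delta(x),y\otimes y')_\phi$, $(K_\alpha,K'_\beta)_\phi=v^{\alpha\cdot\beta}t^{\langle\beta,\alpha\rangle-\langle\alpha,\beta\rangle}$,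 $(E_i,F_j)_\phi=\delta_{ij}/(v_i^{-1}-v_i)$, $(K_\alpha,F_j)_\phi=(E_i,K'_\beta)_\phi=0$ (where $K_\alpha=\prod K_i^{a_i}$ for $\alpha=\sum a_ii\in Q$, similarly $K'_\beta$, and simple tensors pair factorwise); it is nondegenerate on $U^+_{v,t,\nu}\times U^-_{v,t,-\nu}$. For a basis $\mathcal B_\nu$ of $U^-_{v,t,-\nu}$ with dual basis $\{b^\sharp\}$ of $U^+_{v,t,\nu}$ ($(b^\sharp,c)_\phi=\delta_{b,c}$), $\Theta_{t,\nu}=\sum_{b}b\otimes b^\sharp$, $\Theta_t=\sum_{\nu\in Q^+}\Theta_{t,\nu}$ (a finite sum on finite-dimensional weight modules). Let $f_t(\lambda,\mu)=v^{-\lambda\cdot\mu}t^{\langle\lambda,\mu\rangle-\langle\mu,\lambda\rangle}$, let $\widetilde f_t^{N,M}(n_\mu\otimes m_\lambda)=f_t(\mu,\lambda)n_\mu\otimes m_\lambda$, and let $P_{M,N}$ be the flip $m\otimes n\mapsto n\otimes m$. The checked $R$-matrix is $\widehat R_t^{M,N}=\Theta_t^{N,M}\widetilde f_t^{N,M}P_{M,N}$, an invertible map, where $\Theta_t^{N,M}$ is the action of $\Theta_t$ on (transported) $N\otimes M$; $\widehat R_1^{M,N}$ is the same construction for $U_{v,1}$ (all with $t=1$). *)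

theory Defs
  imports
    "HOL-Computational_Algebra.Polynomial"
    "HOL-Computational_Algebra.Fraction_Field"
    "HOL-Library.Poly_Mapping"
    "HOL-Library.Product_Plus"
    "HOL-Library.FuncSet"
    "HOL-Analysis.Finite_Cartesian_Product"
    "HOL-Algebra.QuotRing"
begin

unbundle no m_inv_syntax

section \<open>The ground field and its vector spaces\<close>

text \<open>
  The field \<open>\<rat>(v\<^bsup>1/D\<^esup>, t\<^bsup>1/D\<^esup>)\<close> is the field of rational functions in the two
  indeterminates \<open>v_root\<close> \<open>= v\<^bsup>1/D\<^esup>\<close> and \<open>t_root\<close> \<open>= t\<^bsup>1/D\<^esup>\<close>; the number \<open>D\<close> only
  enters through the meaning of the powers of \<open>v\<close> and \<open>t\<close>.
\<close>

type_synonym KD = "rat poly poly fract"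

definition v_root :: KD where "v_root = Fract [:[:0, 1:]:] 1"
definition t_root :: KD where "t_root = Fract [:0, 1:] 1"

class kd_space = ab_group_add +
  fixes kscale :: "KD \<Rightarrow> 'a \<Rightarrow> 'a" (infixr \<open>*\<^sub>K\<close> 75)
  assumes kscale_add_right: "c *\<^sub>K (x + y) = c *\<^sub>K x + c *\<^sub>K y"
    and kscale_add_left: "(c + d) *\<^sub>K x = c *\<^sub>K x + d *\<^sub>K x"
    and kscale_kscale: "c *\<^sub>K (d *\<^sub>K x) = (c * d) *\<^sub>K x"
    and kscale_one: "1 *\<^sub>K x = x"

global_interpretation kd: vector_space "kscale :: KD \<Rightarrow> 'a::kd_space \<Rightarrow> 'a"
  by standard (simp_all add: kscale_add_right kscale_add_left kscale_kscale kscale_one)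

abbreviation kd_linear :: "('a::kd_space \<Rightarrow> 'b::kd_space) \<Rightarrow> bool" where
  "kd_linear \<equiv> Vector_Spaces.linear kscale kscale"

definition kd_bilinear :: "('a::kd_space \<Rightarrow> 'b::kd_space \<Rightarrow> 'c::kd_space) \<Rightarrow> bool" where
  "kd_bilinear f \<longleftrightarrow> (\<forall>b. kd_linear (\<lambda>a. f a b)) \<and> (\<forall>a. kd_linear (f a))"

definition kd_finite_dim :: "'a::kd_space itself \<Rightarrow> bool" where
  "kd_finite_dim _ \<longleftrightarrow> (\<exists>B :: 'a set. finite B \<and> kd.span B = UNIV)"


subsection \<open>Tensor products\<close>

definition pm_scale :: "KD \<Rightarrow> ('x \<Rightarrow>\<^sub>0 KD) \<Rightarrow> ('x \<Rightarrow>\<^sub>0 KD)" where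
  "pm_scale c = Poly_Mapping.map ((*) c)"

lemma lookup_pm_scale [simp]: "Poly_Mapping.lookup (pm_scale c p) x = c * Poly_Mapping.lookup p x"
  by (simp add: pm_scale_def Poly_Mapping.map.rep_eq when_def)

global_interpretation pm: vector_space "pm_scale :: KD \<Rightarrow> ('x \<Rightarrow>\<^sub>0 KD) \<Rightarrow> _"
  by standard (auto intro!: poly_mapping_eqI simp: lookup_add algebra_simps)

text \<open>\<open>M \<otimes> N\<close> is the free vector space on the set \<open>M \<times> N\<close> modulo the bilinearity relations.\<close>

definition tensor_relators :: "(('a::kd_space \<times> 'b::kd_space) \<Rightarrow>\<^sub>0 KD) set" where
  "tensor_relators =
     {Poly_Mapping.single (a + a', b) 1 - Poly_Mapping.single (a, b) 1 - Poly_Mapping.single (a', b) 1 | a a' b. True}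
   \<union> {Poly_Mapping.single (a, b + b') 1 - Poly_Mapping.single (a, b) 1 - Poly_Mapping.single (a, b') 1 | a b b'. True}
   \<union> {Poly_Mapping.single (c *\<^sub>K a, b) 1 - Poly_Mapping.single (a, b) c | c a b. True}
   \<union> {Poly_Mapping.single (a, c *\<^sub>K b) 1 - Poly_Mapping.single (a, b) c | c a b. True}"

definition tensor_rel ::
    "(('a::kd_space \<times> 'b::kd_space) \<Rightarrow>\<^sub>0 KD) \<Rightarrow> (('a \<times> 'b) \<Rightarrow>\<^sub>0 KD) \<Rightarrow> bool" where
  "tensor_rel p q \<longleftrightarrow> p - q \<in> pm.span tensor_relators"

quotient_type (overloaded) ('a, 'b) tensor =
    "('a::kd_space \<times> 'b::kd_space) \<Rightarrow>\<^sub>0 KD" / tensor_rel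
proof (rule equivpI)
  show "reflp (tensor_rel :: (('a \<times> 'b) \<Rightarrow>\<^sub>0 KD) \<Rightarrow> _)"
    by (simp add: reflp_def tensor_rel_def pm.span_zero)
  show "symp (tensor_rel :: (('a \<times> 'b) \<Rightarrow>\<^sub>0 KD) \<Rightarrow> _)"
    unfolding symp_def tensor_rel_def using pm.span_neg by fastforce
  show "transp (tensor_rel :: (('a \<times> 'b) \<Rightarrow>\<^sub>0 KD) \<Rightarrow> _)"
    unfolding transp_def tensor_rel_def using pm.span_add by fastforce
qed

instantiation tensor :: (kd_space, kd_space) kd_space
begin

lift_definition zero_tensor :: "('a, 'b) tensor" is 0 .

lift_definition plus_tensor :: "('a, 'b) tensor \<Rightarrow> ('a, 'b) tensor \<Rightarrow> ('a, 'b) tensor" is "(+)"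
  unfolding tensor_rel_def add_diff_add by (rule pm.span_add)

lift_definition uminus_tensor :: "('a, 'b) tensor \<Rightarrow> ('a, 'b) tensor" is uminus
  unfolding tensor_rel_def minus_diff_minus by (rule pm.span_neg)

lift_definition minus_tensor :: "('a, 'b) tensor \<Rightarrow> ('a, 'b) tensor \<Rightarrow> ('a, 'b) tensor" is "(-)"
proof -
  fix p p' q q' :: "('a \<times> 'b) \<Rightarrow>\<^sub>0 KD"
  assume "tensor_rel p p'" "tensor_rel q q'"
  then have "(p - p') - (q - q') \<in> pm.span tensor_relators"
    unfolding tensor_rel_def by (rule pm.span_diff)
  also have "(p - p') - (q - q') = (p - q) - (p' - q')" by simp
  finally show "tensor_rel (p - q) (p' - q')" unfolding tensor_rel_def .
qed

lift_definition kscale_tensor :: "KD \<Rightarrow> ('a, 'b) tensor \<Rightarrow> ('a, 'b) tensor" is pm_scale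
  unfolding tensor_rel_def pm.scale_right_diff_distrib[symmetric] by (rule pm.span_scale)

instance
proof
  fix x y z :: "('a, 'b) tensor" and c d :: KD
  show "x + y + z = x + (y + z)" by transfer (simp add: tensor_rel_def pm.span_zero add.assoc)
  show "x + y = y + x" by transfer (simp add: tensor_rel_def pm.span_zero)
  show "0 + x = x" by transfer (simp add: tensor_rel_def pm.span_zero)
  show "- x + x = 0" by transfer (simp add: tensor_rel_def pm.span_zero)
  show "x - y = x + - y" by transfer (simp add: tensor_rel_def pm.span_zero)
  show "c *\<^sub>K (x + y) = c *\<^sub>K x + c *\<^sub>K y"
    by transfer (simp add: tensor_rel_def pm.span_zero pm.scale_right_distrib)
  show "(c + d) *\<^sub>K x = c *\<^sub>K x + d *\<^sub>K x"
    by transfer (simp add: tensor_rel_def pm.span_zero pm.scale_left_distrib)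
  show "c *\<^sub>K (d *\<^sub>K x) = (c * d) *\<^sub>K x" by transfer (simp add: tensor_rel_def pm.span_zero)
  show "1 *\<^sub>K x = x" by transfer (simp add: tensor_rel_def pm.span_zero)
qed

end

lift_definition tens :: "'a::kd_space \<Rightarrow> 'b::kd_space \<Rightarrow> ('a, 'b) tensor"  (infixr \<open>\<otimes>\<^sub>K\<close> 76)
  is "\<lambda>a b. Poly_Mapping.single (a, b) 1" .

text \<open>
  The linear map on the tensor product induced by a bilinear map; it is evaluated on an arbitrary
  representative (see \<open>tensor_lift_tens\<close> and \<open>kd_linear_tensor_lift\<close>).
\<close>

definition free_lift ::
    "('a::kd_space \<Rightarrow> 'b::kd_space \<Rightarrow> 'c::kd_space) \<Rightarrow> (('a \<times> 'b) \<Rightarrow>\<^sub>0 KD) \<Rightarrow> 'c" where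
  "free_lift f p = (\<Sum>(a, b) \<in> Poly_Mapping.keys p. Poly_Mapping.lookup p (a, b) *\<^sub>K f a b)"

definition tensor_lift ::
    "('a::kd_space \<Rightarrow> 'b::kd_space \<Rightarrow> 'c::kd_space) \<Rightarrow> ('a, 'b) tensor \<Rightarrow> 'c" where
  "tensor_lift f z = free_lift f (rep_tensor z)"

definition tensor_map ::
    "('a::kd_space \<Rightarrow> 'c::kd_space) \<Rightarrow> ('b::kd_space \<Rightarrow> 'd::kd_space) \<Rightarrow> ('a, 'b) tensor \<Rightarrow> ('c, 'd) tensor" where
  "tensor_map f g = tensor_lift (\<lambda>a b. f a \<otimes>\<^sub>K g b)"

definition tensor_flip :: "('a::kd_space, 'b::kd_space) tensor \<Rightarrow> ('b, 'a) tensor" where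
  "tensor_flip = tensor_lift (\<lambda>a b. b \<otimes>\<^sub>K a)"

lemma free_lift_superset:
  assumes "finite A" "Poly_Mapping.keys p \<subseteq> A"
  shows "free_lift f p = (\<Sum>(a, b) \<in> A. Poly_Mapping.lookup p (a, b) *\<^sub>K f a b)"
  unfolding free_lift_def
  by (rule sum.mono_neutral_left) (use assms in \<open>auto simp: in_keys_iff\<close>)

lemma free_lift_single: "free_lift f (Poly_Mapping.single (a, b) c) = c *\<^sub>K f a b"
  by (subst free_lift_superset[where A = "{(a, b)}"]) auto

lemma free_lift_add: "free_lift f (p + q) = free_lift f p + free_lift f q"
proof -
  let ?A = "Poly_Mapping.keys p \<union> Poly_Mapping.keys q"
  have "free_lift f r = (\<Sum>(a, b) \<in> ?A. Poly_Mapping.lookup r (a, b) *\<^sub>K f a b)" if "Poly_Mapping.keys r \<subseteq> ?A" for r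
    by (rule free_lift_superset) (use that in auto)
  from this[of p] this[of q] this[of "p + q"] show ?thesis
    using Poly_Mapping.keys_add[of p q]
    by (simp add: lookup_add kd.scale_left_distrib sum.distrib split_def)
qed

lemma free_lift_scale: "free_lift f (pm_scale c p) = c *\<^sub>K free_lift f p"
proof -
  have "Poly_Mapping.keys (pm_scale c p) \<subseteq> Poly_Mapping.keys p" by (auto simp: in_keys_iff)
  then have "free_lift f (pm_scale c p) = (\<Sum>(a, b) \<in> Poly_Mapping.keys p. Poly_Mapping.lookup (pm_scale c p) (a, b) *\<^sub>K f a b)"
    by (intro free_lift_superset) auto
  then show ?thesis
    by (simp add: free_lift_def kd.scale_sum_right split_def)
qed

lemma kd_linear_free_lift: "Vector_Spaces.linear pm_scale kscale (free_lift f)"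
  by unfold_locales (simp_all add: free_lift_add free_lift_scale)

lemma free_lift_null:
  assumes f: "kd_bilinear f" and p: "p \<in> pm.span tensor_relators"
  shows "free_lift f p = 0"
proof -
  interpret F: Vector_Spaces.linear pm_scale kscale "free_lift f" by (rule kd_linear_free_lift)
  have l: "kd_linear (\<lambda>a. f a b)" "kd_linear (f a)" for a b
    using f by (auto simp: kd_bilinear_def)
  have fs: "f (a + a') b = f a b + f a' b" "f (c *\<^sub>K a) b = c *\<^sub>K f a b"
    "f a (b + b') = f a b + f a b'" "f a (c *\<^sub>K b) = c *\<^sub>K f a b" for a a' b b' c
    using l by (simp_all add: Vector_Spaces.linear_iff)
  have "free_lift f r = 0" if "r \<in> tensor_relators" for r
    using that unfolding tensor_relators_def
    apply (elim UnE CollectE exE conjE)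
       apply (simp add: F.diff free_lift_single fs)
      apply (simp add: F.diff free_lift_single fs)
     apply (simp add: F.diff free_lift_single fs)
    apply (simp add: F.diff free_lift_single fs)
    done
  then show ?thesis
    using p by (rule F.eq_0_on_span)
qed

lemma free_lift_rep:
  assumes "kd_bilinear f" shows "tensor_lift f (abs_tensor p) = free_lift f p"
proof -
  interpret F: Vector_Spaces.linear pm_scale kscale "free_lift f" by (rule kd_linear_free_lift)
  have "tensor_rel (rep_tensor (abs_tensor p)) p"
    by (rule rep_abs_rsp_left[OF Quotient3_tensor]) (simp add: tensor_rel_def pm.span_zero)
  then show ?thesis
    using free_lift_null[OF assms, of "rep_tensor (abs_tensor p) - p"]
    by (simp add: tensor_rel_def tensor_lift_def F.diff)
qed

lemma tensor_lift_tens: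
  assumes "kd_bilinear f" shows "tensor_lift f (a \<otimes>\<^sub>K b) = f a b"
  using assms by (simp add: tens.abs_eq free_lift_rep free_lift_single kscale_one)

lemma kd_linear_tensor_lift:
  assumes "kd_bilinear f" shows "kd_linear (tensor_lift f)"
proof -
  have "tensor_lift f (x + y) = tensor_lift f x + tensor_lift f y" for x y
    by (induct x, induct y) (simp add: plus_tensor.abs_eq free_lift_rep[OF assms] free_lift_add)
  moreover have "tensor_lift f (c *\<^sub>K x) = c *\<^sub>K tensor_lift f x" for c x
    by (induct x) (simp add: kscale_tensor.abs_eq free_lift_rep[OF assms] free_lift_scale)
  ultimately show ?thesis by (simp add: Vector_Spaces.linear_iff kd.vector_space_axioms)
qed


lemma pm_scale_single: "pm_scale c (Poly_Mapping.single x 1) = Poly_Mapping.single x c"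
  by (simp add: pm_scale_def)

lemma kd_bilinear_tens: "kd_bilinear (\<otimes>\<^sub>K)"
proof -
  have "(a + a') \<otimes>\<^sub>K b = a \<otimes>\<^sub>K b + a' \<otimes>\<^sub>K b" for a a' :: 'a and b :: 'b
    by transfer (unfold tensor_rel_def tensor_relators_def diff_diff_add[symmetric], rule pm.span_base, blast)
  moreover have "a \<otimes>\<^sub>K (b + b') = a \<otimes>\<^sub>K b + a \<otimes>\<^sub>K b'" for a :: 'a and b b' :: 'b
    by transfer (unfold tensor_rel_def tensor_relators_def diff_diff_add[symmetric], rule pm.span_base, blast)
  moreover have "(c *\<^sub>K a) \<otimes>\<^sub>K b = c *\<^sub>K (a \<otimes>\<^sub>K b)" for c and a :: 'a and b :: 'b
    by transfer (unfold tensor_rel_def tensor_relators_def pm_scale_single, rule pm.span_base, blast)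
  moreover have "a \<otimes>\<^sub>K (c *\<^sub>K b) = c *\<^sub>K (a \<otimes>\<^sub>K b)" for c and a :: 'a and b :: 'b
    by transfer (unfold tensor_rel_def tensor_relators_def pm_scale_single, rule pm.span_base, blast)
  ultimately show ?thesis
    by (simp add: kd_bilinear_def Vector_Spaces.linear_iff kd.vector_space_axioms)
qed


section \<open>Cartan data and weight lattices\<close>

text \<open>
  \<open>\<Omega>\<close> is a matrix indexed by a finite type \<open>'i\<close>, and \<open>Q \<otimes> \<rat>\<close> is \<open>rat ^ 'i\<close>, the simple root \<open>i\<close>
  being the \<open>i\<close>-th unit vector. The form \<open>\<langle>x, y\<rangle>\<close> is \<open>angle \<Omega> x y\<close> and \<open>x \<cdot> y\<close> is \<open>sdot \<Omega> x y\<close>.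
\<close>

definition simple_root :: "'i::finite \<Rightarrow> rat ^ 'i" where "simple_root i = axis i 1"

definition angle :: "('i::finite \<Rightarrow> 'i \<Rightarrow> int) \<Rightarrow> rat ^ 'i \<Rightarrow> rat ^ 'i \<Rightarrow> rat" where
  "angle \<Omega> x y = (\<Sum>i\<in>UNIV. \<Sum>j\<in>UNIV. x $ i * y $ j * of_int (\<Omega> i j))"

definition sdot :: "('i::finite \<Rightarrow> 'i \<Rightarrow> int) \<Rightarrow> rat ^ 'i \<Rightarrow> rat ^ 'i \<Rightarrow> rat" where
  "sdot \<Omega> x y = angle \<Omega> x y + angle \<Omega> y x"

definition ht :: "('i::finite \<Rightarrow> 'i \<Rightarrow> int) \<Rightarrow> rat ^ 'i \<Rightarrow> rat" where
  "ht \<Omega> x = (\<Sum>i\<in>UNIV. of_int (\<Omega> i i) * x $ i)"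

definition cartan_datum :: "('i::finite \<Rightarrow> 'i \<Rightarrow> int) \<Rightarrow> bool" where
  "cartan_datum \<Omega> \<longleftrightarrow>
     (\<forall>i. \<Omega> i i > 0) \<and>
     (\<forall>i j. i \<noteq> j \<longrightarrow> \<Omega> i j \<le> 0 \<and> \<Omega> i i dvd (\<Omega> i j + \<Omega> j i) \<and> (\<Omega> i j + \<Omega> j i) div \<Omega> i i \<le> 0) \<and>
     Gcd (range (\<lambda>i. \<Omega> i i)) = 1"

definition finite_type :: "('i::finite \<Rightarrow> 'i \<Rightarrow> int) \<Rightarrow> bool" where
  "finite_type \<Omega> \<longleftrightarrow> (\<forall>x. x \<noteq> 0 \<longrightarrow> sdot \<Omega> x x > 0)"

definition root_lattice :: "(rat ^ 'i::finite) set" where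
  "root_lattice = {x. \<forall>i. x $ i \<in> \<int>}"

definition pos_root_lattice :: "(rat ^ 'i::finite) set" where
  "pos_root_lattice = {x. \<forall>i. x $ i \<in> \<nat>}"

text \<open>Freeness of \<open>L\<close> is automatic: \<open>L\<close> is torsion free, and finitely generated as \<open>[L : Q] < \<infinity>\<close>.\<close>

definition admissible_lattice :: "(rat ^ 'i::finite) set \<Rightarrow> bool" where
  "admissible_lattice L \<longleftrightarrow>
     (\<forall>x\<in>L. \<forall>y\<in>L. x - y \<in> L) \<and> root_lattice \<subseteq> L \<and>
     finite (L // {(x, y). x \<in> L \<and> y \<in> L \<and> x - y \<in> root_lattice})"

definition common_denominator :: "('i::finite \<Rightarrow> 'i \<Rightarrow> int) \<Rightarrow> (rat ^ 'i) set \<Rightarrow> nat \<Rightarrow> bool" where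
  "common_denominator \<Omega> L D \<longleftrightarrow> D > 0 \<and>
     (\<forall>x\<in>L. \<forall>y\<in>L. of_nat D * sdot \<Omega> x y \<in> \<int> \<and> of_nat D * angle \<Omega> x y \<in> \<int>) \<and>
     (\<forall>x\<in>L. of_nat D * ht \<Omega> x \<in> \<int>)"


section \<open>Free algebras\<close>

datatype 'a fword = Word (letters: "'a list")

instantiation fword :: (type) monoid_add
begin

definition zero_fword :: "'a fword" where "zero_fword = Word []"
definition plus_fword :: "'a fword \<Rightarrow> 'a fword \<Rightarrow> 'a fword" where
  "plus_fword w w' = Word (letters w @ letters w')"

instance by standard (simp_all add: zero_fword_def plus_fword_def)

end

datatype 'i qgen = Eg 'i | Fg 'i | Kg 'i | Kg_inv 'i | K'g 'i | K'g_inv 'i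

text \<open>
  The free algebra on the generators is the monoid algebra of the words, and its tensor square is
  the monoid algebra of the pairs of words.
\<close>

type_synonym 'i falg = "'i qgen fword \<Rightarrow>\<^sub>0 KD"
type_synonym 'i falg2 = "('i qgen fword \<times> 'i qgen fword) \<Rightarrow>\<^sub>0 KD"
type_synonym 'i uelem = "'i falg set"

definition free_ring :: "'i falg ring" where
  "free_ring = \<lparr>carrier = UNIV, monoid.mult = (*), one = 1, zero = 0, add = (+)\<rparr>"

lemma ring_free_ring: "ring free_ring"
proof (intro ringI abelian_groupI monoidI)
  fix x :: "'i falg"
  assume "x \<in> carrier free_ring"
  then show "\<exists>y\<in>carrier free_ring. y \<oplus>\<^bsub>free_ring\<^esub> x = \<zero>\<^bsub>free_ring\<^esub>"
    by (intro bexI[of _ "- x"]) (simp_all add: free_ring_def)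
qed (simp_all add: free_ring_def algebra_simps)

definition gen :: "'i qgen \<Rightarrow> 'i falg" where "gen g = Poly_Mapping.single (Word [g]) 1"

definition scalar :: "KD \<Rightarrow> 'i falg" where "scalar c = Poly_Mapping.single 0 c"

text \<open>The subalgebra of the free algebra generated by a set of generators.\<close>

definition free_subalg :: "'i qgen set \<Rightarrow> 'i falg set" where
  "free_subalg S = {x. \<forall>w \<in> Poly_Mapping.keys x. set (letters w) \<subseteq> S}"

fun root_deg :: "'i::finite qgen \<Rightarrow> rat ^ 'i" where
  "root_deg (Eg i) = simple_root i"
| "root_deg (Fg i) = - simple_root i"
| "root_deg _ = 0"

fun torus_deg :: "'i::finite qgen \<Rightarrow> rat ^ 'i" where
  "torus_deg (Kg i) = simple_root i"
| "torus_deg (Kg_inv i) = - simple_root i"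
| "torus_deg (K'g i) = simple_root i"
| "torus_deg (K'g_inv i) = - simple_root i"
| "torus_deg _ = 0"

definition word_deg :: "('i::finite qgen \<Rightarrow> rat ^ 'i) \<Rightarrow> 'i qgen fword \<Rightarrow> rat ^ 'i" where
  "word_deg d w = sum_list (map d (letters w))"

definition free_homog :: "'i::finite qgen set \<Rightarrow> rat ^ 'i \<Rightarrow> 'i falg set" where
  "free_homog S \<nu> = {x \<in> free_subalg S. \<forall>w \<in> Poly_Mapping.keys x. word_deg root_deg w = \<nu>}"

text \<open>
  Coproduct and counit, lifted to the free algebra; those of \<open>U\<^bsub>v,t\<^esub>\<close> are induced by these maps.
\<close>

fun coprod_gen :: "'i qgen \<Rightarrow> 'i falg2" where
  "coprod_gen (Eg i) = Poly_Mapping.single (Word [Eg i], 0) 1 + Poly_Mapping.single (Word [Kg i], Word [Eg i]) 1"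
| "coprod_gen (Fg i) = Poly_Mapping.single (0, Word [Fg i]) 1 + Poly_Mapping.single (Word [Fg i], Word [K'g i]) 1"
| "coprod_gen g = Poly_Mapping.single (Word [g], Word [g]) 1"

definition coprod :: "'i falg \<Rightarrow> 'i falg2" where
  "coprod x = (\<Sum>w \<in> Poly_Mapping.keys x.
     pm_scale (Poly_Mapping.lookup x w) (prod_list (map coprod_gen (letters w))))"

fun counit_gen :: "'i qgen \<Rightarrow> KD" where
  "counit_gen (Eg i) = 0"
| "counit_gen (Fg i) = 0"
| "counit_gen _ = 1"

definition counit :: "'i falg \<Rightarrow> KD" where
  "counit x = (\<Sum>w \<in> Poly_Mapping.keys x.
     Poly_Mapping.lookup x w * prod_list (map counit_gen (letters w)))"


section \<open>Weight gradings\<close>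

definition is_decomposition :: "('w \<Rightarrow> 'm::kd_space set) \<Rightarrow> 'm \<Rightarrow> ('w \<Rightarrow> 'm) \<Rightarrow> bool" where
  "is_decomposition W m c \<longleftrightarrow>
     (\<forall>\<gamma>. c \<gamma> \<in> W \<gamma>) \<and> finite {\<gamma>. c \<gamma> \<noteq> 0} \<and> m = (\<Sum>\<gamma> | c \<gamma> \<noteq> 0. c \<gamma>)"

definition is_grading :: "'w set \<Rightarrow> ('w \<Rightarrow> 'm::kd_space set) \<Rightarrow> bool" where
  "is_grading L W \<longleftrightarrow>
     (\<forall>\<gamma>. kd.subspace (W \<gamma>)) \<and> (\<forall>\<gamma>. \<gamma> \<notin> L \<longrightarrow> W \<gamma> = {0}) \<and> (\<forall>m. \<exists>!c. is_decomposition W m c)"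

definition component :: "('w \<Rightarrow> 'm::kd_space set) \<Rightarrow> 'm \<Rightarrow> 'w \<Rightarrow> 'm" where
  "component W m = (THE c. is_decomposition W m c)"

text \<open>The linear map with \<open>m\<^sub>\<gamma> \<mapsto> a(\<gamma>) f(m\<^sub>\<gamma>)\<close> for \<open>m\<^sub>\<gamma> \<in> M\<^sub>\<gamma>\<close>, where \<open>f\<close> is linear.\<close>

definition graded_op :: "('w \<Rightarrow> 'm::kd_space set) \<Rightarrow> ('w \<Rightarrow> KD) \<Rightarrow> ('m \<Rightarrow> 'm) \<Rightarrow> 'm \<Rightarrow> 'm" where
  "graded_op W a f m = (\<Sum>\<gamma> | component W m \<gamma> \<noteq> 0. a \<gamma> *\<^sub>K f (component W m \<gamma>))"

text \<open>The linear map with \<open>m\<^sub>\<gamma> \<otimes> n\<^sub>\<mu> \<mapsto> a(\<gamma>, \<mu>) m\<^sub>\<gamma> \<otimes> n\<^sub>\<mu>\<close>.\<close>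

definition tensor_graded_scale ::
    "('w \<Rightarrow> 'm::kd_space set) \<Rightarrow> ('w \<Rightarrow> 'n::kd_space set) \<Rightarrow> ('w \<Rightarrow> 'w \<Rightarrow> KD)
      \<Rightarrow> ('m, 'n) tensor \<Rightarrow> ('m, 'n) tensor" where
  "tensor_graded_scale W W' a = tensor_lift (\<lambda>m n.
     \<Sum>\<gamma> | component W m \<gamma> \<noteq> 0. \<Sum>\<mu> | component W' n \<mu> \<noteq> 0.
       a \<gamma> \<mu> *\<^sub>K (component W m \<gamma> \<otimes>\<^sub>K component W' n \<mu>))"

text \<open>A weight module consists of the operators of the generators and the weight spaces.\<close>

record ('i, 'm) wmod =
  act :: "'i qgen \<Rightarrow> 'm \<Rightarrow> 'm"
  wt :: "rat ^ 'i \<Rightarrow> 'm set"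

definition free_act :: "('i::finite, 'm::kd_space) wmod \<Rightarrow> 'i falg \<Rightarrow> 'm \<Rightarrow> 'm" where
  "free_act M x m = (\<Sum>w \<in> Poly_Mapping.keys x. Poly_Mapping.lookup x w *\<^sub>K foldr (act M) (letters w) m)"

text \<open>An element of \<open>U\<^bsub>v,t\<^esub>\<close> is a coset; it acts by the common action of its representatives.\<close>

definition u_act :: "('i::finite, 'm::kd_space) wmod \<Rightarrow> 'i uelem \<Rightarrow> 'm \<Rightarrow> 'm" where
  "u_act M u = the_elem (free_act M ` u)"


section \<open>The algebra, its modules and the checked R-matrix\<close>

text \<open>
  The parameter \<open>\<tau>\<close> is the value of \<open>t\<^bsup>1/D\<^esup>\<close>: \<open>\<tau> =\<close> \<open>t_root\<close> gives \<open>U\<^bsub>v,t\<^esub>\<close> and \<open>\<tau> = 1\<close> gives \<open>U\<^bsub>v,1\<^esub>\<close>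
  (with scalars extended to \<open>\<rat>(v\<^bsup>1/D\<^esup>, t\<^bsup>1/D\<^esup>)\<close>).
\<close>

locale qgroup =
  fixes \<Omega> :: "'i::finite \<Rightarrow> 'i \<Rightarrow> int" and D :: nat and \<tau> :: KD
begin

abbreviation ang :: "rat ^ 'i \<Rightarrow> rat ^ 'i \<Rightarrow> rat" where "ang \<equiv> angle \<Omega>"
abbreviation dot :: "rat ^ 'i \<Rightarrow> rat ^ 'i \<Rightarrow> rat"  (infixl \<open>\<bullet>\<bullet>\<close> 70) where "dot \<equiv> sdot \<Omega>"

text \<open>\<open>v\<^sup>a\<close> and \<open>t\<^sup>a\<close> for \<open>a \<in> D\<^bsup>-1\<^esup>\<int>\<close>.\<close>

definition vpow :: "rat \<Rightarrow> KD" where "vpow a = v_root powi \<lfloor>of_nat D * a\<rfloor>"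
definition tpow :: "rat \<Rightarrow> KD" where "tpow a = \<tau> powi \<lfloor>of_nat D * a\<rfloor>"

definition dd :: "'i \<Rightarrow> rat" where "dd i = of_int (\<Omega> i i)"
definition vi :: "'i \<Rightarrow> KD" where "vi i = vpow (dd i)"
definition ti :: "'i \<Rightarrow> KD" where "ti i = tpow (dd i)"

definition cartan :: "'i \<Rightarrow> 'i \<Rightarrow> int" where "cartan i j = (\<Omega> i j + \<Omega> j i) div \<Omega> i i"

definition qnum :: "'i \<Rightarrow> nat \<Rightarrow> KD" where
  "qnum i p = ((vi i * ti i) powi int p - (vi i * inverse (ti i)) powi (- int p))
               / (vi i * ti i - inverse (vi i * inverse (ti i)))"

definition qfact :: "'i \<Rightarrow> nat \<Rightarrow> KD" where "qfact i p = (\<Prod>r = 1..p. qnum i r)"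

definition divpow :: "'i \<Rightarrow> nat \<Rightarrow> 'i falg \<Rightarrow> 'i falg" where
  "divpow i p x = scalar (inverse (qfact i p)) * x ^ p"

definition kappa :: "'i \<Rightarrow> 'i \<Rightarrow> nat \<Rightarrow> nat \<Rightarrow> KD" where
  "kappa i j p p' = (- 1) ^ p * tpow (- dd i * of_nat p * of_nat p'
     + of_nat p * ang (simple_root i) (simple_root j) - of_nat p * ang (simple_root j) (simple_root i))"

definition torus_relators :: "'i falg set" where
  "torus_relators =
     (\<Union>i. {gen (Kg i) * gen (Kg_inv i) - 1, gen (Kg_inv i) * gen (Kg i) - 1,
           gen (K'g i) * gen (K'g_inv i) - 1, gen (K'g_inv i) * gen (K'g i) - 1})
   \<union> (\<Union>i j. {gen (Kg i) * gen (Kg j) - gen (Kg j) * gen (Kg i),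
             gen (K'g i) * gen (K'g j) - gen (K'g j) * gen (K'g i),
             gen (Kg i) * gen (K'g j) - gen (K'g j) * gen (Kg i)})"

definition weight_relators :: "'i falg set" where
  "weight_relators = (\<Union>i j.
     let \<alpha> = simple_root i; \<beta> = simple_root j; s = ang \<beta> \<alpha> - ang \<alpha> \<beta> in
     {gen (Kg i) * gen (Eg j) * gen (Kg_inv i) - scalar (vpow (\<alpha> \<bullet>\<bullet> \<beta>) * tpow s) * gen (Eg j),
      gen (K'g i) * gen (Eg j) * gen (K'g_inv i) - scalar (vpow (- (\<alpha> \<bullet>\<bullet> \<beta>)) * tpow s) * gen (Eg j),
      gen (Kg i) * gen (Fg j) * gen (Kg_inv i) - scalar (vpow (- (\<alpha> \<bullet>\<bullet> \<beta>)) * tpow (- s)) * gen (Fg j),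
      gen (K'g i) * gen (Fg j) * gen (K'g_inv i) - scalar (vpow (\<alpha> \<bullet>\<bullet> \<beta>) * tpow (- s)) * gen (Fg j)})"

definition commutator_relators :: "'i falg set" where
  "commutator_relators = (\<Union>i j.
     {gen (Eg i) * gen (Fg j) - gen (Fg j) * gen (Eg i)
        - (if i = j then scalar (inverse (vi i - inverse (vi i))) * (gen (Kg i) - gen (K'g i)) else 0)})"

definition serre_relators :: "'i falg set" where
  "serre_relators = (\<Union>i. \<Union>j\<in>{j. j \<noteq> i}.
     let N = nat (1 - cartan i j) in
     {\<Sum>p\<le>N. scalar (kappa i j p (N - p))
         * (divpow i p (gen (Eg i)) * gen (Eg j) * divpow i (N - p) (gen (Eg i))),
      \<Sum>p\<le>N. scalar (kappa i j p (N - p))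
         * (divpow i (N - p) (gen (Fg i)) * gen (Fg j) * divpow i p (gen (Fg i)))})"

definition relators :: "'i falg set" where
  "relators = torus_relators \<union> weight_relators \<union> commutator_relators \<union> serre_relators"

definition U :: "'i uelem ring" where
  "U = free_ring Quot (Idl\<^bsub>free_ring\<^esub> relators)"

lemma ring_U: "ring U"
proof -
  interpret R: ring free_ring by (rule ring_free_ring)
  have "ideal (Idl\<^bsub>free_ring\<^esub> relators) free_ring"
    by (rule R.genideal_ideal) (simp add: free_ring_def)
  then show ?thesis unfolding U_def by (rule ideal.quotient_is_ring)
qed

text \<open>The projection of the free algebra onto \<open>U\<close>.\<close>

definition cls :: "'i falg \<Rightarrow> 'i uelem" where
  "cls x = (Idl\<^bsub>free_ring\<^esub> relators) +>\<^bsub>free_ring\<^esub> x"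

definition U_scale :: "KD \<Rightarrow> 'i uelem \<Rightarrow> 'i uelem" where
  "U_scale c u = cls (scalar c) \<otimes>\<^bsub>U\<^esub> u"

definition U_pos :: "rat ^ 'i \<Rightarrow> 'i uelem set" where
  "U_pos \<nu> = cls ` free_homog (range Eg) \<nu>"

definition U_neg :: "rat ^ 'i \<Rightarrow> 'i uelem set" where
  "U_neg \<nu> = cls ` free_homog (range Fg) (- \<nu>)"

definition is_basis :: "'i uelem set \<Rightarrow> 'i uelem set \<Rightarrow> bool" where
  "is_basis V B \<longleftrightarrow> finite B \<and> B \<subseteq> V \<and>
     (\<forall>x\<in>V. \<exists>!c. c \<in> B \<rightarrow>\<^sub>E UNIV \<and> x = (\<Oplus>\<^bsub>U\<^esub>b\<in>B. U_scale (c b) b))"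

text \<open>
  The bilinear pairing on \<open>U\<^bsup>\<ge>0\<^esup> \<times> U\<^bsup>\<le>0\<^esup>\<close> (the values of \<open>\<phi>\<close> outside are irrelevant). Elements of
  \<open>U\<close> are written as classes of elements of the free algebra, so that \<open>\<Delta>(y)\<close> becomes a finite
  linear combination of pairs of words. A word in the \<open>K\<^sub>i\<^bsup>\<plusminus>1\<^esup>\<close> of total exponent \<open>\<alpha>\<close> represents
  \<open>K\<^sub>\<alpha>\<close>, and likewise for the \<open>K'\<^sub>\<beta>\<close>.
\<close>

definition is_pairing :: "('i uelem \<Rightarrow> 'i uelem \<Rightarrow> KD) \<Rightarrow> bool" where
  "is_pairing \<phi> \<longleftrightarrow>
    (let wd = (\<lambda>w. cls (Poly_Mapping.single w 1));
         pos = free_subalg (range Eg \<union> range Kg \<union> range Kg_inv);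
         neg = free_subalg (range Fg \<union> range K'g \<union> range K'g_inv);
         torus = {w. set (letters w) \<subseteq> range Kg \<union> range Kg_inv};
         torus' = {w. set (letters w) \<subseteq> range K'g \<union> range K'g_inv}
     in
       (\<forall>x\<in>pos. \<forall>x'\<in>pos. \<forall>y\<in>neg. \<phi> (cls (x + x')) (cls y) = \<phi> (cls x) (cls y) + \<phi> (cls x') (cls y)) \<and>
       (\<forall>x\<in>pos. \<forall>y\<in>neg. \<forall>y'\<in>neg. \<phi> (cls x) (cls (y + y')) = \<phi> (cls x) (cls y) + \<phi> (cls x) (cls y')) \<and>
       (\<forall>c. \<forall>x\<in>pos. \<forall>y\<in>neg. \<phi> (cls (scalar c * x)) (cls y) = c * \<phi> (cls x) (cls y)) \<and>
       (\<forall>c. \<forall>x\<in>pos. \<forall>y\<in>neg. \<phi> (cls x) (cls (scalar c * y)) = c * \<phi> (cls x) (cls y)) \<and>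
       (\<forall>y\<in>neg. \<phi> (cls 1) (cls y) = counit y) \<and>
       (\<forall>x\<in>pos. \<phi> (cls x) (cls 1) = counit x) \<and>
       (\<forall>x\<in>pos. \<forall>x'\<in>pos. \<forall>y\<in>neg. \<phi> (cls (x * x')) (cls y) =
          (\<Sum>(u, u') \<in> Poly_Mapping.keys (coprod y).
             Poly_Mapping.lookup (coprod y) (u, u') * (\<phi> (cls x) (wd u') * \<phi> (cls x') (wd u)))) \<and>
       (\<forall>x\<in>pos. \<forall>y\<in>neg. \<forall>y'\<in>neg. \<phi> (cls x) (cls (y * y')) =
          (\<Sum>(u, u') \<in> Poly_Mapping.keys (coprod x).
             Poly_Mapping.lookup (coprod x) (u, u') * (\<phi> (wd u) (cls y) * \<phi> (wd u') (cls y')))) \<and>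
       (\<forall>w\<in>torus. \<forall>w'\<in>torus'. \<phi> (wd w) (wd w') =
          (let \<alpha> = word_deg torus_deg w; \<beta> = word_deg torus_deg w'
           in vpow (\<alpha> \<bullet>\<bullet> \<beta>) * tpow (ang \<beta> \<alpha> - ang \<alpha> \<beta>))) \<and>
       (\<forall>i j. \<phi> (cls (gen (Eg i))) (cls (gen (Fg j))) = (if i = j then inverse (inverse (vi i) - vi i) else 0)) \<and>
       (\<forall>w\<in>torus. \<forall>j. \<phi> (wd w) (cls (gen (Fg j))) = 0) \<and>
       (\<forall>i. \<forall>w'\<in>torus'. \<phi> (cls (gen (Eg i))) (wd w') = 0))"

text \<open>
  \<open>B \<nu>\<close> is a basis of \<open>U\<^sup>-\<^bsub>-\<nu>\<^esub>\<close>, and the \<open>sharp \<nu> b\<close> with \<open>b \<in> B \<nu>\<close> form the dual basis of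
  \<open>U\<^sup>+\<^bsub>\<nu>\<^esub>\<close>. The element \<open>\<Theta>\<^sub>\<nu> = \<Sum>\<^sub>b b \<otimes> b\<^sup>\<sharp>\<close> is given by these data.
\<close>

definition dual_bases ::
    "('i uelem \<Rightarrow> 'i uelem \<Rightarrow> KD) \<Rightarrow> (rat ^ 'i \<Rightarrow> 'i uelem set) \<Rightarrow> (rat ^ 'i \<Rightarrow> 'i uelem \<Rightarrow> 'i uelem) \<Rightarrow> bool" where
  "dual_bases \<phi> B sharp \<longleftrightarrow> (\<forall>\<nu> \<in> pos_root_lattice.
     is_basis (U_neg \<nu>) (B \<nu>) \<and> is_basis (U_pos \<nu>) (sharp \<nu> ` B \<nu>) \<and>
     (\<forall>b \<in> B \<nu>. \<forall>c \<in> B \<nu>. \<phi> (sharp \<nu> b) c = (if b = c then 1 else 0)))"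

definition weight_module :: "(rat ^ 'i) set \<Rightarrow> ('i, 'm::kd_space) wmod \<Rightarrow> bool" where
  "weight_module L M \<longleftrightarrow>
     kd_finite_dim TYPE('m) \<and>
     (\<forall>g. kd_linear (act M g)) \<and>
     (\<forall>r \<in> relators. \<forall>m. free_act M r m = 0) \<and>
     is_grading L (wt M) \<and>
     (\<forall>\<gamma>\<in>L. \<forall>m \<in> wt M \<gamma>. \<forall>i.
        act M (Eg i) m \<in> wt M (\<gamma> + simple_root i) \<and>
        act M (Fg i) m \<in> wt M (\<gamma> - simple_root i) \<and>
        act M (Kg i) m = (vpow (simple_root i \<bullet>\<bullet> \<gamma>) * tpow (ang \<gamma> (simple_root i) - ang (simple_root i) \<gamma>)) *\<^sub>K m \<and>
        act M (K'g i) m = (vpow (- (simple_root i \<bullet>\<bullet> \<gamma>)) * tpow (ang \<gamma> (simple_root i) - ang (simple_root i) \<gamma>)) *\<^sub>K m)"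

text \<open>The functor \<open>\<Phi>\<^sub>t\<close>, on a module for \<open>\<tau> = 1\<close>.\<close>

definition transport :: "('i, 'm::kd_space) wmod \<Rightarrow> ('i, 'm) wmod" where
  "transport M = \<lparr>
     act = (\<lambda>g. case g of
         Eg i \<Rightarrow> graded_op (wt M) (\<lambda>\<gamma>. tpow (ang \<gamma> (simple_root i))) (act M (Eg i))
       | Fg i \<Rightarrow> graded_op (wt M) (\<lambda>\<gamma>. tpow (dd i - ang (simple_root i) \<gamma>)) (act M (Fg i))
       | Kg i \<Rightarrow> graded_op (wt M)
           (\<lambda>\<gamma>. vpow (simple_root i \<bullet>\<bullet> \<gamma>) * tpow (ang \<gamma> (simple_root i) - ang (simple_root i) \<gamma>)) (\<lambda>m. m)
       | Kg_inv i \<Rightarrow> graded_op (wt M)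
           (\<lambda>\<gamma>. inverse (vpow (simple_root i \<bullet>\<bullet> \<gamma>) * tpow (ang \<gamma> (simple_root i) - ang (simple_root i) \<gamma>))) (\<lambda>m. m)
       | K'g i \<Rightarrow> graded_op (wt M)
           (\<lambda>\<gamma>. vpow (- (simple_root i \<bullet>\<bullet> \<gamma>)) * tpow (ang \<gamma> (simple_root i) - ang (simple_root i) \<gamma>)) (\<lambda>m. m)
       | K'g_inv i \<Rightarrow> graded_op (wt M)
           (\<lambda>\<gamma>. inverse (vpow (- (simple_root i \<bullet>\<bullet> \<gamma>)) * tpow (ang \<gamma> (simple_root i) - ang (simple_root i) \<gamma>))) (\<lambda>m. m)),
     wt = wt M\<rparr>"

text \<open>The tensor comparison \<open>J\<^bsub>M,N\<^esub>\<close>, as a map of the underlying spaces.\<close>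

definition comparison ::
    "('i, 'm::kd_space) wmod \<Rightarrow> ('i, 'n::kd_space) wmod \<Rightarrow> ('m, 'n) tensor \<Rightarrow> ('m, 'n) tensor" where
  "comparison M N = tensor_graded_scale (wt M) (wt N) (\<lambda>\<gamma> \<mu>. tpow (ang \<mu> \<gamma>))"

definition theta_part ::
    "(rat ^ 'i \<Rightarrow> 'i uelem set) \<Rightarrow> (rat ^ 'i \<Rightarrow> 'i uelem \<Rightarrow> 'i uelem)
      \<Rightarrow> ('i, 'n::kd_space) wmod \<Rightarrow> ('i, 'm::kd_space) wmod \<Rightarrow> rat ^ 'i \<Rightarrow> ('n, 'm) tensor \<Rightarrow> ('n, 'm) tensor" where
  "theta_part B sharp N M \<nu> z = (\<Sum>b \<in> B \<nu>. tensor_map (u_act N b) (u_act M (sharp \<nu> b)) z)"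

text \<open>On finite-dimensional weight modules only finitely many \<open>\<Theta>\<^sub>\<nu>\<close> act non-trivially.\<close>

definition theta ::
    "(rat ^ 'i \<Rightarrow> 'i uelem set) \<Rightarrow> (rat ^ 'i \<Rightarrow> 'i uelem \<Rightarrow> 'i uelem)
      \<Rightarrow> ('i, 'n::kd_space) wmod \<Rightarrow> ('i, 'm::kd_space) wmod \<Rightarrow> ('n, 'm) tensor \<Rightarrow> ('n, 'm) tensor" where
  "theta B sharp N M z =
     (\<Sum>\<nu> | \<nu> \<in> pos_root_lattice \<and> theta_part B sharp N M \<nu> z \<noteq> 0. theta_part B sharp N M \<nu> z)"

definition f_scale ::
    "('i, 'n::kd_space) wmod \<Rightarrow> ('i, 'm::kd_space) wmod \<Rightarrow> ('n, 'm) tensor \<Rightarrow> ('n, 'm) tensor" where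
  "f_scale N M = tensor_graded_scale (wt N) (wt M)
     (\<lambda>\<mu> \<gamma>. vpow (- (\<mu> \<bullet>\<bullet> \<gamma>)) * tpow (ang \<mu> \<gamma> - ang \<gamma> \<mu>))"

definition checked_R ::
    "(rat ^ 'i \<Rightarrow> 'i uelem set) \<Rightarrow> (rat ^ 'i \<Rightarrow> 'i uelem \<Rightarrow> 'i uelem)
      \<Rightarrow> ('i, 'm::kd_space) wmod \<Rightarrow> ('i, 'n::kd_space) wmod \<Rightarrow> ('m, 'n) tensor \<Rightarrow> ('n, 'm) tensor" where
  "checked_R B sharp M N = theta B sharp N M \<circ> f_scale N M \<circ> tensor_flip"

end

end

theory Submission
  imports Defs
begin

text \<open>
  Let \<open>E\<^sub>w\<close> and \<open>F\<^sub>w\<close> be the products of generators along a word \<open>w\<close> of degree \<open>\<nu>\<close>, respectively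
  \<open>-\<nu>\<close>. On a vector of weight \<open>\<lambda>\<close>, the transport changes \<open>E\<^sub>w\<close> by the factor \<open>t\<close> to the power
  \<open>\<langle>\<lambda>, \<nu>\<rangle> + c(w)\<close> and \<open>F\<^sub>w\<close> by \<open>t\<close> to the power \<open>-\<langle>\<nu>, \<lambda>\<rangle> + c'(w)\<close>, where \<open>c(w)\<close> and \<open>c'(w)\<close>
  depend on the word only. So, if \<open>\<sigma>\<^sup>+\<close> and \<open>\<sigma>\<^sup>-\<close> multiply each word by \<open>t\<close> to the power \<open>c(w)\<close>,
  respectively \<open>c'(w)\<close>, then \<open>x\<close> acts on the transported module as \<open>\<sigma>\<^sup>\<plusminus>(x)\<close> acts on the given one,
  up to a factor that depends on the degree and the weight only (\<open>free_act_transport_E\<close>,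
  \<open>free_act_transport_F\<close>; in the text below, \<open>\<sigma>\<^sup>+\<close> is \<open>twist_E\<close> and \<open>\<sigma>\<^sup>-\<close> is \<open>twist_F\<close>).

  The heart of the proof is the identity \<open>(\<sigma>\<^sup>+ x, \<sigma>\<^sup>- y)\<^sub>1 = t\<^bsup>\<langle>\<nu>, \<nu>\<rangle>\<^esup> (x, y)\<^sub>t\<close> in degree \<open>\<nu>\<close>
  (\<open>twist_pairing\<close>). The axioms of the pairing determine it on words by recursion: \<open>(E\<^sub>i x, F\<^sub>w)\<close> is a
  sum over the places of \<open>F\<^sub>i\<close> in \<open>w\<close> (\<open>pairing_word_Cons\<close>), and the powers of \<open>t\<close> agree place by
  place (\<open>twist_contract\<close>). Because the pairings are nondegenerate, \<open>\<sigma>\<^sup>\<plusminus>\<close> respect the relations of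
  \<open>U\<^sup>\<plusminus>\<close> and carry dual bases to dual bases up to the factor, so that \<open>\<sigma>\<^sup>- \<otimes> \<sigma>\<^sup>+\<close> maps
  \<open>\<Theta>\<^bsub>t,\<nu>\<^esub>\<close> to \<open>t\<^bsup>\<langle>\<nu>, \<nu>\<rangle>\<^esup> \<Theta>\<^bsub>1,\<nu>\<^esub>\<close> (\<open>canonical_twist\<close>). On \<open>n\<^sub>\<mu> \<otimes> m\<^sub>\<lambda>\<close>, the part \<open>\<Theta>\<^bsub>t,\<nu>\<^esub>\<close> therefore
  acts as \<open>\<Theta>\<^bsub>1,\<nu>\<^esub>\<close> times \<open>t\<close> to the power \<open>\<langle>\<lambda>, \<nu>\<rangle> - \<langle>\<nu>, \<mu>\<rangle> + \<langle>\<nu>, \<nu>\<rangle>\<close> (\<open>theta_part_transport\<close>). Together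
  with the power \<open>\<langle>\<mu>, \<lambda>\<rangle> - \<langle>\<lambda>, \<mu>\<rangle>\<close> in \<open>f\<^sub>t\<close> and the power \<open>\<langle>\<lambda> + \<nu>, \<mu> - \<nu>\<rangle>\<close> in \<open>J\<^bsub>N,M\<^esub>\<close>, this makes
  \<open>\<langle>\<mu>, \<lambda>\<rangle>\<close>, which is the power in \<open>J\<^bsub>M,N\<^esub>\<close> (\<open>checked_R_comparison\<close>).

  Two more facts are involved. A class in \<open>U\<^bsub>v,t\<^esub>\<close> acts on a transported module only because the
  defining relations hold there (\<open>transport_relators\<close>); for the Serre relations, \<open>\<sigma>\<^sup>\<plusminus>\<close> turns the
  relator for \<open>t\<close> into a multiple of the one for \<open>t = 1\<close>. And \<open>\<Theta>\<^sub>1\<close> is invertible because it is the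
  identity plus a nilpotent operator (\<open>bij_theta_one\<close>); the invertibility of the checked R-matrix for
  \<open>t\<close> then follows from the formula itself.
\<close>

section \<open>Linear maps, tensor products and gradings\<close>

lemma kd_linearI:
  assumes "\<And>x y. f (x + y) = f x + f y" and "\<And>c x. f (c *\<^sub>K x) = c *\<^sub>K f x"
  shows "kd_linear f"
  using assms by (simp add: Vector_Spaces.linear_iff kd.vector_space_axioms)

lemma kd_linearD:
  assumes "kd_linear f"
  shows kd_linear_add: "f (x + y) = f x + f y"
    and kd_linear_scale: "f (c *\<^sub>K x) = c *\<^sub>K f x"
    and kd_linear_0: "f 0 = 0"
    and kd_linear_diff: "f (x - y) = f x - f y"
    and kd_linear_sum: "f (sum g A) = (\<Sum>a\<in>A. f (g a))"
proof -
  interpret F: Vector_Spaces.linear kscale kscale f by (rule assms)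
  show "f (x + y) = f x + f y" "f (c *\<^sub>K x) = c *\<^sub>K f x" "f 0 = 0"
    "f (x - y) = f x - f y" "f (sum g A) = (\<Sum>a\<in>A. f (g a))"
    by (simp_all add: F.add F.scale F.zero F.diff F.sum)
qed

lemma kd_bilinearI:
  assumes "\<And>a a' b. f (a + a') b = f a b + f a' b" and "\<And>c a b. f (c *\<^sub>K a) b = c *\<^sub>K f a b"
    and "\<And>a b b'. f a (b + b') = f a b + f a b'" and "\<And>c a b. f a (c *\<^sub>K b) = c *\<^sub>K f a b"
  shows "kd_bilinear f"
  unfolding kd_bilinear_def by (auto intro!: kd_linearI simp: assms)

lemma kd_bilinearD:
  assumes "kd_bilinear f"
  shows "kd_linear (\<lambda>a. f a b)" and "kd_linear (f a)"
  using assms by (auto simp: kd_bilinear_def)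

lemmas tens_linear_left = kd_bilinearD(1)[OF kd_bilinear_tens]
lemmas tens_linear_right = kd_bilinearD(2)[OF kd_bilinear_tens]

lemma tens_simps:
  fixes a a' :: "'a::kd_space" and b b' :: "'b::kd_space"
  shows "(a + a') \<otimes>\<^sub>K b = a \<otimes>\<^sub>K b + a' \<otimes>\<^sub>K b" and "(c *\<^sub>K a) \<otimes>\<^sub>K b = c *\<^sub>K (a \<otimes>\<^sub>K b)"
    and "a \<otimes>\<^sub>K (b + b') = a \<otimes>\<^sub>K b + a \<otimes>\<^sub>K b'" and "a \<otimes>\<^sub>K (c *\<^sub>K b) = c *\<^sub>K (a \<otimes>\<^sub>K b)"
    and "(0::'a) \<otimes>\<^sub>K b = 0" and "a \<otimes>\<^sub>K (0::'b) = 0"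
    and "sum g A \<otimes>\<^sub>K b = (\<Sum>i\<in>A. g i \<otimes>\<^sub>K b)" and "a \<otimes>\<^sub>K sum h A = (\<Sum>i\<in>A. a \<otimes>\<^sub>K h i)"
  using kd_linearD[OF tens_linear_left[of b]] kd_linearD[OF tens_linear_right[of a]] by simp_all

lemma kd_linear_compose:
  assumes "kd_linear f" "kd_linear g" shows "kd_linear (\<lambda>x. f (g x))"
  by (rule kd_linearI) (simp_all add: assms[THEN kd_linear_add] assms[THEN kd_linear_scale])

lemma kd_linear_id: "kd_linear (\<lambda>x. x)"
  by (rule kd_linearI) simp_all

lemma kd_linear_zero: "kd_linear (\<lambda>x. 0)"
  by (rule kd_linearI) simp_all

lemma kd_linear_plus:
  assumes "kd_linear f" "kd_linear g" shows "kd_linear (\<lambda>x. f x + g x)"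
  by (rule kd_linearI) (simp_all add: assms[THEN kd_linear_add] assms[THEN kd_linear_scale] kscale_add_right algebra_simps)

lemma kd_linear_smult:
  assumes "kd_linear f" shows "kd_linear (\<lambda>x. c *\<^sub>K f x)"
  by (rule kd_linearI) (simp_all add: kd_linear_add[OF assms] kd_linear_scale[OF assms]
      kscale_add_right kscale_kscale mult.commute)

lemma kd_linear_setsum: "(\<And>i. i \<in> A \<Longrightarrow> kd_linear (f i)) \<Longrightarrow> kd_linear (\<lambda>x. \<Sum>i\<in>A. f i x)"
  by (induct A rule: infinite_finite_induct) (auto intro: kd_linear_zero kd_linear_plus)

lemma sum_single_lookup: "(\<Sum>k\<in>Poly_Mapping.keys p. Poly_Mapping.single k (Poly_Mapping.lookup p k)) = p"
proof (rule poly_mapping_eqI)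
  fix x
  have "(\<Sum>k\<in>Poly_Mapping.keys p. Poly_Mapping.lookup (Poly_Mapping.single k (Poly_Mapping.lookup p k)) x) =
      (\<Sum>k\<in>Poly_Mapping.keys p. if k = x then Poly_Mapping.lookup p k else 0)"
    by (rule sum.cong) (auto simp: lookup_single when_def)
  then show "Poly_Mapping.lookup (\<Sum>k\<in>Poly_Mapping.keys p. Poly_Mapping.single k (Poly_Mapping.lookup p k)) x =
      Poly_Mapping.lookup p x"
    by (simp add: lookup_sum in_keys_iff)
qed

text \<open>
  A scalar coefficient can be absorbed into a factor, so that the sums of pure tensors exhaust the
  tensor product.
\<close>

lemma tensor_induct [case_names zero add tens]:
  assumes "P 0" and "\<And>x y. P x \<Longrightarrow> P y \<Longrightarrow> P (x + y)" and "\<And>a b. P (a \<otimes>\<^sub>K b)"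
  shows "P (z :: ('a::kd_space, 'b::kd_space) tensor)"
proof (induct z)
  case (1 p)
  have single: "P (abs_tensor (Poly_Mapping.single (a, b) c))" for a :: 'a and b :: 'b and c
  proof -
    have "c *\<^sub>K (a \<otimes>\<^sub>K b) = abs_tensor (Poly_Mapping.single (a, b) c)"
      by (simp add: tens.abs_eq kscale_tensor.abs_eq pm_scale_single)
    then have "abs_tensor (Poly_Mapping.single (a, b) c) = (c *\<^sub>K a) \<otimes>\<^sub>K b"
      by (simp add: tens_simps)
    then show ?thesis using assms(3) by simp
  qed
  have "P (abs_tensor (\<Sum>k\<in>A. Poly_Mapping.single k (Poly_Mapping.lookup p k)))" if "finite A" for A
    using that
  proof (induct A)
    case empty
    then show ?case using assms(1) by (simp add: zero_tensor.abs_eq)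
  next
    case (insert k A)
    then show ?case
      using assms(2)[OF single[of "fst k" "snd k"] insert(3)]
      by (simp add: plus_tensor.abs_eq[symmetric])
  qed
  from this[of "Poly_Mapping.keys p"] show ?case
    by (simp add: sum_single_lookup)
qed

lemma tensor_linear_ext:
  assumes "kd_linear f" "kd_linear g" and "\<And>a b. f (a \<otimes>\<^sub>K b) = g (a \<otimes>\<^sub>K b)"
  shows "f z = g z"
  by (induct z rule: tensor_induct) (simp_all add: assms(3) assms(1,2)[THEN kd_linear_0] assms(1,2)[THEN kd_linear_add])

lemma tensor_map_bilinear:
  assumes "kd_linear f" "kd_linear g" shows "kd_bilinear (\<lambda>a b. f a \<otimes>\<^sub>K g b)"
  by (rule kd_bilinearI) (simp_all add: assms[THEN kd_linear_add] assms[THEN kd_linear_scale] tens_simps)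

lemma tensor_map_tens:
  assumes "kd_linear f" "kd_linear g" shows "tensor_map f g (a \<otimes>\<^sub>K b) = f a \<otimes>\<^sub>K g b"
  unfolding tensor_map_def by (rule tensor_lift_tens[OF tensor_map_bilinear[OF assms]])

lemma kd_linear_tensor_map:
  assumes "kd_linear f" "kd_linear g" shows "kd_linear (tensor_map f g)"
  unfolding tensor_map_def by (rule kd_linear_tensor_lift[OF tensor_map_bilinear[OF assms]])

lemma flip_bilinear: "kd_bilinear (\<lambda>a b. b \<otimes>\<^sub>K a)"
  by (rule kd_bilinearI) (simp_all add: tens_simps)

lemma tensor_flip_tens: "tensor_flip (a \<otimes>\<^sub>K b) = b \<otimes>\<^sub>K a"
  unfolding tensor_flip_def by (rule tensor_lift_tens[OF flip_bilinear])

lemma kd_linear_tensor_flip: "kd_linear tensor_flip"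
  unfolding tensor_flip_def by (rule kd_linear_tensor_lift[OF flip_bilinear])

lemma bij_tensor_flip: "bij (tensor_flip :: ('a::kd_space, 'b::kd_space) tensor \<Rightarrow> _)"
proof (rule o_bij[where g = tensor_flip])
  have "tensor_flip (tensor_flip z) = z" for z :: "('c::kd_space, 'd::kd_space) tensor"
    by (rule tensor_linear_ext[OF kd_linear_compose[OF kd_linear_tensor_flip kd_linear_tensor_flip] kd_linear_id])
       (simp add: tensor_flip_tens)
  then show "tensor_flip \<circ> tensor_flip = (id :: ('a, 'b) tensor \<Rightarrow> _)"
    "tensor_flip \<circ> tensor_flip = (id :: ('b, 'a) tensor \<Rightarrow> _)"
    by (auto simp: fun_eq_iff)
qed

text \<open>
  The filtration makes \<open>X\<close> nilpotent. An element with \<open>z = - X z\<close> lies in every step of it, and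
  \<open>z = (z - y) + X (z - y)\<close> when \<open>X z = y + X y\<close>, so that the range swallows the steps of the
  filtration one after the other, starting from the last.
\<close>

lemma bij_unipotent:
  fixes X :: "'a::kd_space \<Rightarrow> 'a" and V :: "nat \<Rightarrow> 'a set"
  assumes X: "kd_linear X" and V: "\<And>n z. z \<in> V n \<Longrightarrow> X z \<in> V (Suc n)"
    and neg: "\<And>n z. z \<in> V n \<Longrightarrow> - z \<in> V n"
    and V0: "V 0 = UNIV" and Vk: "V k = {0}"
  shows "bij (\<lambda>z. z + X z)"
proof -
  have lin: "kd_linear (\<lambda>z. z + X z)" by (rule kd_linear_plus[OF kd_linear_id X])
  have ker: "z = 0" if "z + X z = 0" for z
  proof -
    have z: "z = - X z" using that by (simp add: eq_neg_iff_add_eq_0)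
    have "z \<in> V n" for n
    proof (induct n)
      case (Suc n)
      then have "- X z \<in> V (Suc n)" by (intro neg V)
      then show ?case using z by metis
    qed (simp add: V0)
    then show ?thesis using Vk by blast
  qed
  have inj: "inj (\<lambda>z. z + X z)"
  proof (rule injI)
    fix x y assume "x + X x = y + X y"
    then have "(x - y) + X (x - y) = 0" by (simp add: kd_linear_diff[OF X] algebra_simps)
    from ker[OF this] show "x = y" by simp
  qed
  have "V (k - j) \<subseteq> range (\<lambda>z. z + X z)" for j
  proof (induct j)
    case 0
    have "0 = (\<lambda>z. z + X z) 0" by (simp add: kd_linear_0[OF X])
    then have "0 \<in> range (\<lambda>z. z + X z)" by (rule range_eqI)
    then show ?case using Vk by simp
  next
    case (Suc j)
    show ?case
    proof (cases "k - j = 0")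
      case False
      show ?thesis
      proof
        fix z assume "z \<in> V (k - Suc j)"
        then have "X z \<in> V (k - j)" using V[of z "k - Suc j"] False by (simp add: Suc_diff_Suc)
        then obtain y where y: "X z = y + X y" using Suc by blast
        have "z = (z - y) + X (z - y)" using y by (simp add: kd_linear_diff[OF X])
        then show "z \<in> range (\<lambda>z. z + X z)" by (rule range_eqI)
      qed
    qed (use Suc in auto)
  qed
  from this[of k] have "surj (\<lambda>z. z + X z)" by (simp add: V0 top.extremum_unique)
  with inj show ?thesis by (rule bijI)
qed

subsection \<open>Gradings\<close>

lemma decomposition_component:
  assumes "is_grading L W" shows "is_decomposition W m (component W m)"
proof -
  have "\<exists>!c. is_decomposition W m c" using assms by (simp add: is_grading_def)
  then show ?thesis unfolding component_def by (rule theI')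
qed

lemma component_in: "is_grading L W \<Longrightarrow> component W m \<gamma> \<in> W \<gamma>"
  using decomposition_component[of L W m] by (simp add: is_decomposition_def)

lemma component_eqI:
  assumes W: "is_grading L W" and c: "\<And>\<gamma>. c \<gamma> \<in> W \<gamma>"
    and A: "finite A" "\<And>\<gamma>. \<gamma> \<notin> A \<Longrightarrow> c \<gamma> = 0" and m: "m = (\<Sum>\<gamma>\<in>A. c \<gamma>)"
  shows "component W m = c"
proof -
  have sub: "{\<gamma>. c \<gamma> \<noteq> 0} \<subseteq> A" using A by auto
  have "(\<Sum>\<gamma>\<in>A. c \<gamma>) = (\<Sum>\<gamma> | c \<gamma> \<noteq> 0. c \<gamma>)"
    by (rule sum.mono_neutral_right) (use A sub in auto)
  then have "is_decomposition W m c"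
    unfolding is_decomposition_def using c m finite_subset[OF sub A(1)] by auto
  moreover have "\<exists>!c. is_decomposition W m c" using W by (auto simp: is_grading_def)
  ultimately show ?thesis using decomposition_component[OF W, of m] by blast
qed

lemma finite_component: "is_grading L W \<Longrightarrow> finite {\<gamma>. component W m \<gamma> \<noteq> 0}"
  using decomposition_component[of L W m] by (simp add: is_decomposition_def)

lemma sum_component:
  assumes W: "is_grading L W" and "finite A" "{\<gamma>. component W m \<gamma> \<noteq> 0} \<subseteq> A"
  shows "(\<Sum>\<gamma>\<in>A. component W m \<gamma>) = m"
proof -
  have "(\<Sum>\<gamma>\<in>A. component W m \<gamma>) = (\<Sum>\<gamma> | component W m \<gamma> \<noteq> 0. component W m \<gamma>)"
    by (rule sum.mono_neutral_right) (use assms in auto)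
  then show ?thesis using decomposition_component[OF W, of m] by (simp add: is_decomposition_def)
qed

lemma grading_subspace: "is_grading L W \<Longrightarrow> kd.subspace (W \<gamma>)"
  by (simp add: is_grading_def)

lemma grading_closed:
  assumes "is_grading L W"
  shows grading_zero: "0 \<in> W \<gamma>" and grading_add: "x \<in> W \<gamma> \<Longrightarrow> y \<in> W \<gamma> \<Longrightarrow> x + y \<in> W \<gamma>"
    and grading_scale: "x \<in> W \<gamma> \<Longrightarrow> c *\<^sub>K x \<in> W \<gamma>"
  using grading_subspace[OF assms] by (auto simp: kd.subspace_def)

lemma kd_linear_component:
  assumes W: "is_grading L W" shows "kd_linear (\<lambda>m. component W m \<gamma>)"
proof (rule kd_linearI)
  fix x y
  let ?A = "{\<gamma>. component W x \<gamma> \<noteq> 0} \<union> {\<gamma>. component W y \<gamma> \<noteq> 0}"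
  have "component W (x + y) = (\<lambda>\<gamma>. component W x \<gamma> + component W y \<gamma>)"
    by (rule component_eqI[OF W, where A = ?A])
       (auto simp: component_in[OF W] grading_add[OF W] finite_component[OF W] sum.distrib sum_component[OF W])
  then show "component W (x + y) \<gamma> = component W x \<gamma> + component W y \<gamma>" by simp
next
  fix c x
  let ?A = "{\<gamma>. component W x \<gamma> \<noteq> 0}"
  have "component W (c *\<^sub>K x) = (\<lambda>\<gamma>. c *\<^sub>K component W x \<gamma>)"
    by (rule component_eqI[OF W, where A = ?A])
       (auto simp: component_in[OF W] grading_scale[OF W] finite_component[OF W] sum_component[OF W]
          simp flip: kd.scale_sum_right)
  then show "component W (c *\<^sub>K x) \<gamma> = c *\<^sub>K component W x \<gamma>" by simp
qed

lemma component_weight: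
  assumes W: "is_grading L W" and m: "m \<in> W \<gamma>"
  shows "component W m \<delta> = (if \<delta> = \<gamma> then m else 0)"
proof -
  have "component W m = (\<lambda>\<delta>. if \<delta> = \<gamma> then m else 0)"
    by (rule component_eqI[OF W, where A = "{\<gamma>}"]) (use m W in \<open>auto simp: grading_zero\<close>)
  then show ?thesis by simp
qed

text \<open>Only the finitely many weights of the elements of a finite spanning set occur.\<close>

lemma finite_weights:
  fixes W :: "'w \<Rightarrow> 'm::kd_space set"
  assumes W: "is_grading L W" and fd: "kd_finite_dim TYPE('m)"
  shows "finite {\<gamma>. W \<gamma> \<noteq> {0}}"
proof -
  obtain B :: "'m set" where B: "finite B" "kd.span B = UNIV" using fd by (auto simp: kd_finite_dim_def)
  let ?A = "\<Union>b\<in>B. {\<gamma>. component W b \<gamma> \<noteq> 0}"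
  have fin: "finite ?A" using B finite_component[OF W] by auto
  have "component W m \<gamma> = 0" if "\<gamma> \<notin> ?A" for m \<gamma>
  proof -
    have "m \<in> kd.span B" using B by simp
    then show ?thesis
    proof (induct rule: kd.span_induct_alt)
      case base
      then show ?case by (rule kd_linear_0[OF kd_linear_component[OF W]])
    next
      case (step c x y)
      then show ?case using that
        by (auto simp: kd_linear_add[OF kd_linear_component[OF W]] kd_linear_scale[OF kd_linear_component[OF W]])
    qed
  qed
  then have "W \<gamma> = {0}" if "\<gamma> \<notin> ?A" for \<gamma>
    using that component_weight[OF W, of _ \<gamma> \<gamma>] grading_zero[OF W, of \<gamma>] by force
  then have "{\<gamma>. W \<gamma> \<noteq> {0}} \<subseteq> ?A" by blast
  then show ?thesis using fin by (rule finite_subset)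
qed

lemma component_zero_outside:
  assumes W: "is_grading L W" and "W \<gamma> = {0}" shows "component W m \<gamma> = 0"
  using component_in[OF W, of m \<gamma>] assms by simp

lemma sum_all_components:
  fixes W :: "'w \<Rightarrow> 'm::kd_space set"
  assumes W: "is_grading L W" and fd: "kd_finite_dim TYPE('m)"
  shows "(\<Sum>\<gamma> | W \<gamma> \<noteq> {0}. component W m \<gamma>) = m"
  by (rule sum_component[OF W finite_weights[OF W fd]]) (use component_zero_outside[OF W] in auto)

lemma linear_ext_weights:
  assumes W: "is_grading L W" and f: "kd_linear f" and g: "kd_linear g"
    and eq: "\<And>\<gamma> m. \<gamma> \<in> L \<Longrightarrow> m \<in> W \<gamma> \<Longrightarrow> f m = g m"
  shows "f m = g m"
proof -
  have eq': "f m = g m" if "m \<in> W \<gamma>" for m \<gamma>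
  proof (cases "\<gamma> \<in> L")
    case False
    then have "m = 0" using that W by (auto simp: is_grading_def)
    then show ?thesis by (simp add: kd_linear_0[OF f] kd_linear_0[OF g])
  qed (use eq that in auto)
  have "f (\<Sum>\<gamma> | component W m \<gamma> \<noteq> 0. component W m \<gamma>) = g (\<Sum>\<gamma> | component W m \<gamma> \<noteq> 0. component W m \<gamma>)"
    unfolding kd_linear_sum[OF f] kd_linear_sum[OF g] by (rule sum.cong) (auto intro: eq' component_in[OF W])
  then show ?thesis
    by (simp add: sum_component[OF W finite_component[OF W] order_refl])
qed

lemma tensor_linear_ext_weights:
  assumes W: "is_grading L W" and W': "is_grading L W'" and f: "kd_linear f" and g: "kd_linear g"
    and eq: "\<And>\<gamma> \<mu> m n. \<gamma> \<in> L \<Longrightarrow> \<mu> \<in> L \<Longrightarrow> m \<in> W \<gamma> \<Longrightarrow> n \<in> W' \<mu> \<Longrightarrow> f (m \<otimes>\<^sub>K n) = g (m \<otimes>\<^sub>K n)"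
  shows "f z = g z"
proof (rule tensor_linear_ext[OF f g])
  fix m n
  show "f (m \<otimes>\<^sub>K n) = g (m \<otimes>\<^sub>K n)"
  proof (rule linear_ext_weights[OF W kd_linear_compose[OF f tens_linear_left] kd_linear_compose[OF g tens_linear_left]])
    fix \<gamma> m assume m: "\<gamma> \<in> L" "m \<in> W \<gamma>"
    show "f (m \<otimes>\<^sub>K n) = g (m \<otimes>\<^sub>K n)"
      by (rule linear_ext_weights[OF W' kd_linear_compose[OF f tens_linear_right] kd_linear_compose[OF g tens_linear_right]])
         (use m eq in auto)
  qed
qed

lemma graded_op_alt:
  fixes W :: "'w \<Rightarrow> 'm::kd_space set"
  assumes W: "is_grading L W" and fd: "kd_finite_dim TYPE('m)" and f: "kd_linear f"
  shows "graded_op W a f m = (\<Sum>\<gamma> | W \<gamma> \<noteq> {0}. a \<gamma> *\<^sub>K f (component W m \<gamma>))"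
  unfolding graded_op_def
  by (rule sum.mono_neutral_left)
     (use component_zero_outside[OF W] in \<open>auto simp: finite_weights[OF W fd] kd_linear_0[OF f]\<close>)

lemma kd_linear_graded_op:
  fixes W :: "'w \<Rightarrow> 'm::kd_space set"
  assumes W: "is_grading L W" and fd: "kd_finite_dim TYPE('m)" and f: "kd_linear f"
  shows "kd_linear (graded_op W a f)"
  unfolding graded_op_alt[OF assms]
  by (intro kd_linear_setsum kd_linear_smult kd_linear_compose[OF f] kd_linear_component[OF W])

lemma graded_op_weight:
  assumes W: "is_grading L W" and m: "m \<in> W \<gamma>" and f: "kd_linear f"
  shows "graded_op W a f m = a \<gamma> *\<^sub>K f m"
proof (cases "m = 0")
  case True
  then show ?thesis
    by (simp add: graded_op_def kd_linear_0[OF f] kd_linear_0[OF kd_linear_component[OF W]])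
next
  case False
  then have "{\<delta>. component W m \<delta> \<noteq> 0} = {\<gamma>}" by (auto simp: component_weight[OF W m])
  then show ?thesis by (simp add: graded_op_def component_weight[OF W m])
qed

lemma tensor_graded_scale_bilinear:
  fixes W :: "'w \<Rightarrow> 'm::kd_space set" and W' :: "'w \<Rightarrow> 'n::kd_space set"
  assumes W: "is_grading L W" "kd_finite_dim TYPE('m)" and W': "is_grading L W'" "kd_finite_dim TYPE('n)"
  shows "kd_bilinear (\<lambda>m n. \<Sum>\<gamma> | component W m \<gamma> \<noteq> 0. \<Sum>\<mu> | component W' n \<mu> \<noteq> 0.
       a \<gamma> \<mu> *\<^sub>K (component W m \<gamma> \<otimes>\<^sub>K component W' n \<mu>))"
proof -
  have inner: "(\<Sum>\<mu> | component W' n \<mu> \<noteq> 0. a \<gamma> \<mu> *\<^sub>K (x \<otimes>\<^sub>K component W' n \<mu>)) =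
     (\<Sum>\<mu> | W' \<mu> \<noteq> {0}. a \<gamma> \<mu> *\<^sub>K (x \<otimes>\<^sub>K component W' n \<mu>))" for x :: 'm and n \<gamma>
    by (rule sum.mono_neutral_left)
       (use component_zero_outside[OF W'(1)] in \<open>auto simp: finite_weights[OF W'] tens_simps\<close>)
  have outer: "(\<Sum>\<gamma> | component W m \<gamma> \<noteq> 0. \<Sum>\<mu> | component W' n \<mu> \<noteq> 0.
       a \<gamma> \<mu> *\<^sub>K (component W m \<gamma> \<otimes>\<^sub>K component W' n \<mu>)) =
     (\<Sum>\<gamma> | W \<gamma> \<noteq> {0}. \<Sum>\<mu> | W' \<mu> \<noteq> {0}.
       a \<gamma> \<mu> *\<^sub>K (component W m \<gamma> \<otimes>\<^sub>K component W' n \<mu>))" for m n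
    unfolding inner
    by (rule sum.mono_neutral_left)
       (use component_zero_outside[OF W(1)] in \<open>auto simp: finite_weights[OF W] tens_simps\<close>)
  show ?thesis
    unfolding outer kd_bilinear_def
    by (intro conjI allI kd_linear_setsum kd_linear_smult
        kd_linear_compose[OF tens_linear_left kd_linear_component[OF W(1)]]
        kd_linear_compose[OF tens_linear_right kd_linear_component[OF W'(1)]])
qed

lemma kd_linear_tensor_graded_scale:
  fixes W :: "'w \<Rightarrow> 'm::kd_space set" and W' :: "'w \<Rightarrow> 'n::kd_space set"
  assumes "is_grading L W" "kd_finite_dim TYPE('m)" and "is_grading L W'" "kd_finite_dim TYPE('n)"
  shows "kd_linear (tensor_graded_scale W W' a)"
  unfolding tensor_graded_scale_def
  by (rule kd_linear_tensor_lift[OF tensor_graded_scale_bilinear[OF assms]])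

lemma tensor_graded_scale_weight:
  fixes W :: "'w \<Rightarrow> 'm::kd_space set" and W' :: "'w \<Rightarrow> 'n::kd_space set"
  assumes W: "is_grading L W" "kd_finite_dim TYPE('m)" and W': "is_grading L W'" "kd_finite_dim TYPE('n)"
    and m: "m \<in> W \<gamma>" and n: "n \<in> W' \<mu>"
  shows "tensor_graded_scale W W' a (m \<otimes>\<^sub>K n) = a \<gamma> \<mu> *\<^sub>K (m \<otimes>\<^sub>K n)"
proof -
  have "tensor_graded_scale W W' a (m \<otimes>\<^sub>K n) = (\<Sum>\<gamma> | component W m \<gamma> \<noteq> 0. \<Sum>\<mu> | component W' n \<mu> \<noteq> 0.
       a \<gamma> \<mu> *\<^sub>K (component W m \<gamma> \<otimes>\<^sub>K component W' n \<mu>))"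
    unfolding tensor_graded_scale_def by (rule tensor_lift_tens[OF tensor_graded_scale_bilinear[OF W W']])
  also have "\<dots> = a \<gamma> \<mu> *\<^sub>K (m \<otimes>\<^sub>K n)"
  proof (cases "m = 0 \<or> n = 0")
    case True
    then show ?thesis
      by (auto simp: tens_simps kd_linear_0[OF kd_linear_component[OF W(1)]] kd_linear_0[OF kd_linear_component[OF W'(1)]])
  next
    case False
    then have "{\<delta>. component W m \<delta> \<noteq> 0} = {\<gamma>}" "{\<delta>. component W' n \<delta> \<noteq> 0} = {\<mu>}"
      by (auto simp: component_weight[OF W(1) m] component_weight[OF W'(1) n])
    then show ?thesis by (simp add: component_weight[OF W(1) m] component_weight[OF W'(1) n])
  qed
  finally show ?thesis .
qed

lemma bij_tensor_graded_scale:
  fixes W :: "'w \<Rightarrow> 'm::kd_space set" and W' :: "'w \<Rightarrow> 'n::kd_space set"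
  assumes W: "is_grading L W" "kd_finite_dim TYPE('m)" and W': "is_grading L W'" "kd_finite_dim TYPE('n)"
    and a: "\<And>\<gamma> \<mu>. a \<gamma> \<mu> \<noteq> 0"
  shows "bij (tensor_graded_scale W W' a)"
proof (rule o_bij[where g = "tensor_graded_scale W W' (\<lambda>\<gamma> \<mu>. inverse (a \<gamma> \<mu>))"])
  have inv: "tensor_graded_scale W W' a (tensor_graded_scale W W' b z) = z"
    if "\<And>\<gamma> \<mu>. b \<gamma> \<mu> * a \<gamma> \<mu> = 1" for a b z
    by (rule tensor_linear_ext_weights[OF W(1) W'(1) kd_linear_compose[OF
            kd_linear_tensor_graded_scale[OF W W'] kd_linear_tensor_graded_scale[OF W W']] kd_linear_id])
       (simp_all add: tensor_graded_scale_weight[OF W W'] kd_linear_scale[OF kd_linear_tensor_graded_scale[OF W W']]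
          that kscale_kscale kscale_one)
  show "tensor_graded_scale W W' (\<lambda>\<gamma> \<mu>. inverse (a \<gamma> \<mu>)) \<circ> tensor_graded_scale W W' a = id"
    "tensor_graded_scale W W' a \<circ> tensor_graded_scale W W' (\<lambda>\<gamma> \<mu>. inverse (a \<gamma> \<mu>)) = id"
    using a by (auto simp: fun_eq_iff inv)
qed

section \<open>The action of the free algebra and of its quotient\<close>

lemma pm_induct [case_names single add]:
  assumes "\<And>k c. P (Poly_Mapping.single k c)" and "\<And>p q. P p \<Longrightarrow> P q \<Longrightarrow> P (p + q)"
  shows "P (p :: 'x \<Rightarrow>\<^sub>0 'c::comm_monoid_add)"
proof -
  have "P (\<Sum>k\<in>A. Poly_Mapping.single k (Poly_Mapping.lookup p k))" if "finite A" for A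
    using that
  proof (induct A)
    case empty
    have "P (Poly_Mapping.single undefined 0)" by (rule assms(1))
    then show ?case by simp
  qed (simp add: assms)
  from this[of "Poly_Mapping.keys p"] show ?thesis by (simp add: sum_single_lookup)
qed

lemma scalar_mult_eq_pm_scale: "scalar c * x = pm_scale c x"
proof (induct x rule: pm_induct)
  case (single k a)
  have "pm_scale c (Poly_Mapping.single k a) = Poly_Mapping.single k (c * a)"
    by (rule poly_mapping_eqI) (simp add: lookup_single when_def)
  then show ?case by (simp add: scalar_def mult_single)
next
  case (add p q)
  then show ?case by (simp add: pm.scale_right_distrib ring_distribs)
qed

lemma lookup_scalar_mult [simp]: "Poly_Mapping.lookup (scalar c * x) w = c * Poly_Mapping.lookup x w"
  by (simp add: scalar_mult_eq_pm_scale)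

lemma scalar_mult_single [simp]: "scalar c * Poly_Mapping.single w a = Poly_Mapping.single w (c * a)"
  by (rule poly_mapping_eqI) (simp add: lookup_single when_def)

lemma free_subalg_closed:
  shows free_subalg_0: "0 \<in> free_subalg S"
    and free_subalg_add: "x \<in> free_subalg S \<Longrightarrow> y \<in> free_subalg S \<Longrightarrow> x + y \<in> free_subalg S"
    and free_subalg_scalar: "x \<in> free_subalg S \<Longrightarrow> scalar c * x \<in> free_subalg S"
    and free_subalg_single: "set (letters w) \<subseteq> S \<Longrightarrow> Poly_Mapping.single w a \<in> free_subalg S"
  using Poly_Mapping.keys_add[of x y]
  by (auto simp: free_subalg_def in_keys_iff lookup_single when_def split: if_splits)

lemma free_homog_closed:
  shows free_homog_0: "0 \<in> free_homog S \<nu>"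
    and free_homog_add: "x \<in> free_homog S \<nu> \<Longrightarrow> y \<in> free_homog S \<nu> \<Longrightarrow> x + y \<in> free_homog S \<nu>"
    and free_homog_scalar: "x \<in> free_homog S \<nu> \<Longrightarrow> scalar c * x \<in> free_homog S \<nu>"
  using Poly_Mapping.keys_add[of x y]
  by (auto simp: free_homog_def free_subalg_closed in_keys_iff)

lemma free_homog_sum: "(\<And>i. i \<in> A \<Longrightarrow> f i \<in> free_homog S \<nu>) \<Longrightarrow> sum f A \<in> free_homog S \<nu>"
  by (induct A rule: infinite_finite_induct) (auto intro: free_homog_closed)

lemma free_homog_single:
  "set (letters w) \<subseteq> S \<Longrightarrow> word_deg root_deg w = \<nu> \<Longrightarrow> Poly_Mapping.single w a \<in> free_homog S \<nu>"
  by (auto simp: free_homog_def free_subalg_def)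

lemma free_act_single: "free_act M (Poly_Mapping.single w c) m = c *\<^sub>K foldr (act M) (letters w) m"
  by (cases "c = 0") (simp_all add: free_act_def)

lemma free_act_add: "free_act M (x + y) m = free_act M x m + free_act M y m"
  unfolding free_act_def by (rule setsum_keys_plus_distrib) (simp_all add: kscale_add_left)

lemma free_act_0: "free_act M 0 m = 0"
  by (simp add: free_act_def)

lemma free_act_minus: "free_act M (- x) m = - free_act M x m"
  using free_act_add[of M x "- x" m] by (simp add: free_act_0 eq_neg_iff_add_eq_0 add.commute)

lemma free_act_diff: "free_act M (x - y) m = free_act M x m - free_act M y m"
  using free_act_add[of M x "- y" m] by (simp add: free_act_minus)

lemma free_act_sum: "free_act M (sum f A) m = (\<Sum>i\<in>A. free_act M (f i) m)"
  by (induct A rule: infinite_finite_induct) (simp_all add: free_act_0 free_act_add)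

lemma free_act_scalar: "free_act M (scalar c * x) m = c *\<^sub>K free_act M x m"
  by (induct x rule: pm_induct)
     (simp_all add: free_act_single free_act_add ring_distribs kscale_add_right kscale_kscale)

lemma free_act_gen: "free_act M (gen g) m = act M g m"
  by (simp add: gen_def free_act_single kscale_one)

lemma free_act_1: "free_act M 1 m = m"
proof -
  have "free_act M (Poly_Mapping.single 0 1) m = m"
    unfolding free_act_single by (simp add: kscale_one zero_fword_def)
  then show ?thesis by simp
qed

locale free_module =
  fixes M :: "('i::finite, 'm::kd_space) wmod"
  assumes linear_act: "kd_linear (act M g)"
begin

lemma linear_foldr: "kd_linear (foldr (act M) gs)"
proof (induct gs)
  case Nil
  then show ?case using kd_linear_id by (simp add: id_def)
next
  case (Cons g gs)
  then show ?case using kd_linear_compose[OF linear_act Cons, of g] by (simp add: comp_def)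
qed

lemma linear_free_act: "kd_linear (free_act M x)"
  unfolding free_act_def by (intro kd_linear_setsum kd_linear_smult linear_foldr)

lemma free_act_mult: "free_act M (x * y) m = free_act M x (free_act M y m)"
proof (induct x rule: pm_induct)
  case (single k a)
  show ?case
  proof (induct y rule: pm_induct)
    case (single l b)
    then show ?case
      by (simp add: mult_single free_act_single plus_fword_def kd_linear_scale[OF linear_foldr] kscale_kscale)
  next
    case (add p q)
    then show ?case
      by (simp add: ring_distribs free_act_add kd_linear_add[OF linear_free_act])
  qed
next
  case (add p q)
  then show ?case by (simp add: ring_distribs free_act_add)
qed

text \<open>
  Once it contains the relators, this ideal contains the ideal which they generate; this is why a
  class of \<open>U\<close> acts by any of its representatives.
\<close>

lemma ideal_annihilator: "ideal {x. \<forall>m. free_act M x m = 0} free_ring"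
proof (rule idealI[OF ring_free_ring])
  interpret R: ring free_ring by (rule ring_free_ring)
  have inv: "m_inv (add_monoid free_ring) x = - x" for x :: "'i falg"
    using R.minus_equality[of "- x" x] by (simp add: free_ring_def a_inv_def)
  show "subgroup {x. \<forall>m. free_act M x m = 0} (add_monoid free_ring)"
    by (rule subgroup.intro) (simp_all add: inv[unfolded free_ring_def, simplified] free_ring_def free_act_0 free_act_add free_act_minus)
qed (auto simp: free_ring_def free_act_mult kd_linear_0[OF linear_free_act])

end

locale u_module = qgroup \<Omega> D \<tau> + free_module M
  for \<Omega> :: "'i::finite \<Rightarrow> 'i \<Rightarrow> int" and D :: nat and \<tau> :: KD and M :: "('i, 'm::kd_space) wmod" +
  assumes relators_act: "r \<in> relators \<Longrightarrow> free_act M r m = 0"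

context qgroup
begin

lemma ideal_relators: "ideal (Idl\<^bsub>free_ring\<^esub> relators) free_ring"
proof -
  interpret R: ring free_ring by (rule ring_free_ring)
  show ?thesis by (rule R.genideal_ideal) (simp add: free_ring_def)
qed

lemma cls_eqD: assumes "cls x = cls y" shows "x - y \<in> Idl\<^bsub>free_ring\<^esub> relators"
proof -
  interpret I: ideal "Idl\<^bsub>free_ring\<^esub> relators" free_ring by (rule ideal_relators)
  have "x \<in> cls x" unfolding cls_def by (rule I.a_rcos_self) (simp add: free_ring_def)
  then have "x \<in> cls y" using assms by simp
  then show ?thesis by (auto simp: cls_def a_r_coset_def' free_ring_def)
qed

lemma ring_hom_cls: "cls \<in> ring_hom free_ring U"
proof -
  interpret I: ideal "Idl\<^bsub>free_ring\<^esub> relators" free_ring by (rule ideal_relators)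
  show ?thesis using I.rcos_ring_hom by (simp add: cls_def[abs_def] U_def)
qed

lemma cls_in_U: "cls x \<in> carrier U"
  and cls_add: "cls (x + y) = cls x \<oplus>\<^bsub>U\<^esub> cls y"
  and cls_mult: "cls (x * y) = cls x \<otimes>\<^bsub>U\<^esub> cls y"
  using ring_hom_closed[OF ring_hom_cls, of x] ring_hom_add[OF ring_hom_cls, of x y]
    ring_hom_mult[OF ring_hom_cls, of x y]
  by (simp_all add: free_ring_def)

lemma cls_0: "cls 0 = \<zero>\<^bsub>U\<^esub>"
proof -
  interpret I: ideal "Idl\<^bsub>free_ring\<^esub> relators" free_ring by (rule ideal_relators)
  interpret H: ring_hom_ring free_ring U cls
    using I.rcos_ring_hom_ring by (simp add: cls_def[abs_def] U_def)
  show ?thesis using H.hom_zero by (simp add: free_ring_def)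
qed

lemma U_scale_cls: "U_scale c (cls x) = cls (scalar c * x)"
  by (simp add: U_scale_def cls_mult)

lemma finsum_cls:
  assumes "finite A" shows "(\<Oplus>\<^bsub>U\<^esub>i\<in>A. cls (f i)) = cls (\<Sum>i\<in>A. f i)"
proof -
  interpret U: ring U by (rule ring_U)
  show ?thesis using assms
    by (induct A) (simp_all add: cls_0 cls_add cls_in_U U.finsum_insert Pi_def)
qed

end

context u_module
begin

lemma ideal_act: "x \<in> Idl\<^bsub>free_ring\<^esub> relators \<Longrightarrow> free_act M x m = 0"
proof -
  interpret R: ring free_ring by (rule ring_free_ring)
  have "Idl\<^bsub>free_ring\<^esub> relators \<subseteq> {x. \<forall>m. free_act M x m = 0}"
    by (rule R.genideal_minimal[OF ideal_annihilator]) (auto simp: relators_act)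
  then show "x \<in> Idl\<^bsub>free_ring\<^esub> relators \<Longrightarrow> free_act M x m = 0" by blast
qed

lemma free_act_cong: "cls x = cls y \<Longrightarrow> free_act M x m = free_act M y m"
  using ideal_act[OF cls_eqD, of x y m] by (simp add: free_act_diff)

lemma u_act_cls: "u_act M (cls x) = free_act M x"
proof -
  have "y \<in> cls x \<longleftrightarrow> (\<exists>h \<in> Idl\<^bsub>free_ring\<^esub> relators. y = h + x)" for y
    by (auto simp: cls_def a_r_coset_def' free_ring_def)
  then have "free_act M y = free_act M x" if "y \<in> cls x" for y
    using that by (auto simp: fun_eq_iff free_act_add ideal_act)
  moreover have "x \<in> cls x"
  proof -
    interpret I: ideal "Idl\<^bsub>free_ring\<^esub> relators" free_ring by (rule ideal_relators)
    show ?thesis unfolding cls_def by (rule I.a_rcos_self) (simp add: free_ring_def)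
  qed
  ultimately have "free_act M ` cls x = {free_act M x}" by blast
  then show ?thesis by (simp add: u_act_def)
qed

end

section \<open>Dual bases\<close>

context qgroup
begin

definition pos_subalg :: "'i falg set" where
  "pos_subalg = free_subalg (range Eg \<union> range Kg \<union> range Kg_inv)"
definition neg_subalg :: "'i falg set" where
  "neg_subalg = free_subalg (range Fg \<union> range K'g \<union> range K'g_inv)"

lemma homog_in_pos: "x \<in> free_homog (range Eg) \<nu> \<Longrightarrow> x \<in> pos_subalg"
  and homog_in_neg: "y \<in> free_homog (range Fg) \<nu> \<Longrightarrow> y \<in> neg_subalg"
  by (auto simp: free_homog_def free_subalg_def pos_subalg_def neg_subalg_def)

lemma pos_subalg_closed:
  shows "0 \<in> pos_subalg" and "x \<in> pos_subalg \<Longrightarrow> y \<in> pos_subalg \<Longrightarrow> x + y \<in> pos_subalg"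
    and "x \<in> pos_subalg \<Longrightarrow> scalar c * x \<in> pos_subalg"
  by (auto simp: pos_subalg_def intro: free_subalg_closed)

lemma neg_subalg_closed:
  shows "0 \<in> neg_subalg" and "x \<in> neg_subalg \<Longrightarrow> y \<in> neg_subalg \<Longrightarrow> x + y \<in> neg_subalg"
    and "x \<in> neg_subalg \<Longrightarrow> scalar c * x \<in> neg_subalg"
  by (auto simp: neg_subalg_def intro: free_subalg_closed)

lemma pairing_props:
  assumes "is_pairing \<phi>"
  shows pairing_add_left: "x \<in> pos_subalg \<Longrightarrow> x' \<in> pos_subalg \<Longrightarrow> y \<in> neg_subalg \<Longrightarrow>
      \<phi> (cls (x + x')) (cls y) = \<phi> (cls x) (cls y) + \<phi> (cls x') (cls y)"
    and pairing_add_right: "x \<in> pos_subalg \<Longrightarrow> y \<in> neg_subalg \<Longrightarrow> y' \<in> neg_subalg \<Longrightarrow>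
      \<phi> (cls x) (cls (y + y')) = \<phi> (cls x) (cls y) + \<phi> (cls x) (cls y')"
    and pairing_scalar_left: "x \<in> pos_subalg \<Longrightarrow> y \<in> neg_subalg \<Longrightarrow>
      \<phi> (cls (scalar c * x)) (cls y) = c * \<phi> (cls x) (cls y)"
    and pairing_scalar_right: "x \<in> pos_subalg \<Longrightarrow> y \<in> neg_subalg \<Longrightarrow>
      \<phi> (cls x) (cls (scalar c * y)) = c * \<phi> (cls x) (cls y)"
    and pairing_one_left: "y \<in> neg_subalg \<Longrightarrow> \<phi> (cls 1) (cls y) = counit y"
    and pairing_mult_left: "x \<in> pos_subalg \<Longrightarrow> x' \<in> pos_subalg \<Longrightarrow> y \<in> neg_subalg \<Longrightarrow>
      \<phi> (cls (x * x')) (cls y) = (\<Sum>(u, u') \<in> Poly_Mapping.keys (coprod y). Poly_Mapping.lookup (coprod y) (u, u') *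
         (\<phi> (cls x) (cls (Poly_Mapping.single u' 1)) * \<phi> (cls x') (cls (Poly_Mapping.single u 1))))"
    and pairing_mult_right: "x \<in> pos_subalg \<Longrightarrow> y \<in> neg_subalg \<Longrightarrow> y' \<in> neg_subalg \<Longrightarrow>
      \<phi> (cls x) (cls (y * y')) = (\<Sum>(u, u') \<in> Poly_Mapping.keys (coprod x). Poly_Mapping.lookup (coprod x) (u, u') *
         (\<phi> (cls (Poly_Mapping.single u 1)) (cls y) * \<phi> (cls (Poly_Mapping.single u' 1)) (cls y')))"
    and pairing_torus: "set (letters w) \<subseteq> range Kg \<union> range Kg_inv \<Longrightarrow> set (letters w') \<subseteq> range K'g \<union> range K'g_inv \<Longrightarrow>
      \<phi> (cls (Poly_Mapping.single w 1)) (cls (Poly_Mapping.single w' 1)) =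
        vpow (word_deg torus_deg w \<bullet>\<bullet> word_deg torus_deg w') *
        tpow (ang (word_deg torus_deg w') (word_deg torus_deg w) - ang (word_deg torus_deg w) (word_deg torus_deg w'))"
    and pairing_E_F: "\<phi> (cls (gen (Eg i))) (cls (gen (Fg j))) = (if i = j then inverse (inverse (vi i) - vi i) else 0)"
    and pairing_K_F: "set (letters w) \<subseteq> range Kg \<union> range Kg_inv \<Longrightarrow>
      \<phi> (cls (Poly_Mapping.single w 1)) (cls (gen (Fg j))) = 0"
    and pairing_E_K: "set (letters w') \<subseteq> range K'g \<union> range K'g_inv \<Longrightarrow>
      \<phi> (cls (gen (Eg i))) (cls (Poly_Mapping.single w' 1)) = 0"
proof -
  \<comment> \<open>the clauses of the definition, in their order there\<close>
  note A = assms[unfolded is_pairing_def Let_def, folded pos_subalg_def neg_subalg_def]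
  note A1 = A[THEN conjunct1, rule_format]
  note A2 = A[THEN conjunct2, THEN conjunct1, rule_format]
  note A3 = A[THEN conjunct2, THEN conjunct2, THEN conjunct1, rule_format]
  note A4 = A[THEN conjunct2, THEN conjunct2, THEN conjunct2, THEN conjunct1, rule_format]
  note A5 = A[THEN conjunct2, THEN conjunct2, THEN conjunct2, THEN conjunct2, THEN conjunct1, rule_format]
  note A7 = A[THEN conjunct2, THEN conjunct2, THEN conjunct2, THEN conjunct2, THEN conjunct2, THEN conjunct2, THEN conjunct1, rule_format]
  note A8 = A[THEN conjunct2, THEN conjunct2, THEN conjunct2, THEN conjunct2, THEN conjunct2, THEN conjunct2, THEN conjunct2, THEN conjunct1, rule_format]
  note A9 = A[THEN conjunct2, THEN conjunct2, THEN conjunct2, THEN conjunct2, THEN conjunct2, THEN conjunct2, THEN conjunct2, THEN conjunct2, THEN conjunct1, rule_format]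
  note A10 = A[THEN conjunct2, THEN conjunct2, THEN conjunct2, THEN conjunct2, THEN conjunct2, THEN conjunct2, THEN conjunct2, THEN conjunct2, THEN conjunct2, THEN conjunct1, rule_format]
  note A11 = A[THEN conjunct2, THEN conjunct2, THEN conjunct2, THEN conjunct2, THEN conjunct2, THEN conjunct2, THEN conjunct2, THEN conjunct2, THEN conjunct2, THEN conjunct2, THEN conjunct1, rule_format]
  note A12 = A[THEN conjunct2, THEN conjunct2, THEN conjunct2, THEN conjunct2, THEN conjunct2, THEN conjunct2, THEN conjunct2, THEN conjunct2, THEN conjunct2, THEN conjunct2, THEN conjunct2, rule_format]
  show "x \<in> pos_subalg \<Longrightarrow> x' \<in> pos_subalg \<Longrightarrow> y \<in> neg_subalg \<Longrightarrow>
      \<phi> (cls (x + x')) (cls y) = \<phi> (cls x) (cls y) + \<phi> (cls x') (cls y)"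
    by (rule A1; simp)
  show "x \<in> pos_subalg \<Longrightarrow> y \<in> neg_subalg \<Longrightarrow> y' \<in> neg_subalg \<Longrightarrow>
      \<phi> (cls x) (cls (y + y')) = \<phi> (cls x) (cls y) + \<phi> (cls x) (cls y')"
    by (rule A2; simp)
  show "x \<in> pos_subalg \<Longrightarrow> y \<in> neg_subalg \<Longrightarrow>
      \<phi> (cls (scalar c * x)) (cls y) = c * \<phi> (cls x) (cls y)"
    by (rule A3; simp)
  show "x \<in> pos_subalg \<Longrightarrow> y \<in> neg_subalg \<Longrightarrow>
      \<phi> (cls x) (cls (scalar c * y)) = c * \<phi> (cls x) (cls y)"
    by (rule A4; simp)
  show "y \<in> neg_subalg \<Longrightarrow> \<phi> (cls 1) (cls y) = counit y"
    by (rule A5; simp)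
  show "x \<in> pos_subalg \<Longrightarrow> x' \<in> pos_subalg \<Longrightarrow> y \<in> neg_subalg \<Longrightarrow>
      \<phi> (cls (x * x')) (cls y) = (\<Sum>(u, u') \<in> Poly_Mapping.keys (coprod y). Poly_Mapping.lookup (coprod y) (u, u') *
         (\<phi> (cls x) (cls (Poly_Mapping.single u' 1)) * \<phi> (cls x') (cls (Poly_Mapping.single u 1))))"
    by (rule A7; simp)
  show "x \<in> pos_subalg \<Longrightarrow> y \<in> neg_subalg \<Longrightarrow> y' \<in> neg_subalg \<Longrightarrow>
      \<phi> (cls x) (cls (y * y')) = (\<Sum>(u, u') \<in> Poly_Mapping.keys (coprod x). Poly_Mapping.lookup (coprod x) (u, u') *
         (\<phi> (cls (Poly_Mapping.single u 1)) (cls y) * \<phi> (cls (Poly_Mapping.single u' 1)) (cls y')))"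
    by (rule A8; simp)
  show "set (letters w) \<subseteq> range Kg \<union> range Kg_inv \<Longrightarrow> set (letters w') \<subseteq> range K'g \<union> range K'g_inv \<Longrightarrow>
      \<phi> (cls (Poly_Mapping.single w 1)) (cls (Poly_Mapping.single w' 1)) =
        vpow (word_deg torus_deg w \<bullet>\<bullet> word_deg torus_deg w') *
        tpow (ang (word_deg torus_deg w') (word_deg torus_deg w) - ang (word_deg torus_deg w) (word_deg torus_deg w'))"
    by (rule A9; simp)
  show "\<phi> (cls (gen (Eg i))) (cls (gen (Fg j))) = (if i = j then inverse (inverse (vi i) - vi i) else 0)"
    by (rule A10; simp)
  show "set (letters w) \<subseteq> range Kg \<union> range Kg_inv \<Longrightarrow>
      \<phi> (cls (Poly_Mapping.single w 1)) (cls (gen (Fg j))) = 0"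
    by (rule A11; simp)
  show "set (letters w') \<subseteq> range K'g \<union> range K'g_inv \<Longrightarrow>
      \<phi> (cls (gen (Eg i))) (cls (Poly_Mapping.single w' 1)) = 0"
    by (rule A12; simp)
qed

lemma pairing_zero:
  assumes "is_pairing \<phi>"
  shows pairing_zero_left: "y \<in> neg_subalg \<Longrightarrow> \<phi> (cls 0) (cls y) = 0"
    and pairing_zero_right: "x \<in> pos_subalg \<Longrightarrow> \<phi> (cls x) (cls 0) = 0"
  using pairing_scalar_left[OF assms, of 0 y 0] pairing_scalar_right[OF assms, of x 0 0]
  by (simp_all add: pos_subalg_def neg_subalg_def free_subalg_0)

lemma pairing_sum_left:
  assumes p: "is_pairing \<phi>" and y: "y \<in> neg_subalg" and x: "\<And>i. i \<in> A \<Longrightarrow> x i \<in> pos_subalg"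
  shows "\<phi> (cls (\<Sum>i\<in>A. scalar (c i) * x i)) (cls y) = (\<Sum>i\<in>A. c i * \<phi> (cls (x i)) (cls y))"
proof -
  have "(\<Sum>i\<in>A. scalar (c i) * x i) \<in> pos_subalg \<and> ?thesis"
    using x
    by (induct A rule: infinite_finite_induct)
       (simp_all add: pairing_zero_left[OF p y] pairing_add_left[OF p _ _ y] pairing_scalar_left[OF p _ y]
          pos_subalg_closed)
  then show ?thesis by blast
qed

lemma pairing_sum_right:
  assumes p: "is_pairing \<phi>" and x: "x \<in> pos_subalg" and y: "\<And>i. i \<in> A \<Longrightarrow> y i \<in> neg_subalg"
  shows "\<phi> (cls x) (cls (\<Sum>i\<in>A. scalar (c i) * y i)) = (\<Sum>i\<in>A. c i * \<phi> (cls x) (cls (y i)))"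
proof -
  have "(\<Sum>i\<in>A. scalar (c i) * y i) \<in> neg_subalg \<and> ?thesis"
    using y
    by (induct A rule: infinite_finite_induct)
       (simp_all add: pairing_zero_right[OF p x] pairing_add_right[OF p x] pairing_scalar_right[OF p x]
          neg_subalg_closed)
  then show ?thesis by blast
qed

lemma basis_expansion:
  assumes B: "is_basis (cls ` H) B" and rep: "\<And>b. b \<in> B \<Longrightarrow> cls (r b) = b" and x: "x \<in> H"
  obtains c where "cls x = cls (\<Sum>b\<in>B. scalar (c b) * r b)"
proof -
  from B x obtain c where c: "cls x = (\<Oplus>\<^bsub>U\<^esub>b\<in>B. U_scale (c b) b)" and fin: "finite B"
    unfolding is_basis_def by (meson image_eqI)
  interpret U: ring U by (rule ring_U)
  have "(\<Oplus>\<^bsub>U\<^esub>b\<in>B. U_scale (c b) b) = (\<Oplus>\<^bsub>U\<^esub>b\<in>B. cls (scalar (c b) * r b))"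
  proof (rule U.finsum_cong')
    fix b assume "b \<in> B"
    then show "U_scale (c b) b = cls (scalar (c b) * r b)" using rep[of b] U_scale_cls[of "c b" "r b"] by simp
  qed (auto simp: cls_in_U)
  then show ?thesis using that[of c] c fin by (simp add: finsum_cls)
qed

text \<open>
  A pair of dual bases of \<open>U\<^sup>+\<^bsub>\<nu>\<^esub>\<close> and \<open>U\<^sup>-\<^bsub>-\<nu>\<^esub>\<close>, given by representatives \<open>X b\<close> and \<open>Y b\<close> in the free
  algebra. Linear maps such as the rescaling of words are defined there, and it is not clear in
  advance that they pass to the quotient.
\<close>

definition dual_system ::
    "('i uelem \<Rightarrow> 'i uelem \<Rightarrow> KD) \<Rightarrow> rat ^ 'i \<Rightarrow> 'b set \<Rightarrow> ('b \<Rightarrow> 'i falg) \<Rightarrow> ('b \<Rightarrow> 'i falg) \<Rightarrow> bool" where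
  "dual_system \<phi> \<nu> A X Y \<longleftrightarrow> finite A \<and>
     (\<forall>b\<in>A. X b \<in> free_homog (range Eg) \<nu> \<and> Y b \<in> free_homog (range Fg) (- \<nu>)) \<and>
     (\<forall>x\<in>free_homog (range Eg) \<nu>. cls x = cls (\<Sum>b\<in>A. scalar (\<phi> (cls x) (cls (Y b))) * X b)) \<and>
     (\<forall>y\<in>free_homog (range Fg) (- \<nu>). cls y = cls (\<Sum>b\<in>A. scalar (\<phi> (cls (X b)) (cls y)) * Y b))"

text \<open>
  The coefficients in a basis are recovered by pairing with the elements of the dual basis.
\<close>

lemma dual_bases_system:
  assumes p: "is_pairing \<phi>" and dual: "dual_bases \<phi> B sharp" and \<nu>: "\<nu> \<in> pos_root_lattice"
  obtains X Y where "dual_system \<phi> \<nu> (B \<nu>) X Y"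
    and "\<And>b. b \<in> B \<nu> \<Longrightarrow> cls (X b) = sharp \<nu> b" and "\<And>b. b \<in> B \<nu> \<Longrightarrow> cls (Y b) = b"
proof -
  let ?E = "free_homog (range Eg) \<nu>" and ?F = "free_homog (range Fg) (- \<nu>)" and ?B = "B \<nu>" and ?s = "sharp \<nu>"
  from dual \<nu> have B: "is_basis (cls ` ?F) ?B" and S: "is_basis (cls ` ?E) (?s ` ?B)"
    and delta: "\<And>b c. b \<in> ?B \<Longrightarrow> c \<in> ?B \<Longrightarrow> \<phi> (?s b) c = (if b = c then 1 else 0)"
    by (auto simp: dual_bases_def U_pos_def U_neg_def)
  have fin: "finite ?B" using B by (simp add: is_basis_def)
  have "\<exists>y. y \<in> ?F \<and> cls y = b" if "b \<in> ?B" for b using B that by (auto simp: is_basis_def)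
  then obtain Y where Y: "\<And>b. b \<in> ?B \<Longrightarrow> Y b \<in> ?F" "\<And>b. b \<in> ?B \<Longrightarrow> cls (Y b) = b" by metis
  have "\<exists>x. x \<in> ?E \<and> cls x = s" if "s \<in> ?s ` ?B" for s
  proof -
    have "?s ` ?B \<subseteq> cls ` ?E" using S by (simp add: is_basis_def)
    then show ?thesis using that by blast
  qed
  then obtain X' where X': "\<And>s. s \<in> ?s ` ?B \<Longrightarrow> X' s \<in> ?E" "\<And>s. s \<in> ?s ` ?B \<Longrightarrow> cls (X' s) = s" by metis
  have inj: "inj_on ?s ?B"
    by (rule inj_onI) (metis delta zero_neq_one)
  define X where "X b = X' (?s b)" for b
  have X: "\<And>b. b \<in> ?B \<Longrightarrow> X b \<in> ?E" "\<And>b. b \<in> ?B \<Longrightarrow> cls (X b) = ?s b" using X' by (auto simp: X_def)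
  have expX: "cls x = cls (\<Sum>b\<in>?B. scalar (\<phi> (cls x) (cls (Y b))) * X b)" if x: "x \<in> ?E" for x
  proof -
    obtain c where "cls x = cls (\<Sum>s\<in>?s ` ?B. scalar (c s) * X' s)"
      by (rule basis_expansion[OF S X'(2) x])
    then have c: "cls x = cls (\<Sum>b\<in>?B. scalar (c (?s b)) * X b)"
      by (simp add: sum.reindex[OF inj] X_def)
    have "\<phi> (cls x) (cls (Y d)) = c (?s d)" if d: "d \<in> ?B" for d
    proof -
      have "\<phi> (cls x) (cls (Y d)) = (\<Sum>b\<in>?B. c (?s b) * \<phi> (cls (X b)) (cls (Y d)))"
        unfolding c by (rule pairing_sum_left[OF p]) (use d homog_in_pos[OF X(1)] homog_in_neg[OF Y(1)] in auto)
      also have "\<dots> = (\<Sum>b\<in>?B. if b = d then c (?s b) else 0)"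
        by (rule sum.cong) (use X Y d delta in auto)
      finally show ?thesis using fin d by simp
    qed
    then show ?thesis using c by (simp cong: sum.cong)
  qed
  have expY: "cls y = cls (\<Sum>b\<in>?B. scalar (\<phi> (cls (X b)) (cls y)) * Y b)" if y: "y \<in> ?F" for y
  proof -
    obtain c where c: "cls y = cls (\<Sum>b\<in>?B. scalar (c b) * Y b)"
      by (rule basis_expansion[OF B Y(2) y])
    have "\<phi> (cls (X d)) (cls y) = c d" if d: "d \<in> ?B" for d
    proof -
      have "\<phi> (cls (X d)) (cls y) = (\<Sum>b\<in>?B. c b * \<phi> (cls (X d)) (cls (Y b)))"
        unfolding c by (rule pairing_sum_right[OF p]) (use d homog_in_pos[OF X(1)] homog_in_neg[OF Y(1)] in auto)
      also have "\<dots> = (\<Sum>b\<in>?B. if b = d then c b else 0)"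
        by (rule sum.cong) (use X Y d delta in auto)
      finally show ?thesis using fin d by simp
    qed
    then show ?thesis using c by (simp cong: sum.cong)
  qed
  show ?thesis
    by (rule that[of X Y]) (use fin X Y expX expY in \<open>auto simp: dual_system_def\<close>)
qed

end

section \<open>The pairing of words\<close>

definition pair_sum :: "('x \<Rightarrow> 'y \<Rightarrow> KD) \<Rightarrow> (('x \<times> 'y) \<Rightarrow>\<^sub>0 KD) \<Rightarrow> KD" where
  "pair_sum h Z = (\<Sum>(u, u') \<in> Poly_Mapping.keys Z. Poly_Mapping.lookup Z (u, u') * h u u')"

lemma pair_sum_single: "pair_sum h (Poly_Mapping.single (a, b) c) = c * h a b"
  by (cases "c = 0") (simp_all add: pair_sum_def)

lemma pair_sum_add: "pair_sum h (Y + Z) = pair_sum h Y + pair_sum h Z"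
proof -
  have "pair_sum h Z = (\<Sum>k\<in>Poly_Mapping.keys Z. Poly_Mapping.lookup Z k * h (fst k) (snd k))" for Z
    by (simp add: pair_sum_def split_def)
  then show ?thesis
    by (simp only:) (rule setsum_keys_plus_distrib, simp_all add: algebra_simps)
qed

lemma pair_sum_single_mult:
  fixes Z :: "('x::monoid_add \<times> 'y::monoid_add) \<Rightarrow>\<^sub>0 KD"
  shows "pair_sum h (Poly_Mapping.single (a, b) c * Z) = c * pair_sum (\<lambda>u u'. h (a + u) (b + u')) Z"
proof (induct Z rule: pm_induct)
  case (single k d)
  then show ?case by (cases k) (simp add: mult_single pair_sum_single)
next
  case (add p q)
  then show ?case by (simp add: ring_distribs pair_sum_add)
qed

lemma pair_sum_one: "pair_sum h (1 :: ('x::monoid_add \<times> 'y::monoid_add) \<Rightarrow>\<^sub>0 KD) = h 0 0"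
  using pair_sum_single[of h 0 0 1] by (simp flip: zero_prod_def)

lemma pair_sum_cong:
  assumes "\<And>u u'. (u, u') \<in> Poly_Mapping.keys Z \<Longrightarrow> g u u' = h u u'"
  shows "pair_sum g Z = pair_sum h Z"
  unfolding pair_sum_def by (rule sum.cong) (use assms in auto)

lemma pair_sum_cmult: "pair_sum (\<lambda>u u'. c * h u u') Z = c * pair_sum h Z"
  by (simp add: pair_sum_def sum_distrib_left split_def mult.left_commute)

lemma coprod_word: "coprod (Poly_Mapping.single w 1) = prod_list (map coprod_gen (letters w))"
  by (simp add: coprod_def)

lemma counit_word: "counit (Poly_Mapping.single w 1) = prod_list (map counit_gen (letters w))"
  by (simp add: counit_def)

definition Eword :: "'i list \<Rightarrow> 'i falg" where "Eword x = Poly_Mapping.single (Word (map Eg x)) 1"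
definition Fword :: "'i list \<Rightarrow> 'i falg" where "Fword x = Poly_Mapping.single (Word (map Fg x)) 1"

lemma words_Nil: "Eword [] = 1" "Fword [] = 1"
  by (simp_all add: Eword_def Fword_def flip: zero_fword_def)

lemma Eword_Cons: "Eword (i # x) = gen (Eg i) * Eword x"
  by (simp add: Eword_def gen_def mult_single plus_fword_def)

lemma coprod_Fword_Nil: "coprod (Fword []) = 1"
  by (simp add: Fword_def coprod_word)

lemma coprod_Fword_Cons:
  "coprod (Fword (j # w)) = Poly_Mapping.single (0, Word [Fg j]) 1 * coprod (Fword w)
     + Poly_Mapping.single (Word [Fg j], Word [K'g j]) 1 * coprod (Fword w)"
  by (simp add: Fword_def coprod_word ring_distribs)

lemma keys_single_mult:
  assumes "k \<in> Poly_Mapping.keys (Poly_Mapping.single a c * Z)"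
  shows "\<exists>l\<in>Poly_Mapping.keys Z. k = a + l"
  using keys_mult[of "Poly_Mapping.single a c" Z] assms by (auto split: if_splits)

lemma keys_coprod_Fword:
  "(u, u') \<in> Poly_Mapping.keys (coprod (Fword w)) \<Longrightarrow> set (letters u) \<subseteq> range Fg \<and> set (letters u') \<subseteq> range Fg \<union> range K'g"
proof (induct w arbitrary: u u')
  case Nil
  then show ?case by (simp add: coprod_Fword_Nil zero_prod_def zero_fword_def)
next
  case (Cons j w)
  have "(u, u') \<in> Poly_Mapping.keys (Poly_Mapping.single (0, Word [Fg j]) (1::KD) * coprod (Fword w)) \<or>
      (u, u') \<in> Poly_Mapping.keys (Poly_Mapping.single (Word [Fg j], Word [K'g j]) (1::KD) * coprod (Fword w))"
    using Cons(2) unfolding coprod_Fword_Cons by (auto simp: in_keys_iff lookup_add)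
  then show ?case
  proof
    assume "(u, u') \<in> Poly_Mapping.keys (Poly_Mapping.single (0, Word [Fg j]) (1::KD) * coprod (Fword w))"
    from keys_single_mult[OF this] obtain r s
      where rs: "(r, s) \<in> Poly_Mapping.keys (coprod (Fword w))" "u = r" "u' = Word [Fg j] + s" by auto
    show ?thesis using Cons(1)[OF rs(1)] by (auto simp: rs(2,3) plus_fword_def)
  next
    assume "(u, u') \<in> Poly_Mapping.keys (Poly_Mapping.single (Word [Fg j], Word [K'g j]) (1::KD) * coprod (Fword w))"
    from keys_single_mult[OF this] obtain r s
      where rs: "(r, s) \<in> Poly_Mapping.keys (coprod (Fword w))" "u = Word [Fg j] + r" "u' = Word [K'g j] + s" by auto
    show ?thesis using Cons(1)[OF rs(1)] by (auto simp: rs(2,3) plus_fword_def)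
  qed
qed

text \<open>
  The counit axiom \<open>(id \<otimes> \<epsilon>) \<Delta> = id\<close> on \<open>F\<^sub>w\<close>, in the form in which it disposes of the letters behind a
  deleted one.
\<close>

lemma pair_sum_counit:
  "pair_sum (\<lambda>u u'. counit (Poly_Mapping.single u' 1) * f u) (coprod (Fword w)) = f (Word (map Fg w))"
proof (induct w arbitrary: f)
  case Nil
  show ?case by (simp add: coprod_Fword_Nil pair_sum_one counit_word zero_fword_def)
next
  case (Cons j w)
  have "pair_sum (\<lambda>u u'. counit (Poly_Mapping.single u' 1) * f u) (coprod (Fword (j # w))) =
      pair_sum (\<lambda>u u'. 0 * f u) (coprod (Fword w)) +
      pair_sum (\<lambda>u u'. counit (Poly_Mapping.single u' 1) * f (Word [Fg j] + u)) (coprod (Fword w))"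
    by (simp add: coprod_Fword_Cons pair_sum_add pair_sum_single_mult counit_word plus_fword_def)
  also have "\<dots> = f (Word [Fg j] + Word (map Fg w))"
    using Cons[of "\<lambda>u. f (Word [Fg j] + u)"] pair_sum_cmult[of 0] by simp
  finally show ?case by (simp add: plus_fword_def)
qed

context qgroup
begin

text \<open>
  The value \<open>(E\<^sub>i x, F\<^sub>w)\<close> when \<open>f\<close> is the function \<open>u \<mapsto> (x, F\<^sub>u)\<close>: each letter \<open>F\<^sub>i\<close> of \<open>w\<close> is
  deleted in turn, at the cost of moving \<open>E\<^sub>i\<close> past the letters in front of it. The factor for
  passing \<open>F\<^sub>j\<close> is \<open>(K\<^sub>i, K'\<^sub>j)\<close>.
\<close>

fun contract :: "'i \<Rightarrow> ('i list \<Rightarrow> KD) \<Rightarrow> 'i list \<Rightarrow> KD" where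
  "contract i f [] = 0"
| "contract i f (j # w) = (if i = j then inverse (inverse (vi i) - vi i) * f w else 0)
     + vpow (simple_root i \<bullet>\<bullet> simple_root j)
       * tpow (ang (simple_root j) (simple_root i) - ang (simple_root i) (simple_root j))
       * contract i (\<lambda>u. f (j # u)) w"

lemma single_in_pos: "set (letters w) \<subseteq> range Eg \<union> range Kg \<union> range Kg_inv \<Longrightarrow> Poly_Mapping.single w c \<in> pos_subalg"
  by (simp add: pos_subalg_def free_subalg_single)

lemma single_in_neg: "set (letters w) \<subseteq> range Fg \<union> range K'g \<union> range K'g_inv \<Longrightarrow> Poly_Mapping.single w c \<in> neg_subalg"
  by (simp add: neg_subalg_def free_subalg_single)

text \<open>
  This is \<open>\<Delta>(E\<^sub>i) = E\<^sub>i \<otimes> 1 + K\<^sub>i \<otimes> E\<^sub>i\<close>, paired with a product.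
\<close>

lemma pairing_E_mult:
  assumes p: "is_pairing \<phi>" and y: "y \<in> neg_subalg" and y': "y' \<in> neg_subalg"
  shows "\<phi> (cls (gen (Eg i))) (cls (y * y')) = \<phi> (cls (gen (Eg i))) (cls y) * counit y'
     + \<phi> (cls (gen (Kg i))) (cls y) * \<phi> (cls (gen (Eg i))) (cls y')"
proof -
  have "\<phi> (cls (gen (Eg i))) (cls (y * y')) = pair_sum (\<lambda>u u'. \<phi> (cls (Poly_Mapping.single u 1)) (cls y) *
      \<phi> (cls (Poly_Mapping.single u' 1)) (cls y')) (coprod (gen (Eg i)))"
    unfolding pair_sum_def by (rule pairing_mult_right[OF p _ y y']) (simp add: gen_def single_in_pos)
  also have "coprod (gen (Eg i)) = Poly_Mapping.single (Word [Eg i], 0) 1 + Poly_Mapping.single (Word [Kg i], Word [Eg i]) 1"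
    by (simp add: gen_def coprod_word)
  finally show ?thesis
    using pairing_one_left[OF p y'] by (simp add: pair_sum_add pair_sum_single gen_def)
qed

text \<open>
  By \<open>\<Delta>(F\<^sub>j) = 1 \<otimes> F\<^sub>j + F\<^sub>j \<otimes> K'\<^sub>j\<close>, the first letter of \<open>w\<close> is either paired with \<open>E\<^sub>i\<close>, and then all
  other letters stay in the left factor, or it stays there itself and leaves \<open>K'\<^sub>j\<close> behind.
\<close>

lemma pair_sum_contract:
  assumes p: "is_pairing \<phi>"
  shows "pair_sum (\<lambda>u u'. \<phi> (cls (gen (Eg i))) (cls (Poly_Mapping.single u' 1)) * f u) (coprod (Fword w)) =
    contract i (\<lambda>js. f (Word (map Fg js))) w"
proof (induct w arbitrary: f)
  case Nil
  have "\<phi> (cls (gen (Eg i))) (cls (Poly_Mapping.single 0 1)) = 0"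
    by (rule pairing_E_K[OF p]) (simp add: zero_fword_def)
  then show ?case by (simp add: coprod_Fword_Nil pair_sum_one)
next
  case (Cons j w)
  let ?E = "cls (gen (Eg i))" and ?Z = "coprod (Fword w)" and ?c = "if i = j then inverse (inverse (vi i) - vi i) else 0"
  let ?q = "vpow (simple_root i \<bullet>\<bullet> simple_root j)
       * tpow (ang (simple_root j) (simple_root i) - ang (simple_root i) (simple_root j))"
  have split: "Poly_Mapping.single (Word [g] + u') 1 = gen g * Poly_Mapping.single u' (1::KD)" for g :: "'i qgen" and u'
    by (simp add: gen_def mult_single)
  have u': "Poly_Mapping.single u' 1 \<in> neg_subalg" if "(u, u') \<in> Poly_Mapping.keys ?Z" for u u'
    using keys_coprod_Fword[OF that] by (intro single_in_neg) blast
  have K: "\<phi> (cls (gen (Kg i))) (cls (gen (Fg j))) = 0" "\<phi> ?E (cls (gen (K'g j))) = 0"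
    "\<phi> (cls (gen (Kg i))) (cls (gen (K'g j))) = ?q"
    using pairing_K_F[OF p, of "Word [Kg i]" j] pairing_E_K[OF p, of "Word [K'g j]" i]
      pairing_torus[OF p, of "Word [Kg i]" "Word [K'g j]"]
    by (simp_all add: gen_def word_deg_def)
  have gens: "gen (Fg j) \<in> neg_subalg" "gen (K'g j) \<in> neg_subalg"
    by (simp_all add: gen_def single_in_neg)
  have F: "\<phi> ?E (cls (Poly_Mapping.single (Word [Fg j] + u') 1)) = ?c * counit (Poly_Mapping.single u' 1)"
    if "(u, u') \<in> Poly_Mapping.keys ?Z" for u u'
    unfolding split pairing_E_mult[OF p gens(1) u'[OF that]] by (simp add: K pairing_E_F[OF p])
  have K': "\<phi> ?E (cls (Poly_Mapping.single (Word [K'g j] + u') 1)) = ?q * \<phi> ?E (cls (Poly_Mapping.single u' 1))"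
    if "(u, u') \<in> Poly_Mapping.keys ?Z" for u u'
    unfolding split pairing_E_mult[OF p gens(2) u'[OF that]] by (simp add: K)
  have "pair_sum (\<lambda>u u'. \<phi> ?E (cls (Poly_Mapping.single u' 1)) * f u) (coprod (Fword (j # w))) =
      pair_sum (\<lambda>u u'. \<phi> ?E (cls (Poly_Mapping.single (Word [Fg j] + u') 1)) * f u) ?Z +
      pair_sum (\<lambda>u u'. \<phi> ?E (cls (Poly_Mapping.single (Word [K'g j] + u') 1)) * f (Word [Fg j] + u)) ?Z"
    by (simp add: coprod_Fword_Cons pair_sum_add pair_sum_single_mult)
  also have "pair_sum (\<lambda>u u'. \<phi> ?E (cls (Poly_Mapping.single (Word [Fg j] + u') 1)) * f u) ?Z =
      pair_sum (\<lambda>u u'. ?c * (counit (Poly_Mapping.single u' 1) * f u)) ?Z"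
    by (rule pair_sum_cong) (simp add: F)
  also have "\<dots> = ?c * f (Word (map Fg w))" by (simp only: pair_sum_cmult pair_sum_counit)
  also have "pair_sum (\<lambda>u u'. \<phi> ?E (cls (Poly_Mapping.single (Word [K'g j] + u') 1)) * f (Word [Fg j] + u)) ?Z =
      pair_sum (\<lambda>u u'. ?q * (\<phi> ?E (cls (Poly_Mapping.single u' 1)) * f (Word [Fg j] + u))) ?Z"
    by (rule pair_sum_cong) (simp add: K' mult.assoc)
  also have "\<dots> = ?q * contract i (\<lambda>js. f (Word (map Fg (j # js)))) w"
    by (simp only: pair_sum_cmult Cons) (simp add: plus_fword_def)
  finally show ?case by simp
qed

lemma Eword_in_pos: "Eword x \<in> pos_subalg" and Fword_in_neg: "Fword w \<in> neg_subalg"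
  unfolding Eword_def Fword_def by (rule single_in_pos single_in_neg; auto)+

lemma pairing_word_Nil:
  assumes p: "is_pairing \<phi>"
  shows "\<phi> (cls (Eword [])) (cls (Fword w)) = (if w = [] then 1 else 0)"
  unfolding words_Nil pairing_one_left[OF p Fword_in_neg]
  by (cases w) (simp_all add: Fword_def counit_word)

lemma pairing_word_Cons:
  assumes p: "is_pairing \<phi>"
  shows "\<phi> (cls (Eword (i # x))) (cls (Fword w)) = contract i (\<lambda>u. \<phi> (cls (Eword x)) (cls (Fword u))) w"
proof -
  have "gen (Eg i) \<in> pos_subalg" by (simp add: gen_def single_in_pos)
  then have "\<phi> (cls (Eword (i # x))) (cls (Fword w)) =
    pair_sum (\<lambda>u u'. \<phi> (cls (gen (Eg i))) (cls (Poly_Mapping.single u' 1)) * \<phi> (cls (Eword x)) (cls (Poly_Mapping.single u 1)))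
      (coprod (Fword w))"
    unfolding Eword_Cons pair_sum_def by (rule pairing_mult_left[OF p _ Eword_in_pos Fword_in_neg])
  then show ?thesis unfolding pair_sum_contract[OF p] by (simp only: Fword_def)
qed

section \<open>Powers of the parameters\<close>

text \<open>These are the exponents in \<open>D\<^bsup>-1\<^esup>\<int>\<close>, for which the rounding in \<open>vpow\<close> and \<open>tpow\<close> is harmless.\<close>

definition Dint :: "rat set" where "Dint = {a. of_nat D * a \<in> \<int>}"

lemma Dint_closed:
  shows Dint_0: "0 \<in> Dint" and Dint_add: "a \<in> Dint \<Longrightarrow> b \<in> Dint \<Longrightarrow> a + b \<in> Dint"
    and Dint_minus: "a \<in> Dint \<Longrightarrow> - a \<in> Dint" and Dint_diff: "a \<in> Dint \<Longrightarrow> b \<in> Dint \<Longrightarrow> a - b \<in> Dint"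
    and Dint_int_mult: "a \<in> Dint \<Longrightarrow> of_nat n * a \<in> Dint"
proof -
  show "0 \<in> Dint" by (simp add: Dint_def)
  show "a + b \<in> Dint" if "a \<in> Dint" "b \<in> Dint" for a b
    using Ints_add[of "of_nat D * a" "of_nat D * b"] that by (simp add: Dint_def distrib_left)
  show "a - b \<in> Dint" if "a \<in> Dint" "b \<in> Dint" for a b
    using Ints_diff[of "of_nat D * a" "of_nat D * b"] that by (simp add: Dint_def right_diff_distrib)
  show "- a \<in> Dint" if "a \<in> Dint" for a
    using that by (simp add: Dint_def)
  show "of_nat n * a \<in> Dint" if "a \<in> Dint" for n a
    using Ints_mult[OF Ints_of_nat[of n], of "of_nat D * a"] that by (simp add: Dint_def mult.left_commute)
qed

lemma v_root_nonzero: "v_root \<noteq> 0"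
  by (simp add: v_root_def Zero_fract_def eq_fract)

lemma vpow_add: "a \<in> Dint \<Longrightarrow> b \<in> Dint \<Longrightarrow> vpow (a + b) = vpow a * vpow b"
  by (auto simp: vpow_def Dint_def distrib_left power_int_add v_root_nonzero elim!: Ints_cases)

lemma vpow_nonzero: "vpow a \<noteq> 0"
  by (simp add: vpow_def v_root_nonzero power_int_not_zero)

lemma tpow_0: "tpow 0 = 1"
  by (simp add: tpow_def)

end

section \<open>Comparison of the pairings\<close>

lemma angle_simps:
  shows "angle \<Omega> (x + y) z = angle \<Omega> x z + angle \<Omega> y z" and "angle \<Omega> x (y + z) = angle \<Omega> x y + angle \<Omega> x z"
    and "angle \<Omega> (x - y) z = angle \<Omega> x z - angle \<Omega> y z" and "angle \<Omega> x (y - z) = angle \<Omega> x y - angle \<Omega> x z"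
    and "angle \<Omega> (- x) z = - angle \<Omega> x z" and "angle \<Omega> x (- z) = - angle \<Omega> x z"
    and "angle \<Omega> 0 z = 0" and "angle \<Omega> x 0 = 0"
  by (simp_all add: angle_def algebra_simps sum.distrib sum_subtractf sum_negf)

lemma angle_simple_roots: "angle \<Omega> (simple_root i) (simple_root j) = of_int (\<Omega> i j)"
proof -
  have "angle \<Omega> (simple_root i) (simple_root j) =
      (\<Sum>k\<in>UNIV. \<Sum>l\<in>UNIV. if k = i then if l = j then of_int (\<Omega> i j) else 0 else 0)"
    unfolding angle_def simple_root_def axis_def by (intro sum.cong refl) auto
  also have "\<dots> = (\<Sum>k\<in>UNIV. if k = i then of_int (\<Omega> i j) else 0)"
    by (intro sum.cong refl) auto
  finally show ?thesis by simp
qed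

definition list_deg :: "'i::finite qgen list \<Rightarrow> rat ^ 'i" where "list_deg gs = sum_list (map root_deg gs)"

lemma list_deg_simps [simp]:
  "list_deg [] = 0" "list_deg (g # gs) = root_deg g + list_deg gs" "list_deg (gs @ hs) = list_deg gs + list_deg hs"
  by (simp_all add: list_deg_def)

lemma word_deg_list_deg: "word_deg root_deg w = list_deg (letters w)"
  by (simp add: word_deg_def list_deg_def)

lemma list_deg_Fg: "list_deg (map Fg w) = - list_deg (map Eg w)"
  by (induct w) simp_all

definition rescale :: "('x \<Rightarrow> KD) \<Rightarrow> ('x \<Rightarrow>\<^sub>0 KD) \<Rightarrow> ('x \<Rightarrow>\<^sub>0 KD)" where
  "rescale h x = (\<Sum>w\<in>Poly_Mapping.keys x. Poly_Mapping.single w (h w * Poly_Mapping.lookup x w))"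

lemma lookup_rescale [simp]: "Poly_Mapping.lookup (rescale h x) w = h w * Poly_Mapping.lookup x w"
proof -
  have "Poly_Mapping.lookup (rescale h x) w =
      (\<Sum>k\<in>Poly_Mapping.keys x. if k = w then h w * Poly_Mapping.lookup x w else 0)"
    unfolding rescale_def lookup_sum by (rule sum.cong) (auto simp: lookup_single when_def)
  then show ?thesis by (simp add: in_keys_iff)
qed

lemma rescale_single: "rescale h (Poly_Mapping.single w a) = Poly_Mapping.single w (h w * a)"
  by (rule poly_mapping_eqI) (simp add: lookup_single when_def)

lemma rescale_add: "rescale h (x + y) = rescale h x + rescale h y"
  by (rule poly_mapping_eqI) (simp add: lookup_add algebra_simps)

lemma rescale_scalar: "rescale h (scalar c * x) = scalar c * rescale h x"
  by (rule poly_mapping_eqI) (simp add: mult.left_commute)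

lemma rescale_0: "rescale h 0 = 0"
  by (simp add: rescale_def)

lemma rescale_sum: "rescale h (sum f A) = (\<Sum>i\<in>A. rescale h (f i))"
  by (induct A rule: infinite_finite_induct) (simp_all add: rescale_add rescale_0)

lemma free_act_rescale:
  "free_act M (rescale h x) m = (\<Sum>w\<in>Poly_Mapping.keys x. (h w * Poly_Mapping.lookup x w) *\<^sub>K foldr (act M) (letters w) m)"
  unfolding rescale_def free_act_sum by (simp add: free_act_single)

lemma rescale_rescale: "rescale g (rescale h x) = rescale (\<lambda>w. g w * h w) x"
  by (rule poly_mapping_eqI) (simp add: mult.assoc)

lemma rescale_one: "(\<And>w. h w = 1) \<Longrightarrow> rescale h x = x"
  by (rule poly_mapping_eqI) simp

lemma rescale_homog: "x \<in> free_homog S \<nu> \<Longrightarrow> rescale h x \<in> free_homog S \<nu>"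
  by (auto simp: free_homog_def free_subalg_def in_keys_iff)

lemma falg_expand: "(\<Sum>w\<in>Poly_Mapping.keys x. scalar (Poly_Mapping.lookup x w) * Poly_Mapping.single w 1) = x"
  using sum_single_lookup[of x] by simp

lemma rescale_expand:
  "rescale h x = (\<Sum>w\<in>Poly_Mapping.keys x. scalar (h w * Poly_Mapping.lookup x w) * Poly_Mapping.single w 1)"
  by (simp add: rescale_def)

lemma word_Eg: "set (letters w) \<subseteq> range Eg \<Longrightarrow> \<exists>x. w = Word (map Eg x)"
  by (cases w) (auto simp: ex_map_conv subset_iff)

lemma word_Fg: "set (letters w) \<subseteq> range Fg \<Longrightarrow> \<exists>x. w = Word (map Fg x)"
  by (cases w) (auto simp: ex_map_conv subset_iff)

locale twist = qgroup \<Omega> D \<tau> + one: qgroup \<Omega> D 1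
  for \<Omega> :: "'i::finite \<Rightarrow> 'i \<Rightarrow> int" and D :: nat and \<tau> :: KD +
  fixes L :: "(rat ^ 'i) set"
  assumes tau_nonzero: "\<tau> \<noteq> 0" and lattice: "admissible_lattice L" and denominator: "common_denominator \<Omega> L D"
begin

lemma L_root: "simple_root i \<in> L"
proof -
  have "simple_root i \<in> root_lattice" by (auto simp: root_lattice_def simple_root_def axis_def)
  then show ?thesis using lattice by (auto simp: admissible_lattice_def)
qed

lemma L_diff: "x \<in> L \<Longrightarrow> y \<in> L \<Longrightarrow> x - y \<in> L"
  using lattice by (simp add: admissible_lattice_def)

lemma L_0: "0 \<in> L"
  \<comment> \<open>the difference of a simple root with itself\<close>
  using L_diff[OF L_root L_root, of undefined undefined] by simp

lemma L_minus: "x \<in> L \<Longrightarrow> - x \<in> L"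
  using L_diff[OF L_0] by simp

lemma L_add: "x \<in> L \<Longrightarrow> y \<in> L \<Longrightarrow> x + y \<in> L"
  using L_diff[OF _ L_minus] by simp

lemma L_root_deg: "root_deg g \<in> L"
  by (cases g) (simp_all add: L_root L_minus L_0)

lemma L_list_deg: "list_deg gs \<in> L"
  by (induct gs) (simp_all add: L_0 L_add L_root_deg)

lemmas L_closed = L_root L_0 L_root_deg L_list_deg L_minus L_add L_diff

lemma ang_Dint: "x \<in> L \<Longrightarrow> y \<in> L \<Longrightarrow> ang x y \<in> Dint"
  using denominator by (simp add: common_denominator_def Dint_def)

lemma dot_Dint: "x \<in> L \<Longrightarrow> y \<in> L \<Longrightarrow> sdot \<Omega> x y \<in> Dint"
  using denominator by (simp add: common_denominator_def Dint_def)

lemma dd_ang: "dd i = ang (simple_root i) (simple_root i)"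
  by (simp add: dd_def angle_simple_roots)

lemma dd_Dint: "dd i \<in> Dint"
  by (simp add: dd_ang ang_Dint L_root)

lemmas Dint_rules = Dint_0 Dint_add Dint_minus Dint_diff Dint_int_mult dd_Dint ang_Dint dot_Dint

lemma one_tpow: "one.tpow a = 1"
  by (simp add: one.tpow_def)

lemma tpow_nonzero: "tpow a \<noteq> 0"
  by (simp add: tpow_def tau_nonzero power_int_not_zero)

lemma tpow_add: "a \<in> Dint \<Longrightarrow> b \<in> Dint \<Longrightarrow> tpow (a + b) = tpow a * tpow b"
  by (auto simp: tpow_def Dint_def distrib_left power_int_add tau_nonzero elim!: Ints_cases)

text \<open>
  The exponents of \<open>t\<close> which a product of operators \<open>E\<^sub>i\<close>, respectively \<open>F\<^sub>i\<close>, acquires under the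
  transport, apart from a part that depends on its degree and on the weight only. For letters of
  degrees \<open>\<alpha>\<^sub>1, \<alpha>\<^sub>2, \<dots>\<close> these are the sums of the \<open>\<langle>\<alpha>\<^sub>b, \<alpha>\<^sub>a\<rangle>\<close> with \<open>a < b\<close>, and of the \<open>\<langle>\<alpha>\<^sub>a, \<alpha>\<^sub>b\<rangle>\<close>
  with \<open>a \<le> b\<close>.
\<close>

primrec twE :: "'i qgen list \<Rightarrow> rat" where
  "twE [] = 0"
| "twE (g # gs) = twE gs + ang (list_deg gs) (root_deg g)"

primrec twF :: "'i qgen list \<Rightarrow> rat" where
  "twF [] = 0"
| "twF (g # gs) = twF gs + ang (root_deg g) (root_deg g) + ang (root_deg g) (list_deg gs)"

lemma twE_Dint: "twE gs \<in> Dint"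
  by (induct gs) (simp_all add: Dint_rules L_closed)

lemma twF_Dint: "twF gs \<in> Dint"
  by (induct gs) (simp_all add: Dint_rules L_closed)

lemma tpow_mult_eq: "a \<in> Dint \<Longrightarrow> b \<in> Dint \<Longrightarrow> a + b = c \<Longrightarrow> tpow a * tpow b = tpow c"
  using tpow_add by metis

text \<open>
  Deleting \<open>F\<^sub>i\<close> from \<open>w = w' F\<^sub>i w''\<close> lowers \<open>twF w\<close> by \<open>d\<^sub>i + \<langle>w', i\<rangle> + \<langle>i, w''\<rangle>\<close>, and
  \<open>contract\<close> carries \<open>t\<close> to the power \<open>\<langle>w', i\<rangle> - \<langle>i, w'\<rangle>\<close>. The difference of the two is
  \<open>d\<^sub>i + \<langle>i, \<mu>\<rangle>\<close>, with \<open>\<mu>\<close> the degree of \<open>w' w''\<close>: it is the same for all places of \<open>F\<^sub>i\<close>.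
\<close>

lemma twist_contract:
  assumes "\<And>u. list_deg (map Eg u) = \<mu> \<Longrightarrow> f\<^sub>1 u * tpow (twF (map Fg u)) = K * f u"
    and "list_deg (map Eg w) = \<mu> + simple_root i" and "\<mu> \<in> L"
  shows "one.contract i f\<^sub>1 w * tpow (twF (map Fg w)) = K * tpow (dd i + ang (simple_root i) \<mu>) * contract i f w"
  using assms
proof (induct w arbitrary: \<mu> f\<^sub>1 f K)
  case Nil
  then show ?case by simp
next
  case (Cons j w)
  let ?i = "simple_root i" and ?j = "simple_root j" and ?T = "tpow (twF (map Fg w))"
  let ?a = "dd j + ang ?j (\<mu> - ?j)" and ?b = "dd j + ang ?j (list_deg (map Eg w))"
  let ?c = "if i = j then inverse (inverse (vi i) - vi i) else 0"
  have cancel: "P * (T * b) = K * d * (q * C)"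
    if "P * T = K * inverse a * e * C" "e * b = d * q * a" "a \<noteq> 0" for P T a b e d q C :: KD
  proof -
    have "P * (T * b) = (P * T) * b" by (simp add: mult_ac)
    also have "\<dots> = K * inverse a * (e * b) * C" unfolding that(1) by (simp only: mult_ac)
    also have "\<dots> = K * d * (q * C) * (inverse a * a)" unfolding that(2) by (simp only: mult_ac)
    finally show ?thesis using that(3) by simp
  qed
  have w: "list_deg (map Eg w) = (\<mu> - ?j) + ?i" using Cons(3) by (simp add: algebra_simps)
  have T: "tpow (twF (map Fg (j # u))) = tpow (twF (map Fg u)) * tpow (dd j + ang ?j (list_deg (map Eg u)))" for u
    by (simp add: list_deg_Fg angle_simps dd_ang add.assoc tpow_add Dint_rules L_closed twF_Dint)
  have first: "?c * f\<^sub>1 w * (?T * tpow ?b) = K * tpow (dd i + ang ?i \<mu>) * (?c * f w)"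
  proof (cases "i = j")
    case True
    then have "list_deg (map Eg w) = \<mu>" using w by simp
    then show ?thesis using Cons(2)[of w] True by (simp add: mult_ac)
  qed simp
  have "one.contract i (\<lambda>u. f\<^sub>1 (j # u)) w * ?T =
      K * inverse (tpow ?a) * tpow (dd i + ang ?i (\<mu> - ?j)) * contract i (\<lambda>u. f (j # u)) w"
  proof (rule Cons(1)[OF _ w])
    fix u assume u: "list_deg (map Eg u) = \<mu> - ?j"
    then have "f\<^sub>1 (j # u) * tpow (twF (map Fg (j # u))) = K * f (j # u)" by (intro Cons(2)) simp
    then show "f\<^sub>1 (j # u) * tpow (twF (map Fg u)) = K * inverse (tpow ?a) * f (j # u)"
      unfolding T u by (simp add: field_simps tpow_nonzero)
  qed (simp add: L_closed Cons(4))
  moreover have "tpow (dd i + ang ?i (\<mu> - ?j)) * tpow ?b =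
      tpow (dd i + ang ?i \<mu>) * tpow (ang ?j ?i - ang ?i ?j) * tpow ?a"
  proof -
    have "dd i + ang ?i (\<mu> - ?j) + ?b = dd i + ang ?i \<mu> + (ang ?j ?i - ang ?i ?j) + ?a"
      by (simp add: w angle_simps)
    then have "tpow (dd i + ang ?i (\<mu> - ?j) + ?b) = tpow (dd i + ang ?i \<mu> + (ang ?j ?i - ang ?i ?j) + ?a)"
      by (rule arg_cong)
    then show ?thesis
      by (simp add: tpow_add Dint_rules L_closed Cons(4) mult_ac)
  qed
  ultimately have second: "one.contract i (\<lambda>u. f\<^sub>1 (j # u)) w * (?T * tpow ?b) =
      K * tpow (dd i + ang ?i \<mu>) * (tpow (ang ?j ?i - ang ?i ?j) * contract i (\<lambda>u. f (j # u)) w)"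
    by (rule cancel) (rule tpow_nonzero)
  have "one.contract i f\<^sub>1 (j # w) * tpow (twF (map Fg (j # w))) =
      ?c * f\<^sub>1 w * (?T * tpow ?b) + vpow (sdot \<Omega> ?i ?j) * (one.contract i (\<lambda>u. f\<^sub>1 (j # u)) w * (?T * tpow ?b))"
    unfolding T by (simp add: one_tpow algebra_simps)
  also have "\<dots> = K * tpow (dd i + ang ?i \<mu>) * contract i f (j # w)"
    unfolding first second by (simp add: algebra_simps)
  finally show ?case .
qed

text \<open>
  In front of \<open>x\<close>, of degree \<open>\<mu>\<close>, a letter \<open>E\<^sub>i\<close> raises \<open>twE\<close> by \<open>\<langle>\<mu>, i\<rangle>\<close>. Together with the
  \<open>d\<^sub>i + \<langle>i, \<mu>\<rangle>\<close> of \<open>twist_contract\<close> this is the difference of \<open>\<langle>\<mu> + i, \<mu> + i\<rangle>\<close> and \<open>\<langle>\<mu>, \<mu>\<rangle>\<close>.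
\<close>

lemma twist_pairing_words:
  assumes p: "is_pairing \<phi>" and p1: "one.is_pairing \<phi>\<^sub>1"
    and "list_deg (map Eg x) = \<nu>" and "list_deg (map Eg w) = \<nu>"
  shows "\<phi>\<^sub>1 (one.cls (Eword x)) (one.cls (Fword w)) * tpow (twE (map Eg x)) * tpow (twF (map Fg w)) =
    tpow (ang \<nu> \<nu>) * \<phi> (cls (Eword x)) (cls (Fword w))"
  using assms(3-)
proof (induct x arbitrary: w \<nu>)
  case Nil
  then show ?case
    by (auto simp: pairing_word_Nil[OF p] one.pairing_word_Nil[OF p1] tpow_0 angle_simps)
next
  case (Cons i x)
  let ?i = "simple_root i" and ?\<mu> = "list_deg (map Eg x)"
  have cancel: "P * c * b = n * C"
    if "P * b = (m * inverse e) * d * C" "m * d * q = n" "c = e * q" "e \<noteq> 0" for P b m e d C q n c :: KD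
  proof -
    have "P * c * b = (P * b) * c" by (simp add: mult_ac)
    also have "\<dots> = (m * d * q) * (inverse e * e) * C" unfolding that(1,3) by (simp only: mult_ac)
    finally show ?thesis using that(2,4) by simp
  qed
  have "one.contract i (\<lambda>u. \<phi>\<^sub>1 (one.cls (Eword x)) (one.cls (Fword u))) w * tpow (twF (map Fg w)) =
      (tpow (ang ?\<mu> ?\<mu>) * inverse (tpow (twE (map Eg x)))) * tpow (dd i + ang ?i ?\<mu>) *
      contract i (\<lambda>u. \<phi> (cls (Eword x)) (cls (Fword u))) w"
  proof (rule twist_contract)
    fix u assume "list_deg (map Eg u) = ?\<mu>"
    from Cons(1)[OF refl this]
    show "\<phi>\<^sub>1 (one.cls (Eword x)) (one.cls (Fword u)) * tpow (twF (map Fg u)) =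
        tpow (ang ?\<mu> ?\<mu>) * inverse (tpow (twE (map Eg x))) * \<phi> (cls (Eword x)) (cls (Fword u))"
      by (simp add: field_simps tpow_nonzero)
  qed (use Cons(2,3) in \<open>simp_all add: L_closed add.commute\<close>)
  moreover have "tpow (ang ?\<mu> ?\<mu>) * tpow (dd i + ang ?i ?\<mu>) * tpow (ang ?\<mu> ?i) = tpow (ang \<nu> \<nu>)"
    using Cons(2) by (auto simp: Dint_rules L_closed angle_simps dd_ang algebra_simps simp flip: tpow_add)
  moreover have "tpow (twE (map Eg (i # x))) = tpow (twE (map Eg x)) * tpow (ang ?\<mu> ?i)"
    by (simp add: tpow_add twE_Dint ang_Dint L_closed)
  ultimately show ?case
    unfolding pairing_word_Cons[OF p] one.pairing_word_Cons[OF p1]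
    by (rule cancel) (rule tpow_nonzero)
qed

definition twist_E :: "'i falg \<Rightarrow> 'i falg" where "twist_E = rescale (\<lambda>w. tpow (twE (letters w)))"
definition twist_F :: "'i falg \<Rightarrow> 'i falg" where "twist_F = rescale (\<lambda>w. tpow (twF (letters w)))"

text \<open>
  Both sides are bilinear, and on words this is \<open>twist_pairing_words\<close>.
\<close>

lemma twist_pairing:
  assumes p: "is_pairing \<phi>" and p1: "one.is_pairing \<phi>\<^sub>1"
    and x: "x \<in> free_homog (range Eg) \<nu>" and y: "y \<in> free_homog (range Fg) (- \<nu>)"
  shows "\<phi>\<^sub>1 (one.cls (twist_E x)) (one.cls (twist_F y)) = tpow (ang \<nu> \<nu>) * \<phi> (cls x) (cls y)"
proof -
  let ?s = "\<lambda>w. Poly_Mapping.single w (1::KD)" and ?lx = "Poly_Mapping.lookup x" and ?ly = "Poly_Mapping.lookup y"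
  let ?X = "Poly_Mapping.keys x" and ?Y = "Poly_Mapping.keys y"
  let ?a = "\<lambda>w. tpow (twE (letters w))" and ?b = "\<lambda>w. tpow (twF (letters w))"
  have X: "set (letters w) \<subseteq> range Eg" "word_deg root_deg w = \<nu>" if "w \<in> ?X" for w
    using x that by (auto simp: free_homog_def free_subalg_def)
  have Y: "set (letters w) \<subseteq> range Fg" "word_deg root_deg w = - \<nu>" if "w \<in> ?Y" for w
    using y that by (auto simp: free_homog_def free_subalg_def)
  have sX: "?s w \<in> pos_subalg" if "w \<in> ?X" for w using X(1)[OF that] by (intro single_in_pos) blast
  have sY: "?s w \<in> neg_subalg" if "w \<in> ?Y" for w using Y(1)[OF that] by (intro single_in_neg) blast
  have xp: "x \<in> pos_subalg" "twist_E x \<in> pos_subalg" "y \<in> neg_subalg" "twist_F y \<in> neg_subalg"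
    using x y by (auto simp: twist_E_def twist_F_def intro: homog_in_pos homog_in_neg rescale_homog)
  have word: "\<phi>\<^sub>1 (one.cls (?s w)) (one.cls (?s w')) * ?a w * ?b w' = tpow (ang \<nu> \<nu>) * \<phi> (cls (?s w)) (cls (?s w'))"
    if w: "w \<in> ?X" and w': "w' \<in> ?Y" for w w'
  proof -
    obtain u u' where u: "w = Word (map Eg u)" "w' = Word (map Fg u')"
      using word_Eg[OF X(1)[OF w]] word_Fg[OF Y(1)[OF w']] by auto
    show ?thesis
      using twist_pairing_words[OF p p1, of u \<nu> u'] X(2)[OF w] Y(2)[OF w']
      by (simp add: u word_deg_list_deg list_deg_Fg Eword_def Fword_def)
  qed
  have "\<phi>\<^sub>1 (one.cls (twist_E x)) (one.cls (twist_F y)) =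
      (\<Sum>w\<in>?X. ?a w * ?lx w * (\<Sum>w'\<in>?Y. ?b w' * ?ly w' * \<phi>\<^sub>1 (one.cls (?s w)) (one.cls (?s w'))))"
  proof -
    have "\<phi>\<^sub>1 (one.cls (twist_E x)) (one.cls (twist_F y)) =
        (\<Sum>w\<in>?X. ?a w * ?lx w * \<phi>\<^sub>1 (one.cls (?s w)) (one.cls (twist_F y)))"
      unfolding twist_E_def rescale_expand[of _ x] by (rule one.pairing_sum_left[OF p1 xp(4) sX])
    also have "\<dots> = (\<Sum>w\<in>?X. ?a w * ?lx w * (\<Sum>w'\<in>?Y. ?b w' * ?ly w' * \<phi>\<^sub>1 (one.cls (?s w)) (one.cls (?s w'))))"
      unfolding twist_F_def rescale_expand[of _ y]
      by (intro sum.cong refl arg_cong2[where f = "(*)"] one.pairing_sum_right[OF p1 sX sY])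
    finally show ?thesis .
  qed
  also have "\<dots> = (\<Sum>w\<in>?X. \<Sum>w'\<in>?Y. ?lx w * ?ly w' * (\<phi>\<^sub>1 (one.cls (?s w)) (one.cls (?s w')) * ?a w * ?b w'))"
    by (simp add: sum_distrib_left mult_ac)
  also have "\<dots> = (\<Sum>w\<in>?X. \<Sum>w'\<in>?Y. ?lx w * ?ly w' * (tpow (ang \<nu> \<nu>) * \<phi> (cls (?s w)) (cls (?s w'))))"
    by (intro sum.cong refl) (simp add: word)
  also have "\<dots> = tpow (ang \<nu> \<nu>) * (\<Sum>w\<in>?X. ?lx w * (\<Sum>w'\<in>?Y. ?ly w' * \<phi> (cls (?s w)) (cls (?s w'))))"
    by (simp add: sum_distrib_left mult_ac)
  also have "(\<Sum>w\<in>?X. ?lx w * (\<Sum>w'\<in>?Y. ?ly w' * \<phi> (cls (?s w)) (cls (?s w')))) = (\<Sum>w\<in>?X. ?lx w * \<phi> (cls (?s w)) (cls y))"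
    using pairing_sum_right[OF p sX, of _ ?Y ?s ?ly] sY
    by (intro sum.cong refl arg_cong2[where f = "(*)"]) (simp add: falg_expand del: scalar_mult_single)
  also have "\<dots> = \<phi> (cls x) (cls y)"
    using pairing_sum_left[OF p xp(3) sX, of ?X "\<lambda>w. w" ?lx] by (simp add: falg_expand del: scalar_mult_single)
  finally show ?thesis .
qed

end

section \<open>Transported modules\<close>

lemma gen_power: "gen g ^ p = Poly_Mapping.single (Word (replicate p g)) 1"
proof (induct p)
  case 0
  have "(1 :: 'a falg) = Poly_Mapping.single 0 1" by simp
  then show ?case by (simp add: zero_fword_def)
qed (simp add: gen_def mult_single plus_fword_def)

lemma list_deg_replicate: "list_deg (replicate p g) = of_nat p *s root_deg g"
  by (induct p) (simp_all add: vector_sadd_rdistrib algebra_simps)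

lemma angle_smult:
  "angle \<Omega> (c *s x) y = c * angle \<Omega> x y" "angle \<Omega> x (c *s y) = c * angle \<Omega> x y"
  by (simp_all add: angle_def sum_distrib_left mult_ac)

text \<open>The exponent \<open>p (p - 1) / 2\<close> of \<open>t\<^sub>i\<close> in \<open>[p]!\<close>.\<close>

definition tri :: "nat \<Rightarrow> nat" where "tri p = \<Sum>{..<p}"

lemma tri_simps: "tri 0 = 0" "tri (Suc p) = tri p + p"
  by (simp_all add: tri_def)

context twist
begin

lemma tpow_of_nat_mult: "a \<in> Dint \<Longrightarrow> tpow (of_nat n * a) = tpow a ^ n"
  by (induct n) (simp_all add: tpow_0 ring_distribs tpow_add Dint_rules)

lemma qnum_twist: "qnum i (Suc p) = tpow (of_nat p * dd i) * one.qnum i (Suc p)"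
proof -
  let ?t = "ti i" and ?v = "vi i" and ?n = "int (Suc p)"
  have t: "?t \<noteq> 0" by (simp add: ti_def tpow_nonzero)
  have one: "one.ti i = 1" by (simp add: one.ti_def one_tpow)
  have "qnum i (Suc p) = (?t ^ Suc p * (?v powi ?n - ?v powi (- ?n))) / (?t * (?v - inverse ?v))"
    using t by (simp add: qnum_def power_int_mult_distrib power_mult_distrib power_int_minus right_diff_distrib
        power_int_of_nat inverse_mult_distrib power_inverse mult_ac del: power_Suc of_nat_Suc)
  also have "\<dots> = ?t ^ p * ((?v powi ?n - ?v powi (- ?n)) / (?v - inverse ?v))"
    using t by simp
  also have "(?v powi ?n - ?v powi (- ?n)) / (?v - inverse ?v) = one.qnum i (Suc p)"
    by (simp add: one.qnum_def one)
  finally show ?thesis by (simp add: tpow_of_nat_mult dd_Dint ti_def)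
qed

lemma qfact_twist: "qfact i p = tpow (of_nat (tri p) * dd i) * one.qfact i p"
proof (induct p)
  case 0
  then show ?case by (simp add: qfact_def one.qfact_def tri_simps tpow_0)
next
  case (Suc p)
  have "qfact i (Suc p) = qfact i p * qnum i (Suc p)" "one.qfact i (Suc p) = one.qfact i p * one.qnum i (Suc p)"
    by (simp_all add: qfact_def one.qfact_def)
  then show ?case
    using Suc by (simp add: qnum_twist tri_simps ring_distribs tpow_add Dint_rules)
qed

lemma kappa_twist:
  "kappa i j p p' = tpow (- dd i * of_nat p * of_nat p'
     + of_nat p * ang (simple_root i) (simple_root j) - of_nat p * ang (simple_root j) (simple_root i)) * one.kappa i j p p'"
  by (simp add: kappa_def one.kappa_def one_tpow)

text \<open>
  Each pair of letters \<open>E\<^sub>i\<close> contributes \<open>d\<^sub>i\<close>, and the letter \<open>E\<^sub>j\<close> contributes one mixed value for each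
  \<open>E\<^sub>i\<close>, which depends on the side of \<open>E\<^sub>j\<close> on which that \<open>E\<^sub>i\<close> stands.
\<close>

lemma twE_serre:
  "twE (replicate p (Eg i) @ Eg j # replicate p' (Eg i)) =
     of_nat (tri p) * dd i + of_nat (tri p') * dd i + of_nat p * of_nat p' * dd i
     + of_nat p * ang (simple_root j) (simple_root i) + of_nat p' * ang (simple_root i) (simple_root j)"
proof (induct p)
  case 0
  have "twE (replicate p' (Eg i)) = of_nat (tri p') * dd i"
    by (induct p') (simp_all add: tri_simps list_deg_replicate angle_smult dd_ang algebra_simps)
  then show ?case by (simp add: tri_simps list_deg_replicate angle_smult)
next
  case (Suc p)
  then show ?case
    by (simp add: tri_simps list_deg_replicate angle_smult angle_simps algebra_simps flip: dd_ang)
qed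

lemma twF_serre:
  "twF (replicate p' (Fg i) @ Fg j # replicate p (Fg i)) =
     of_nat (tri p) * dd i + of_nat (tri p') * dd i + of_nat p * of_nat p' * dd i
     + of_nat p * ang (simple_root j) (simple_root i) + of_nat p' * ang (simple_root i) (simple_root j)
     + of_nat (p + p') * dd i + dd j"
proof (induct p')
  case 0
  have "twF (replicate p (Fg i)) = of_nat (tri p) * dd i + of_nat p * dd i"
    by (induct p) (simp_all add: tri_simps list_deg_replicate angle_smult angle_simps dd_ang algebra_simps)
  then show ?case by (simp add: tri_simps list_deg_replicate angle_smult angle_simps flip: dd_ang)
next
  case (Suc p')
  then show ?case
    by (simp add: tri_simps list_deg_replicate angle_smult angle_simps algebra_simps flip: dd_ang)
qed

text \<open>
  In the monomial of the Serre relation with \<open>p + p' = N\<close>, the powers of \<open>t\<close> in \<open>\<kappa>\<close>, in the divided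
  powers and in the twist multiply up to a power in which \<open>p\<close> and \<open>p'\<close> only enter through \<open>N\<close>.
\<close>

lemma serre_coefficient:
  assumes e: "e = of_nat (tri p) * dd i + of_nat (tri p') * dd i + of_nat p * of_nat p' * dd i
     + of_nat p * ang (simple_root j) (simple_root i) + of_nat p' * ang (simple_root i) (simple_root j) + c"
    and c: "c \<in> Dint"
  shows "tpow e * (kappa i j p p' * (inverse (qfact i p) * inverse (qfact i p'))) =
    tpow (of_nat (p + p') * ang (simple_root i) (simple_root j) + c) *
      (one.kappa i j p p' * (inverse (one.qfact i p) * inverse (one.qfact i p')))"
proof -
  let ?k = "- dd i * of_nat p * of_nat p'
     + of_nat p * ang (simple_root i) (simple_root j) - of_nat p * ang (simple_root j) (simple_root i)"
  let ?m = "of_nat (p + p') * ang (simple_root i) (simple_root j) + c"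
  let ?P = "of_nat (tri p) * dd i" and ?P' = "of_nat (tri p') * dd i"
  have cancel: "a * b * x * (inverse a * inverse b) = x" if "a \<noteq> 0" "b \<noteq> 0" for a b x :: KD
  proof -
    have "a * b * x * (inverse a * inverse b) = (a * inverse a) * (b * inverse b) * x" by (simp only: mult_ac)
    then show ?thesis using that by simp
  qed
  have pp: "of_nat p * of_nat p' * dd i \<in> Dint" "dd i * of_nat p * of_nat p' \<in> Dint"
    using Dint_int_mult[of "dd i" "p * p'"] dd_Dint by (simp_all add: mult_ac)
  have m: "?m \<in> Dint" by (intro Dint_add Dint_int_mult ang_Dint L_root c)
  have "e \<in> Dint" "?k \<in> Dint"
    unfolding e using pp by (simp_all add: Dint_rules L_closed c)
  then have "tpow e * tpow ?k = tpow (?P + ?P' + ?m)"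
    by (intro tpow_mult_eq) (simp_all add: e algebra_simps)
  also have "\<dots> = tpow ?P * tpow ?P' * tpow ?m"
    using m by (simp only: tpow_add Dint_rules)
  finally have m: "tpow e * tpow ?k * (inverse (tpow ?P) * inverse (tpow ?P')) = tpow ?m"
    by (simp only: cancel[OF tpow_nonzero tpow_nonzero])
  have "tpow e * (kappa i j p p' * (inverse (qfact i p) * inverse (qfact i p'))) =
      tpow e * tpow ?k * (inverse (tpow ?P) * inverse (tpow ?P')) *
      (one.kappa i j p p' * (inverse (one.qfact i p) * inverse (one.qfact i p')))"
    unfolding kappa_twist qfact_twist inverse_mult_distrib by (simp only: mult_ac)
  then show ?thesis unfolding m .
qed

end

lemma (in qgroup) serre_term:
  "scalar a * (divpow i p (gen g) * gen h * divpow i p' (gen g)) =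
    Poly_Mapping.single (Word (replicate p g @ h # replicate p' g)) (a * (inverse (qfact i p) * inverse (qfact i p')))"
  unfolding divpow_def gen_power by (simp add: scalar_def gen_def mult_single plus_fword_def zero_fword_def)

definition (in qgroup) serre_E :: "'i \<Rightarrow> 'i \<Rightarrow> 'i falg" where
  "serre_E i j = (let N = nat (1 - cartan i j) in \<Sum>p\<le>N. scalar (kappa i j p (N - p))
     * (divpow i p (gen (Eg i)) * gen (Eg j) * divpow i (N - p) (gen (Eg i))))"

definition (in qgroup) serre_F :: "'i \<Rightarrow> 'i \<Rightarrow> 'i falg" where
  "serre_F i j = (let N = nat (1 - cartan i j) in \<Sum>p\<le>N. scalar (kappa i j p (N - p))
     * (divpow i (N - p) (gen (Fg i)) * gen (Fg j) * divpow i p (gen (Fg i))))"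

lemma (in qgroup) serre_relators_iff:
  "r \<in> serre_relators \<longleftrightarrow> (\<exists>i j. j \<noteq> i \<and> (r = serre_E i j \<or> r = serre_F i j))"
  by (auto simp: serre_relators_def serre_E_def serre_F_def Let_def)

lemma (in qgroup) serre_E_relator: "j \<noteq> i \<Longrightarrow> serre_E i j \<in> relators"
  and serre_F_relator: "j \<noteq> i \<Longrightarrow> serre_F i j \<in> relators"
  unfolding relators_def by (rule UnI2, auto simp: serre_relators_iff)+

lemma list_deg_serre:
  assumes "p \<le> N"
  shows "list_deg (replicate p g @ h # replicate (N - p) g) = of_nat N *s root_deg g + root_deg h"
    and "list_deg (replicate (N - p) g @ h # replicate p g) = of_nat N *s root_deg g + root_deg h"
proof -
  have "of_nat N = (of_nat p + of_nat (N - p) :: rat)" using assms by simp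
  then show "list_deg (replicate p g @ h # replicate (N - p) g) = of_nat N *s root_deg g + root_deg h"
    "list_deg (replicate (N - p) g @ h # replicate p g) = of_nat N *s root_deg g + root_deg h"
    by (simp_all only: list_deg_simps list_deg_replicate vector_sadd_rdistrib add_ac)
qed

lemma (in qgroup) serre_E_homog:
  "serre_E i j \<in> free_homog (range Eg) (of_nat (nat (1 - cartan i j)) *s simple_root i + simple_root j)"
  unfolding serre_E_def Let_def serre_term
  by (intro free_homog_sum free_homog_single) (auto simp: word_deg_list_deg list_deg_serre simp del: list_deg_simps)

lemma (in qgroup) serre_F_homog:
  "serre_F i j \<in> free_homog (range Fg) (of_nat (nat (1 - cartan i j)) *s (- simple_root i) - simple_root j)"
  unfolding serre_F_def Let_def serre_term
  by (intro free_homog_sum free_homog_single) (auto simp: word_deg_list_deg list_deg_serre simp del: list_deg_simps)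

lemma (in twist) twist_serre_E:
  "twist_E (serre_E i j) =
    scalar (tpow (of_nat (nat (1 - cartan i j)) * ang (simple_root i) (simple_root j))) * one.serre_E i j"
  unfolding twist_E_def serre_E_def one.serre_E_def Let_def rescale_sum sum_distrib_left
proof (rule sum.cong[OF refl])
  let ?N = "nat (1 - cartan i j)"
  fix p assume "p \<in> {..?N}"
  then have "p + (?N - p) = ?N" by simp
  then show "rescale (\<lambda>w. tpow (twE (letters w)))
      (scalar (kappa i j p (?N - p)) * (divpow i p (gen (Eg i)) * gen (Eg j) * divpow i (?N - p) (gen (Eg i)))) =
    scalar (tpow (of_nat ?N * ang (simple_root i) (simple_root j))) *
      (scalar (one.kappa i j p (?N - p)) * (one.divpow i p (gen (Eg i)) * gen (Eg j) * one.divpow i (?N - p) (gen (Eg i))))"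
    using serre_coefficient[of "twE (replicate p (Eg i) @ Eg j # replicate (?N - p) (Eg i))" p i "?N - p" j 0]
    unfolding serre_term one.serre_term by (simp add: rescale_single twE_serre Dint_0)
qed

lemma (in twist) twist_serre_F:
  "twist_F (serre_F i j) = scalar (tpow (of_nat (nat (1 - cartan i j)) * ang (simple_root i) (simple_root j)
     + (of_nat (nat (1 - cartan i j)) * dd i + dd j))) * one.serre_F i j"
  unfolding twist_F_def serre_F_def one.serre_F_def Let_def rescale_sum sum_distrib_left
proof (rule sum.cong[OF refl])
  let ?N = "nat (1 - cartan i j)"
  fix p assume "p \<in> {..?N}"
  then have N: "p + (?N - p) = ?N" by simp
  have N': "of_nat (p + (?N - p)) = (of_nat ?N :: rat)" unfolding N ..
  have "twF (replicate (?N - p) (Fg i) @ Fg j # replicate p (Fg i)) = of_nat (tri p) * dd i + of_nat (tri (?N - p)) * dd i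
      + of_nat p * of_nat (?N - p) * dd i + of_nat p * ang (simple_root j) (simple_root i)
      + of_nat (?N - p) * ang (simple_root i) (simple_root j) + (of_nat ?N * dd i + dd j)"
    unfolding twF_serre N' by (simp only: add.assoc)
  from serre_coefficient[OF this Dint_add[OF Dint_int_mult[OF dd_Dint] dd_Dint]]
  show "rescale (\<lambda>w. tpow (twF (letters w)))
      (scalar (kappa i j p (?N - p)) * (divpow i (?N - p) (gen (Fg i)) * gen (Fg j) * divpow i p (gen (Fg i)))) =
    scalar (tpow (of_nat ?N * ang (simple_root i) (simple_root j) + (of_nat ?N * dd i + dd j))) *
      (scalar (one.kappa i j p (?N - p)) * (one.divpow i (?N - p) (gen (Fg i)) * gen (Fg j) * one.divpow i p (gen (Fg i))))"
    unfolding serre_term one.serre_term N'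
    by (simp add: rescale_single mult.commute[of "inverse (qfact i (?N - p))"] mult.commute[of "inverse (one.qfact i (?N - p))"])
qed

locale twisted_module = twist \<Omega> D \<tau> L
  for \<Omega> :: "'i::finite \<Rightarrow> 'i \<Rightarrow> int" and D :: nat and \<tau> :: KD and L :: "(rat ^ 'i) set" +
  fixes M :: "('i, 'm::kd_space) wmod"
  assumes module: "one.weight_module L M"
begin

lemma finite_dim: "kd_finite_dim TYPE('m)" and grading: "is_grading L (wt M)"
  and linear_act_one: "kd_linear (act M g)"
  and relators_act_one: "r \<in> one.relators \<Longrightarrow> free_act M r m = 0"
  using module by (auto simp: one.weight_module_def)

sublocale one: u_module \<Omega> D 1 M
  by (intro u_module.intro free_module.intro u_module_axioms.intro linear_act_one relators_act_one)

lemma act_weight: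
  assumes "\<gamma> \<in> L" "m \<in> wt M \<gamma>"
  shows E_weight: "act M (Eg i) m \<in> wt M (\<gamma> + simple_root i)"
    and F_weight: "act M (Fg i) m \<in> wt M (\<gamma> - simple_root i)"
    and K_weight: "act M (Kg i) m = vpow (sdot \<Omega> (simple_root i) \<gamma>) *\<^sub>K m"
    and K'_weight: "act M (K'g i) m = vpow (- sdot \<Omega> (simple_root i) \<gamma>) *\<^sub>K m"
  using module assms by (auto simp: one.weight_module_def one_tpow)

abbreviation \<Phi> :: "('i, 'm) wmod" where "\<Phi> \<equiv> transport M"

lemma wt_transport: "wt \<Phi> = wt M"
  by (simp add: transport_def)

text \<open>The eigenvalues of \<open>K\<^sub>i\<close> and \<open>K'\<^sub>i\<close> on the transported weight space; they are characters of \<open>L\<close>.\<close>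

definition chi :: "'i \<Rightarrow> rat ^ 'i \<Rightarrow> KD" where
  "chi i \<gamma> = vpow (sdot \<Omega> (simple_root i) \<gamma>) * tpow (ang \<gamma> (simple_root i) - ang (simple_root i) \<gamma>)"
definition chi' :: "'i \<Rightarrow> rat ^ 'i \<Rightarrow> KD" where
  "chi' i \<gamma> = vpow (- sdot \<Omega> (simple_root i) \<gamma>) * tpow (ang \<gamma> (simple_root i) - ang (simple_root i) \<gamma>)"

lemma chi_nonzero: "chi i \<gamma> \<noteq> 0" "chi' i \<gamma> \<noteq> 0"
  by (simp_all add: chi_def chi'_def vpow_nonzero tpow_nonzero)

lemma chi_add:
  assumes "\<gamma> \<in> L" "\<beta> \<in> L"
  shows "chi i (\<gamma> + \<beta>) = chi i \<gamma> * chi i \<beta>" and "chi' i (\<gamma> + \<beta>) = chi' i \<gamma> * chi' i \<beta>"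
proof -
  let ?i = "simple_root i"
  have s: "sdot \<Omega> ?i (\<gamma> + \<beta>) = sdot \<Omega> ?i \<gamma> + sdot \<Omega> ?i \<beta>"
    by (simp add: sdot_def angle_simps)
  have s': "- sdot \<Omega> ?i (\<gamma> + \<beta>) = - sdot \<Omega> ?i \<gamma> + - sdot \<Omega> ?i \<beta>"
    by (simp add: sdot_def angle_simps)
  have t: "ang (\<gamma> + \<beta>) ?i - ang ?i (\<gamma> + \<beta>) = (ang \<gamma> ?i - ang ?i \<gamma>) + (ang \<beta> ?i - ang ?i \<beta>)"
    by (simp add: angle_simps)
  show "chi i (\<gamma> + \<beta>) = chi i \<gamma> * chi i \<beta>"
    unfolding chi_def s t using assms by (simp only: vpow_add tpow_add Dint_rules L_closed mult_ac)
  show "chi' i (\<gamma> + \<beta>) = chi' i \<gamma> * chi' i \<beta>"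
    unfolding chi'_def s' t using assms by (simp only: vpow_add tpow_add Dint_rules L_closed mult_ac)
qed

lemma act_transport:
  assumes "m \<in> wt M \<gamma>"
  shows "act \<Phi> (Eg i) m = tpow (ang \<gamma> (simple_root i)) *\<^sub>K act M (Eg i) m"
    and "act \<Phi> (Fg i) m = tpow (dd i - ang (simple_root i) \<gamma>) *\<^sub>K act M (Fg i) m"
    and "act \<Phi> (Kg i) m = chi i \<gamma> *\<^sub>K m"
    and "act \<Phi> (Kg_inv i) m = inverse (chi i \<gamma>) *\<^sub>K m"
    and "act \<Phi> (K'g i) m = chi' i \<gamma> *\<^sub>K m"
    and "act \<Phi> (K'g_inv i) m = inverse (chi' i \<gamma>) *\<^sub>K m"
  by (simp_all add: transport_def chi_def chi'_def graded_op_weight[OF grading assms linear_act_one]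
      graded_op_weight[OF grading assms kd_linear_id])

sublocale free_module \<Phi>
proof (rule free_module.intro)
  fix g show "kd_linear (act \<Phi> g)"
    by (cases g) (simp_all add: transport_def kd_linear_graded_op[OF grading finite_dim linear_act_one]
        kd_linear_graded_op[OF grading finite_dim kd_linear_id])
qed

lemma foldr_weight:
  assumes "\<gamma> \<in> L" "m \<in> wt M \<gamma>" and "set gs \<subseteq> range Eg \<union> range Fg"
  shows "foldr (act M) gs m \<in> wt M (\<gamma> + list_deg gs)"
  using assms(3)
proof (induct gs)
  case (Cons g gs)
  then have IH: "foldr (act M) gs m \<in> wt M (\<gamma> + list_deg gs)" by simp
  have L: "\<gamma> + list_deg gs \<in> L" by (simp add: L_closed assms)
  show ?case
    using Cons(2) E_weight[OF L IH] F_weight[OF L IH] by (auto simp: algebra_simps)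
qed (simp add: assms)

lemma foldr_transport_E:
  assumes "\<gamma> \<in> L" "m \<in> wt M \<gamma>" and "set gs \<subseteq> range Eg"
  shows "foldr (act \<Phi>) gs m = tpow (ang \<gamma> (list_deg gs) + twE gs) *\<^sub>K foldr (act M) gs m"
  using assms(3)
proof (induct gs)
  case (Cons g gs)
  then obtain i where i: "g = Eg i" and gs: "set gs \<subseteq> range Eg" by auto
  have w: "foldr (act M) gs m \<in> wt M (\<gamma> + list_deg gs)"
    by (rule foldr_weight[OF assms(1,2)]) (use gs in auto)
  have "tpow (ang \<gamma> (list_deg gs) + twE gs) * tpow (ang (\<gamma> + list_deg gs) (simple_root i)) =
      tpow (ang \<gamma> (list_deg (g # gs)) + twE (g # gs))"
    by (rule tpow_mult_eq) (simp_all add: Dint_rules L_closed twE_Dint assms(1) i angle_simps algebra_simps)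
  then show ?case
    using Cons(1)[OF gs] by (simp add: i kd_linear_scale[OF linear_act] act_transport(1)[OF w] kscale_kscale)
qed (simp add: tpow_0 kscale_one angle_simps)

lemma foldr_transport_F:
  assumes "\<gamma> \<in> L" "m \<in> wt M \<gamma>" and "set gs \<subseteq> range Fg"
  shows "foldr (act \<Phi>) gs m = tpow (ang (list_deg gs) \<gamma> + twF gs) *\<^sub>K foldr (act M) gs m"
  using assms(3)
proof (induct gs)
  case (Cons g gs)
  then obtain i where i: "g = Fg i" and gs: "set gs \<subseteq> range Fg" by auto
  have w: "foldr (act M) gs m \<in> wt M (\<gamma> + list_deg gs)"
    by (rule foldr_weight[OF assms(1,2)]) (use gs in auto)
  have "tpow (ang (list_deg gs) \<gamma> + twF gs) * tpow (dd i - ang (simple_root i) (\<gamma> + list_deg gs)) =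
      tpow (ang (list_deg (g # gs)) \<gamma> + twF (g # gs))"
    by (rule tpow_mult_eq) (simp_all add: Dint_rules L_closed twF_Dint assms(1) i angle_simps algebra_simps dd_ang)
  then show ?case
    using Cons(1)[OF gs] by (simp add: i kd_linear_scale[OF linear_act] act_transport(2)[OF w] kscale_kscale)
qed (simp add: tpow_0 kscale_one angle_simps)

lemma free_act_transport_E:
  assumes m: "\<gamma> \<in> L" "m \<in> wt M \<gamma>" and x: "x \<in> free_homog (range Eg) \<nu>"
  shows "free_act \<Phi> x m = tpow (ang \<gamma> \<nu>) *\<^sub>K free_act M (twist_E x) m"
  unfolding free_act_def[of \<Phi>] twist_E_def free_act_rescale kd.scale_sum_right
proof (rule sum.cong[OF refl])
  fix w assume "w \<in> Poly_Mapping.keys x"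
  then have w: "set (letters w) \<subseteq> range Eg" "list_deg (letters w) = \<nu>"
    using x by (auto simp: free_homog_def free_subalg_def word_deg_list_deg)
  have "tpow (ang \<gamma> \<nu> + twE (letters w)) = tpow (ang \<gamma> \<nu>) * tpow (twE (letters w))"
    unfolding w(2)[symmetric] by (simp add: tpow_add Dint_rules L_closed m twE_Dint)
  then show "Poly_Mapping.lookup x w *\<^sub>K foldr (act \<Phi>) (letters w) m =
      tpow (ang \<gamma> \<nu>) *\<^sub>K (tpow (twE (letters w)) * Poly_Mapping.lookup x w) *\<^sub>K foldr (act M) (letters w) m"
    using foldr_transport_E[OF m w(1)] by (simp add: w(2) kscale_kscale mult_ac)
qed

lemma free_act_transport_F:
  assumes m: "\<gamma> \<in> L" "m \<in> wt M \<gamma>" and x: "x \<in> free_homog (range Fg) \<nu>"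
  shows "free_act \<Phi> x m = tpow (ang \<nu> \<gamma>) *\<^sub>K free_act M (twist_F x) m"
  unfolding free_act_def[of \<Phi>] twist_F_def free_act_rescale kd.scale_sum_right
proof (rule sum.cong[OF refl])
  fix w assume "w \<in> Poly_Mapping.keys x"
  then have w: "set (letters w) \<subseteq> range Fg" "list_deg (letters w) = \<nu>"
    using x by (auto simp: free_homog_def free_subalg_def word_deg_list_deg)
  have "tpow (ang \<nu> \<gamma> + twF (letters w)) = tpow (ang \<nu> \<gamma>) * tpow (twF (letters w))"
    unfolding w(2)[symmetric] by (simp add: tpow_add Dint_rules L_closed m twF_Dint)
  then show "Poly_Mapping.lookup x w *\<^sub>K foldr (act \<Phi>) (letters w) m =
      tpow (ang \<nu> \<gamma>) *\<^sub>K (tpow (twF (letters w)) * Poly_Mapping.lookup x w) *\<^sub>K foldr (act M) (letters w) m"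
    using foldr_transport_F[OF m w(1)] by (simp add: w(2) kscale_kscale mult_ac)
qed

text \<open>
  The relations of the torus and its relations with \<open>E\<^sub>j\<close> and \<open>F\<^sub>j\<close> are read off from the eigenvalues.
  The other relators act on a weight vector as multiples of the corresponding relators for \<open>t = 1\<close>: in
  the commutator, \<open>E\<^sub>iF\<^sub>j\<close> and \<open>F\<^sub>jE\<^sub>i\<close> acquire the same power of \<open>t\<close>, and it is the one in the eigenvalues
  of \<open>K\<^sub>i\<close> and \<open>K'\<^sub>i\<close> if \<open>i = j\<close>; for the Serre relators this is \<open>twist_serre_E\<close> and \<open>twist_serre_F\<close>.
\<close>

lemma transport_relators_weight:
  assumes r: "r \<in> relators" and m: "\<gamma> \<in> L" "m \<in> wt M \<gamma>"
  shows "free_act \<Phi> r m = 0"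
proof -
  note act_simps = free_act_diff free_act_mult free_act_gen free_act_scalar free_act_1
    act_transport[OF m(2)] kd_linear_scale[OF linear_act] kd_linear_scale[OF linear_free_act]
    kscale_kscale kscale_one
  note E = act_transport[OF E_weight[OF m]] and F = act_transport[OF F_weight[OF m]]
  from r consider "r \<in> torus_relators" | "r \<in> weight_relators" | "r \<in> commutator_relators" | "r \<in> serre_relators"
    by (auto simp: relators_def)
  then show ?thesis
  proof cases
    case 1
    then show ?thesis
      unfolding torus_relators_def by (auto simp: act_simps chi_nonzero mult.commute)
  next
    case 2
    have minus: "chi i (\<gamma> - simple_root j) = chi i \<gamma> * chi i (- simple_root j)"
      "chi' i (\<gamma> - simple_root j) = chi' i \<gamma> * chi' i (- simple_root j)" for i j
      using chi_add[OF m(1), of "- simple_root j" i] by (simp_all add: L_closed)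
    have cE: "vpow (sdot \<Omega> (simple_root i) (simple_root j)) *
        tpow (ang (simple_root j) (simple_root i) - ang (simple_root i) (simple_root j)) = chi i (simple_root j)"
      "vpow (- sdot \<Omega> (simple_root i) (simple_root j)) *
        tpow (ang (simple_root j) (simple_root i) - ang (simple_root i) (simple_root j)) = chi' i (simple_root j)" for i j
      by (simp_all add: chi_def chi'_def)
    have cF: "vpow (- sdot \<Omega> (simple_root i) (simple_root j)) *
        tpow (- (ang (simple_root j) (simple_root i) - ang (simple_root i) (simple_root j))) = chi i (- simple_root j)"
      "vpow (sdot \<Omega> (simple_root i) (simple_root j)) *
        tpow (- (ang (simple_root j) (simple_root i) - ang (simple_root i) (simple_root j))) = chi' i (- simple_root j)" for i j
      by (simp_all add: chi_def chi'_def angle_simps sdot_def add.commute)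
    from 2 obtain i j where "r = gen (Kg i) * gen (Eg j) * gen (Kg_inv i) - scalar (chi i (simple_root j)) * gen (Eg j) \<or>
      r = gen (K'g i) * gen (Eg j) * gen (K'g_inv i) - scalar (chi' i (simple_root j)) * gen (Eg j) \<or>
      r = gen (Kg i) * gen (Fg j) * gen (Kg_inv i) - scalar (chi i (- simple_root j)) * gen (Fg j) \<or>
      r = gen (K'g i) * gen (Fg j) * gen (K'g_inv i) - scalar (chi' i (- simple_root j)) * gen (Fg j)"
      unfolding weight_relators_def Let_def cE cF by blast
    then show ?thesis
      by (auto simp: act_simps E F chi_nonzero chi_add[OF m(1) L_root] minus)
  next
    case 3
    then obtain i j where r: "r = gen (Eg i) * gen (Fg j) - gen (Fg j) * gen (Eg i)
        - (if i = j then scalar (inverse (vi i - inverse (vi i))) * (gen (Kg i) - gen (K'g i)) else 0)"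
      unfolding commutator_relators_def by blast
    let ?r1 = "gen (Eg i) * gen (Fg j) - gen (Fg j) * gen (Eg i)
        - (if i = j then scalar (inverse (vi i - inverse (vi i))) * (gen (Kg i) - gen (K'g i)) else 0)"
    have "?r1 \<in> one.relators" unfolding one.relators_def one.commutator_relators_def by blast
    then have one: "free_act M ?r1 m = 0" by (rule relators_act_one)
    let ?i = "simple_root i" and ?j = "simple_root j"
    let ?s = "tpow (dd j - ang ?j \<gamma> + ang \<gamma> ?i - ang ?j ?i)"
    have "tpow (dd j - ang ?j \<gamma>) * tpow (ang (\<gamma> - ?j) ?i) = ?s"
      "tpow (ang \<gamma> ?i) * tpow (dd j - ang ?j (\<gamma> + ?i)) = ?s"
      by (rule tpow_mult_eq; simp add: Dint_rules L_closed m(1) angle_simps)+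
    then have EF: "act \<Phi> (Eg i) (act \<Phi> (Fg j) m) = ?s *\<^sub>K act M (Eg i) (act M (Fg j) m)"
      and FE: "act \<Phi> (Fg j) (act \<Phi> (Eg i) m) = ?s *\<^sub>K act M (Fg j) (act M (Eg i) m)"
      by (simp_all add: act_transport[OF m(2)] kd_linear_scale[OF linear_act] E F kscale_kscale)
    have K: "act \<Phi> (Kg i) m = ?s *\<^sub>K act M (Kg i) m" "act \<Phi> (K'g i) m = ?s *\<^sub>K act M (K'g i) m" if "i = j"
      using that by (simp_all add: act_transport[OF m(2)] K_weight[OF m] K'_weight[OF m] chi_def chi'_def
          dd_ang kscale_kscale mult.commute)
    have "free_act \<Phi> ?r1 m = ?s *\<^sub>K free_act M ?r1 m"
      using K by (simp add: free_act_diff free_act_mult one.free_act_mult free_act_gen free_act_scalar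
          free_act_0 EF FE kd.scale_right_diff_distrib kscale_kscale mult.commute)
    then show ?thesis using one r by simp
  next
    case 4
    then obtain i j where ij: "j \<noteq> i" and r: "r = serre_E i j \<or> r = serre_F i j"
      by (auto simp: serre_relators_iff serre_E_def serre_F_def Let_def)
    from r show ?thesis
    proof
      assume r: "r = serre_E i j"
      show ?thesis
        unfolding r free_act_transport_E[OF m serre_E_homog] twist_serre_E free_act_scalar
        by (simp add: relators_act_one one.serre_E_relator ij)
    next
      assume r: "r = serre_F i j"
      show ?thesis
        unfolding r free_act_transport_F[OF m serre_F_homog] twist_serre_F free_act_scalar
        by (simp add: relators_act_one one.serre_F_relator ij)
    qed
  qed
qed

end

context twisted_module
begin

lemma transport_relators: assumes "r \<in> relators" shows "free_act \<Phi> r m = 0"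
  by (rule linear_ext_weights[OF grading linear_free_act kd_linear_zero transport_relators_weight[OF assms]])

sublocale tr: u_module \<Omega> D \<tau> \<Phi>
  by (intro u_module.intro u_module_axioms.intro free_module_axioms transport_relators)

lemma free_act_weight:
  assumes m: "\<gamma> \<in> L" "m \<in> wt M \<gamma>" and x: "x \<in> free_homog S \<nu>" and S: "S \<subseteq> range Eg \<union> range Fg"
  shows "free_act M x m \<in> wt M (\<gamma> + \<nu>)"
  unfolding free_act_def
proof (intro kd.subspace_sum[OF grading_subspace[OF grading]] grading_scale[OF grading])
  fix w assume "w \<in> Poly_Mapping.keys x"
  then have "set (letters w) \<subseteq> range Eg \<union> range Fg" "list_deg (letters w) = \<nu>"
    using x S by (force simp: free_homog_def free_subalg_def word_deg_list_deg)+
  then show "foldr (act M) (letters w) m \<in> wt M (\<gamma> + \<nu>)"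
    using foldr_weight[OF m] by blast
qed

end

section \<open>Comparison of the canonical elements\<close>

context twist
begin

lemma twist_F_surj:
  assumes "y \<in> free_homog S \<nu>" obtains y' where "y' \<in> free_homog S \<nu>" "twist_F y' = y"
proof
  show "rescale (\<lambda>w. inverse (tpow (twF (letters w)))) y \<in> free_homog S \<nu>" by (rule rescale_homog[OF assms])
  show "twist_F (rescale (\<lambda>w. inverse (tpow (twF (letters w)))) y) = y"
    unfolding twist_F_def rescale_rescale by (rule rescale_one) (simp add: tpow_nonzero)
qed

lemma twist_E_surj:
  assumes "x \<in> free_homog S \<nu>" obtains x' where "x' \<in> free_homog S \<nu>" "twist_E x' = x"
proof
  show "rescale (\<lambda>w. inverse (tpow (twE (letters w)))) x \<in> free_homog S \<nu>" by (rule rescale_homog[OF assms])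
  show "twist_E (rescale (\<lambda>w. inverse (tpow (twE (letters w)))) x) = x"
    unfolding twist_E_def rescale_rescale by (rule rescale_one) (simp add: tpow_nonzero)
qed

lemma twist_E_homog: "x \<in> free_homog S \<nu> \<Longrightarrow> twist_E x \<in> free_homog S \<nu>"
  and twist_F_homog: "x \<in> free_homog S \<nu> \<Longrightarrow> twist_F x \<in> free_homog S \<nu>"
  by (simp_all add: twist_E_def twist_F_def rescale_homog)

text \<open>
  Although \<open>twist_E\<close> is defined on the free algebra, it respects the relations of \<open>U\<^sup>+\<close>: the
  pairing is nondegenerate, so a class is determined by its pairings, which the twist only scales.
\<close>

lemma twist_E_cls_cong:
  assumes p: "is_pairing \<phi>" and p1: "one.is_pairing \<phi>\<^sub>1" and dual: "one.dual_system \<phi>\<^sub>1 \<nu> A X Y"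
    and x: "x \<in> free_homog (range Eg) \<nu>" "x' \<in> free_homog (range Eg) \<nu>" and eq: "cls x = cls x'"
  shows "one.cls (twist_E x) = one.cls (twist_E x')"
proof -
  have exp: "one.cls (twist_E z) = one.cls (\<Sum>b\<in>A. scalar (\<phi>\<^sub>1 (one.cls (twist_E z)) (one.cls (Y b))) * X b)"
    if "z \<in> free_homog (range Eg) \<nu>" for z
    using dual twist_E_homog[OF that] unfolding one.dual_system_def by blast
  have "\<phi>\<^sub>1 (one.cls (twist_E x)) (one.cls (Y b)) = \<phi>\<^sub>1 (one.cls (twist_E x')) (one.cls (Y b))" if "b \<in> A" for b
  proof -
    have "Y b \<in> free_homog (range Fg) (- \<nu>)" using dual that by (simp add: one.dual_system_def)
    then obtain y where y: "y \<in> free_homog (range Fg) (- \<nu>)" "twist_F y = Y b" by (rule twist_F_surj)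
    show ?thesis
      using twist_pairing[OF p p1 x(1) y(1)] twist_pairing[OF p p1 x(2) y(1)] eq by (simp add: y(2))
  qed
  then show ?thesis using exp[OF x(1)] exp[OF x(2)] by simp
qed

end

locale twisted_pair = twist \<Omega> D \<tau> L + N: twisted_module \<Omega> D \<tau> L N + M: twisted_module \<Omega> D \<tau> L M
  for \<Omega> :: "'i::finite \<Rightarrow> 'i \<Rightarrow> int" and D :: nat and \<tau> :: KD and L :: "(rat ^ 'i) set"
    and N :: "('i, 'n::kd_space) wmod" and M :: "('i, 'm::kd_space) wmod"
begin

text \<open>
  Expand each twisted \<open>Y b\<close> in the \<open>Y\<^sub>1 c\<close>, with coefficients \<open>\<beta> c b\<close>, and move these to the other tensor
  factor. There they collect the twisted \<open>X b\<close> into \<open>X\<^sub>1 c\<close>, because by \<open>twist_pairing\<close> they are, up to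
  the common factor, the coefficients of the untwisted \<open>X\<^sub>1 c\<close> in the \<open>X b\<close>.
\<close>

lemma canonical_twist:
  assumes p: "is_pairing \<phi>" and p1: "one.is_pairing \<phi>\<^sub>1"
    and dual: "dual_system \<phi> \<nu> A X Y" and dual1: "one.dual_system \<phi>\<^sub>1 \<nu> A\<^sub>1 X\<^sub>1 Y\<^sub>1"
  shows "(\<Sum>b\<in>A. free_act N (twist_F (Y b)) n \<otimes>\<^sub>K free_act M (twist_E (X b)) m) =
    tpow (ang \<nu> \<nu>) *\<^sub>K (\<Sum>c\<in>A\<^sub>1. free_act N (Y\<^sub>1 c) n \<otimes>\<^sub>K free_act M (X\<^sub>1 c) m)"
proof -
  let ?E = "free_homog (range Eg) \<nu>" and ?F = "free_homog (range Fg) (- \<nu>)"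
  define \<beta> where "\<beta> c b = \<phi>\<^sub>1 (one.cls (X\<^sub>1 c)) (one.cls (twist_F (Y b)))" for c b
  have XY: "\<And>b. b \<in> A \<Longrightarrow> X b \<in> ?E" "\<And>b. b \<in> A \<Longrightarrow> Y b \<in> ?F" "\<And>c. c \<in> A\<^sub>1 \<Longrightarrow> X\<^sub>1 c \<in> ?E" "\<And>c. c \<in> A\<^sub>1 \<Longrightarrow> Y\<^sub>1 c \<in> ?F"
    using dual dual1 by (auto simp: dual_system_def one.dual_system_def)
  have Y: "free_act N (twist_F (Y b)) n = (\<Sum>c\<in>A\<^sub>1. \<beta> c b *\<^sub>K free_act N (Y\<^sub>1 c) n)" if "b \<in> A" for b
  proof -
    have "twist_F (Y b) \<in> ?F" using XY(2)[OF that] by (rule twist_F_homog)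
    then have "one.cls (twist_F (Y b)) = one.cls (\<Sum>c\<in>A\<^sub>1. scalar (\<beta> c b) * Y\<^sub>1 c)"
      using dual1 unfolding one.dual_system_def \<beta>_def by blast
    then have "free_act N (twist_F (Y b)) n = free_act N (\<Sum>c\<in>A\<^sub>1. scalar (\<beta> c b) * Y\<^sub>1 c) n"
      by (rule N.one.free_act_cong)
    then show ?thesis by (simp add: free_act_sum free_act_scalar)
  qed
  have X: "(\<Sum>b\<in>A. \<beta> c b *\<^sub>K free_act M (twist_E (X b)) m) = tpow (ang \<nu> \<nu>) *\<^sub>K free_act M (X\<^sub>1 c) m" if c: "c \<in> A\<^sub>1" for c
  proof -
    obtain x where x: "x \<in> ?E" "twist_E x = X\<^sub>1 c" using XY(3)[OF c] by (rule twist_E_surj)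
    let ?x' = "\<Sum>b\<in>A. scalar (\<phi> (cls x) (cls (Y b))) * X b"
    have "?x' \<in> ?E" by (intro free_homog_sum free_homog_scalar XY)
    moreover have "cls x = cls ?x'" using dual x(1) unfolding dual_system_def by blast
    ultimately have "one.cls (X\<^sub>1 c) = one.cls (twist_E ?x')"
      using twist_E_cls_cong[OF p p1 dual1 x(1)] x(2) by simp
    then have "free_act M (X\<^sub>1 c) m = free_act M (twist_E ?x') m" by (rule M.one.free_act_cong)
    also have "\<dots> = (\<Sum>b\<in>A. \<phi> (cls x) (cls (Y b)) *\<^sub>K free_act M (twist_E (X b)) m)"
      by (simp add: twist_E_def rescale_sum rescale_scalar free_act_sum free_act_scalar)
    finally have "free_act M (X\<^sub>1 c) m = \<dots>" .
    moreover have "\<beta> c b = tpow (ang \<nu> \<nu>) * \<phi> (cls x) (cls (Y b))" if "b \<in> A" for b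
      using twist_pairing[OF p p1 x(1) XY(2)[OF that]] by (simp add: \<beta>_def x(2))
    ultimately show ?thesis by (simp add: kd.scale_sum_right kscale_kscale)
  qed
  have "(\<Sum>b\<in>A. free_act N (twist_F (Y b)) n \<otimes>\<^sub>K free_act M (twist_E (X b)) m) =
      (\<Sum>b\<in>A. \<Sum>c\<in>A\<^sub>1. free_act N (Y\<^sub>1 c) n \<otimes>\<^sub>K (\<beta> c b *\<^sub>K free_act M (twist_E (X b)) m))"
    by (rule sum.cong) (simp_all add: Y tens_simps)
  also have "\<dots> = (\<Sum>c\<in>A\<^sub>1. free_act N (Y\<^sub>1 c) n \<otimes>\<^sub>K (\<Sum>b\<in>A. \<beta> c b *\<^sub>K free_act M (twist_E (X b)) m))"
    by (subst sum.swap) (simp add: tens_simps)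
  also have "\<dots> = tpow (ang \<nu> \<nu>) *\<^sub>K (\<Sum>c\<in>A\<^sub>1. free_act N (Y\<^sub>1 c) n \<otimes>\<^sub>K free_act M (X\<^sub>1 c) m)"
    by (simp add: X tens_simps kd.scale_sum_right)
  finally show ?thesis .
qed

end

context qgroup
begin

lemma theta_part_tens:
  assumes N: "u_module \<Omega> D \<tau> N" and M: "u_module \<Omega> D \<tau> M"
    and X: "\<And>b. b \<in> B \<nu> \<Longrightarrow> cls (X b) = sharp \<nu> b" and Y: "\<And>b. b \<in> B \<nu> \<Longrightarrow> cls (Y b) = b"
  shows "theta_part B sharp N M \<nu> (n \<otimes>\<^sub>K m) = (\<Sum>b\<in>B \<nu>. free_act N (Y b) n \<otimes>\<^sub>K free_act M (X b) m)"
proof -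
  interpret N: u_module \<Omega> D \<tau> N by (rule N)
  interpret M: u_module \<Omega> D \<tau> M by (rule M)
  have "tensor_map (u_act N b) (u_act M (sharp \<nu> b)) (n \<otimes>\<^sub>K m) = free_act N (Y b) n \<otimes>\<^sub>K free_act M (X b) m"
    if "b \<in> B \<nu>" for b
    using tensor_map_tens[OF N.linear_free_act[of "Y b"] M.linear_free_act[of "X b"]]
    by (simp add: N.u_act_cls[of "Y b", unfolded Y[OF that]] M.u_act_cls[of "X b", unfolded X[OF that]])
  then show ?thesis by (simp add: theta_part_def)
qed

lemma kd_linear_theta_part:
  assumes N: "u_module \<Omega> D \<tau> N" and M: "u_module \<Omega> D \<tau> M"
    and p: "is_pairing \<phi>" and dual: "dual_bases \<phi> B sharp" and \<nu>: "\<nu> \<in> pos_root_lattice"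
  shows "kd_linear (theta_part B sharp N M \<nu>)"
proof -
  interpret N: u_module \<Omega> D \<tau> N by (rule N)
  interpret M: u_module \<Omega> D \<tau> M by (rule M)
  obtain X Y where "dual_system \<phi> \<nu> (B \<nu>) X Y"
    and X: "\<And>b. b \<in> B \<nu> \<Longrightarrow> cls (X b) = sharp \<nu> b" and Y: "\<And>b. b \<in> B \<nu> \<Longrightarrow> cls (Y b) = b"
    by (rule dual_bases_system[OF p dual \<nu>]) (rule that; blast)
  show ?thesis
    unfolding theta_part_def
  proof (rule kd_linear_setsum)
    fix b assume b: "b \<in> B \<nu>"
    show "kd_linear (tensor_map (u_act N b) (u_act M (sharp \<nu> b)))"
      using kd_linear_tensor_map[OF N.linear_free_act[of "Y b"] M.linear_free_act[of "X b"]]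
      by (simp add: N.u_act_cls[of "Y b", unfolded Y[OF b]] M.u_act_cls[of "X b", unfolded X[OF b]])
  qed
qed

lemma theta_finite_sum:
  assumes "finite S" "S \<subseteq> pos_root_lattice"
    and "\<And>\<nu>. \<nu> \<in> pos_root_lattice \<Longrightarrow> \<nu> \<notin> S \<Longrightarrow> theta_part B sharp N M \<nu> z = 0"
  shows "theta B sharp N M z = (\<Sum>\<nu>\<in>S. theta_part B sharp N M \<nu> z)"
  unfolding theta_def by (rule sum.mono_neutral_left) (use assms in auto)

end

definition height :: "rat ^ 'i::finite \<Rightarrow> rat" where "height x = (\<Sum>i\<in>UNIV. x $ i)"

lemma height_add: "height (x + y) = height x + height y"
  by (simp add: height_def sum.distrib)

lemma height_list_deg_Eg: "height (list_deg (map Eg x)) = of_nat (length x)"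
proof (induct x)
  case (Cons i x)
  have "height (simple_root i) = 1" by (simp add: height_def simple_root_def axis_def)
  then show ?case using Cons by (simp add: height_add)
qed (simp add: height_def)

lemma height_pos_root:
  assumes "\<nu> \<in> pos_root_lattice" "\<nu> \<noteq> 0" shows "height \<nu> \<ge> 1"
proof -
  have nat: "\<nu> $ i \<in> \<nat>" for i using assms(1) by (simp add: pos_root_lattice_def)
  then have nonneg: "\<nu> $ i \<ge> 0" for i by (metis Nats_cases of_nat_0_le_iff)
  obtain i where "\<nu> $ i \<noteq> 0" using assms(2) by (auto simp: vec_eq_iff)
  then have "\<nu> $ i \<ge> 1" using nat[of i] by (auto elim!: Nats_cases)
  also have "\<nu> $ i \<le> height \<nu>" unfolding height_def by (rule member_le_sum) (auto simp: nonneg)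
  finally show ?thesis .
qed

text \<open>
  Every letter \<open>F\<^sub>i\<close> contributes \<open>-1\<close> to the height, so that only the empty word has degree \<open>0\<close>.
\<close>

lemma free_homog_Fg_0:
  assumes y: "y \<in> free_homog (range Fg) 0" shows "free_act N y n = counit y *\<^sub>K n"
proof -
  have "Poly_Mapping.keys y \<subseteq> {Word []}"
  proof
    fix w assume w: "w \<in> Poly_Mapping.keys y"
    then have "set (letters w) \<subseteq> range Fg" "list_deg (letters w) = 0"
      using y by (auto simp: free_homog_def free_subalg_def word_deg_list_deg)
    then obtain x where x: "letters w = map Fg x" using word_Fg[of w] by auto
    then have "list_deg (map Eg x) = 0" using \<open>list_deg (letters w) = 0\<close> by (simp add: list_deg_Fg)
    then have "x = []" using height_list_deg_Eg[of x] by (simp add: height_def)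
    then show "w \<in> {Word []}" using x by (cases w) simp
  qed
  then have "y = Poly_Mapping.single (Word []) (Poly_Mapping.lookup y (Word []))"
    by (intro poly_mapping_eqI) (auto simp: lookup_single when_def in_keys_iff)
  then obtain a where "y = Poly_Mapping.single (Word []) a" by blast
  then show ?thesis by (cases "a = 0") (simp_all add: free_act_single counit_def free_act_0)
qed

context twisted_pair
begin

text \<open>
  The degrees in which the quasi-R-matrix can act nontrivially. Degree \<open>0\<close> is always included, so
  that its part can be split off even if \<open>M\<close> is zero.
\<close>

definition degrees :: "(rat ^ 'i) set" where
  "degrees = insert 0 {\<nu> \<in> pos_root_lattice. \<exists>\<gamma>. wt M \<gamma> \<noteq> {0} \<and> wt M (\<gamma> + \<nu>) \<noteq> {0}}"

lemma finite_degrees: "finite degrees"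
proof -
  let ?S = "{\<gamma>. wt M \<gamma> \<noteq> {0}}"
  have "degrees \<subseteq> insert 0 ((\<lambda>(\<gamma>, \<delta>). \<delta> - \<gamma>) ` (?S \<times> ?S))"
  proof
    fix \<nu> assume "\<nu> \<in> degrees"
    then consider "\<nu> = 0" | \<gamma> where "\<gamma> \<in> ?S" "\<gamma> + \<nu> \<in> ?S" by (auto simp: degrees_def)
    then show "\<nu> \<in> insert 0 ((\<lambda>(\<gamma>, \<delta>). \<delta> - \<gamma>) ` (?S \<times> ?S))"
    proof cases
      case 2
      then have "\<nu> = (\<lambda>(\<gamma>, \<delta>). \<delta> - \<gamma>) (\<gamma>, \<gamma> + \<nu>)" "(\<gamma>, \<gamma> + \<nu>) \<in> ?S \<times> ?S" by auto
      then show ?thesis by blast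
    qed simp
  qed
  then show ?thesis using finite_weights[OF M.grading M.finite_dim] by (auto intro: finite_subset)
qed

lemma degrees_pos: "degrees \<subseteq> pos_root_lattice"
  by (auto simp: degrees_def pos_root_lattice_def)

lemma pos_root_L: "\<nu> \<in> pos_root_lattice \<Longrightarrow> \<nu> \<in> L"
proof -
  assume "\<nu> \<in> pos_root_lattice"
  then have "\<nu> \<in> root_lattice" using Nats_subset_Ints by (auto simp: pos_root_lattice_def root_lattice_def)
  then show "\<nu> \<in> L" using lattice by (auto simp: admissible_lattice_def)
qed

lemma theta_part_one_sum:
  assumes p1: "one.is_pairing \<phi>\<^sub>1" and dual1: "one.dual_bases \<phi>\<^sub>1 B\<^sub>1 sharp\<^sub>1" and \<nu>: "\<nu> \<in> pos_root_lattice"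
    and n: "\<mu> \<in> L" "n \<in> wt N \<mu>" and m: "\<gamma> \<in> L" "m \<in> wt M \<gamma>"
  obtains n' m' where "one.theta_part B\<^sub>1 sharp\<^sub>1 N M \<nu> (n \<otimes>\<^sub>K m) = (\<Sum>b\<in>B\<^sub>1 \<nu>. n' b \<otimes>\<^sub>K m' b)"
    and "\<And>b. b \<in> B\<^sub>1 \<nu> \<Longrightarrow> n' b \<in> wt N (\<mu> - \<nu>)" and "\<And>b. b \<in> B\<^sub>1 \<nu> \<Longrightarrow> m' b \<in> wt M (\<gamma> + \<nu>)"
proof -
  obtain X Y where sys: "one.dual_system \<phi>\<^sub>1 \<nu> (B\<^sub>1 \<nu>) X Y"
    and X: "\<And>b. b \<in> B\<^sub>1 \<nu> \<Longrightarrow> one.cls (X b) = sharp\<^sub>1 \<nu> b" and Y: "\<And>b. b \<in> B\<^sub>1 \<nu> \<Longrightarrow> one.cls (Y b) = b"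
    by (rule one.dual_bases_system[OF p1 dual1 \<nu>]) (rule that; blast)
  have "X b \<in> free_homog (range Eg) \<nu>" "Y b \<in> free_homog (range Fg) (- \<nu>)" if "b \<in> B\<^sub>1 \<nu>" for b
    using sys that by (auto simp: one.dual_system_def)
  then have "free_act N (Y b) n \<in> wt N (\<mu> - \<nu>)" "free_act M (X b) m \<in> wt M (\<gamma> + \<nu>)" if "b \<in> B\<^sub>1 \<nu>" for b
    using N.free_act_weight[OF n, of "Y b" "range Fg" "- \<nu>"] M.free_act_weight[OF m, of "X b" "range Eg" \<nu>] that by auto
  moreover have "one.theta_part B\<^sub>1 sharp\<^sub>1 N M \<nu> (n \<otimes>\<^sub>K m) = (\<Sum>b\<in>B\<^sub>1 \<nu>. free_act N (Y b) n \<otimes>\<^sub>K free_act M (X b) m)"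
    by (rule one.theta_part_tens[where X = X and Y = Y, OF N.one.u_module_axioms M.one.u_module_axioms])
       (simp_all add: X Y)
  ultimately show ?thesis
    using that[of "\<lambda>b. free_act N (Y b) n" "\<lambda>b. free_act M (X b) m"] by blast
qed

lemma theta_part_one_vanish:
  assumes p1: "one.is_pairing \<phi>\<^sub>1" and dual1: "one.dual_bases \<phi>\<^sub>1 B\<^sub>1 sharp\<^sub>1"
    and \<nu>: "\<nu> \<in> pos_root_lattice" "\<nu> \<notin> degrees"
  shows "one.theta_part B\<^sub>1 sharp\<^sub>1 N M \<nu> z = 0"
proof (rule tensor_linear_ext_weights[OF N.grading M.grading
      one.kd_linear_theta_part[OF N.one.u_module_axioms M.one.u_module_axioms p1 dual1 \<nu>(1)] kd_linear_zero])
  fix \<mu> \<gamma> n m assume n: "\<mu> \<in> L" "n \<in> wt N \<mu>" and m: "\<gamma> \<in> L" "m \<in> wt M \<gamma>"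
  obtain n' m' where *: "one.theta_part B\<^sub>1 sharp\<^sub>1 N M \<nu> (n \<otimes>\<^sub>K m) = (\<Sum>b\<in>B\<^sub>1 \<nu>. n' b \<otimes>\<^sub>K m' b)"
    and "\<And>b. b \<in> B\<^sub>1 \<nu> \<Longrightarrow> n' b \<in> wt N (\<mu> - \<nu>)" and m': "\<And>b. b \<in> B\<^sub>1 \<nu> \<Longrightarrow> m' b \<in> wt M (\<gamma> + \<nu>)"
    by (rule theta_part_one_sum[OF p1 dual1 \<nu>(1) n m]) (rule that; blast)
  show "one.theta_part B\<^sub>1 sharp\<^sub>1 N M \<nu> (n \<otimes>\<^sub>K m) = 0"
  proof (cases "wt M \<gamma> = {0}")
    case True
    then have "m = 0" using m by simp
    then show ?thesis
      using kd_linear_0[OF one.kd_linear_theta_part[OF N.one.u_module_axioms M.one.u_module_axioms p1 dual1 \<nu>(1)]]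
      by (simp add: tens_simps)
  next
    case False
    then have "wt M (\<gamma> + \<nu>) = {0}" using \<nu> by (auto simp: degrees_def)
    then show ?thesis using * m' by (simp add: tens_simps)
  qed
qed

text \<open>
  The three exponents come from the operators on \<open>M\<close>, from those on \<open>N\<close>, and from \<open>canonical_twist\<close>.
\<close>

lemma theta_part_transport:
  assumes p: "is_pairing \<phi>" and dual: "dual_bases \<phi> B sharp"
    and p1: "one.is_pairing \<phi>\<^sub>1" and dual1: "one.dual_bases \<phi>\<^sub>1 B\<^sub>1 sharp\<^sub>1" and \<nu>: "\<nu> \<in> pos_root_lattice"
    and n: "\<mu> \<in> L" "n \<in> wt N \<mu>" and m: "\<gamma> \<in> L" "m \<in> wt M \<gamma>"
  shows "theta_part B sharp (transport N) (transport M) \<nu> (n \<otimes>\<^sub>K m) =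
    tpow (ang \<gamma> \<nu> - ang \<nu> \<mu> + ang \<nu> \<nu>) *\<^sub>K one.theta_part B\<^sub>1 sharp\<^sub>1 N M \<nu> (n \<otimes>\<^sub>K m)"
proof -
  obtain X Y where sys: "dual_system \<phi> \<nu> (B \<nu>) X Y"
    and X: "\<And>b. b \<in> B \<nu> \<Longrightarrow> cls (X b) = sharp \<nu> b" and Y: "\<And>b. b \<in> B \<nu> \<Longrightarrow> cls (Y b) = b"
    by (rule dual_bases_system[OF p dual \<nu>]) (rule that; blast)
  obtain X\<^sub>1 Y\<^sub>1 where sys1: "one.dual_system \<phi>\<^sub>1 \<nu> (B\<^sub>1 \<nu>) X\<^sub>1 Y\<^sub>1"
    and X1: "\<And>b. b \<in> B\<^sub>1 \<nu> \<Longrightarrow> one.cls (X\<^sub>1 b) = sharp\<^sub>1 \<nu> b" and Y1: "\<And>b. b \<in> B\<^sub>1 \<nu> \<Longrightarrow> one.cls (Y\<^sub>1 b) = b"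
    by (rule one.dual_bases_system[OF p1 dual1 \<nu>]) (rule that; blast)
  have homog: "X b \<in> free_homog (range Eg) \<nu>" "Y b \<in> free_homog (range Fg) (- \<nu>)" if "b \<in> B \<nu>" for b
    using sys that by (auto simp: dual_system_def)
  note L = pos_root_L[OF \<nu>] n(1) m(1)
  let ?c = "tpow (ang \<gamma> \<nu>) * tpow (ang (- \<nu>) \<mu>)"
  have "theta_part B sharp (transport N) (transport M) \<nu> (n \<otimes>\<^sub>K m) =
      (\<Sum>b\<in>B \<nu>. free_act (transport N) (Y b) n \<otimes>\<^sub>K free_act (transport M) (X b) m)"
    by (rule theta_part_tens[where X = X and Y = Y, OF N.tr.u_module_axioms M.tr.u_module_axioms])
       (simp_all add: X Y)
  also have "\<dots> = ?c *\<^sub>K (\<Sum>b\<in>B \<nu>. free_act N (twist_F (Y b)) n \<otimes>\<^sub>K free_act M (twist_E (X b)) m)"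
    unfolding kd.scale_sum_right
    by (rule sum.cong)
       (simp_all add: N.free_act_transport_F[OF n homog(2)] M.free_act_transport_E[OF m homog(1)] tens_simps kscale_kscale)
  also have "\<dots> = (?c * tpow (ang \<nu> \<nu>)) *\<^sub>K (\<Sum>b\<in>B\<^sub>1 \<nu>. free_act N (Y\<^sub>1 b) n \<otimes>\<^sub>K free_act M (X\<^sub>1 b) m)"
    by (simp add: canonical_twist[OF p p1 sys sys1] kscale_kscale)
  also have "(\<Sum>b\<in>B\<^sub>1 \<nu>. free_act N (Y\<^sub>1 b) n \<otimes>\<^sub>K free_act M (X\<^sub>1 b) m) = one.theta_part B\<^sub>1 sharp\<^sub>1 N M \<nu> (n \<otimes>\<^sub>K m)"
    by (rule one.theta_part_tens[where X = X\<^sub>1 and Y = Y\<^sub>1, OF N.one.u_module_axioms M.one.u_module_axioms, symmetric])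
       (simp_all add: X1 Y1)
  also have "?c * tpow (ang \<nu> \<nu>) = tpow (ang \<gamma> \<nu> + ang (- \<nu>) \<mu> + ang \<nu> \<nu>)"
    using L by (simp add: tpow_add Dint_rules L_closed)
  also have "ang \<gamma> \<nu> + ang (- \<nu>) \<mu> + ang \<nu> \<nu> = ang \<gamma> \<nu> - ang \<nu> \<mu> + ang \<nu> \<nu>"
    by (simp add: angle_simps)
  finally show ?thesis .
qed

end

section \<open>Comparison of the checked R-matrices\<close>

context twisted_pair
begin

lemmas scale_tens_NM = tensor_graded_scale_weight[OF N.grading N.finite_dim M.grading M.finite_dim]
lemmas scale_tens_MN = tensor_graded_scale_weight[OF M.grading M.finite_dim N.grading N.finite_dim]
lemmas linear_scale_NM = kd_linear_tensor_graded_scale[OF N.grading N.finite_dim M.grading M.finite_dim]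
lemmas linear_scale_MN = kd_linear_tensor_graded_scale[OF M.grading M.finite_dim N.grading N.finite_dim]

context
  fixes \<phi>\<^sub>1 and B\<^sub>1 and sharp\<^sub>1
  assumes p1: "one.is_pairing \<phi>\<^sub>1" and dual1: "one.dual_bases \<phi>\<^sub>1 B\<^sub>1 sharp\<^sub>1"
begin

abbreviation "\<Theta>\<^sub>1 \<equiv> one.theta_part B\<^sub>1 sharp\<^sub>1 N M"

lemma linear_theta_part_one: "\<nu> \<in> pos_root_lattice \<Longrightarrow> kd_linear (\<Theta>\<^sub>1 \<nu>)"
  by (rule one.kd_linear_theta_part[OF N.one.u_module_axioms M.one.u_module_axioms p1 dual1])

lemma theta_one_sum: "one.theta B\<^sub>1 sharp\<^sub>1 N M z = (\<Sum>\<nu>\<in>degrees. \<Theta>\<^sub>1 \<nu> z)"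
  by (rule one.theta_finite_sum[OF finite_degrees degrees_pos theta_part_one_vanish[OF p1 dual1]])

lemma linear_theta_one: "kd_linear (one.theta B\<^sub>1 sharp\<^sub>1 N M)"
  unfolding theta_one_sum[abs_def] by (intro kd_linear_setsum linear_theta_part_one) (use degrees_pos in auto)

lemma comparison_theta_part:
  assumes \<nu>: "\<nu> \<in> pos_root_lattice" and n: "\<mu> \<in> L" "n \<in> wt N \<mu>" and m: "\<gamma> \<in> L" "m \<in> wt M \<gamma>"
  shows "comparison N M (\<Theta>\<^sub>1 \<nu> (n \<otimes>\<^sub>K m)) = tpow (ang (\<gamma> + \<nu>) (\<mu> - \<nu>)) *\<^sub>K \<Theta>\<^sub>1 \<nu> (n \<otimes>\<^sub>K m)"
proof -
  obtain n' m' where *: "\<Theta>\<^sub>1 \<nu> (n \<otimes>\<^sub>K m) = (\<Sum>b\<in>B\<^sub>1 \<nu>. n' b \<otimes>\<^sub>K m' b)"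
    and n': "\<And>b. b \<in> B\<^sub>1 \<nu> \<Longrightarrow> n' b \<in> wt N (\<mu> - \<nu>)" and m': "\<And>b. b \<in> B\<^sub>1 \<nu> \<Longrightarrow> m' b \<in> wt M (\<gamma> + \<nu>)"
    by (rule theta_part_one_sum[OF p1 dual1 \<nu> n m]) (rule that; blast)
  show ?thesis
    unfolding * comparison_def kd_linear_sum[OF linear_scale_NM] kd.scale_sum_right
    by (rule sum.cong[OF refl]) (rule scale_tens_NM[OF n' m'])
qed

text \<open>
  In degree \<open>0\<close>, the element \<open>Y b\<close> is a scalar and acts by its counit. This is \<open>(1, Y b)\<close>, the
  coefficient of \<open>X b\<close> in the expansion of \<open>1\<close>, so that the sum is \<open>1 \<otimes> 1\<close>.
\<close>

lemma theta_part_zero: "\<Theta>\<^sub>1 0 z = z"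
proof -
  have zero: "(0 :: rat ^ 'i) \<in> pos_root_lattice" by (simp add: pos_root_lattice_def)
  have "\<Theta>\<^sub>1 0 (n \<otimes>\<^sub>K m) = n \<otimes>\<^sub>K m" for n m
  proof -
    obtain X Y where sys: "one.dual_system \<phi>\<^sub>1 0 (B\<^sub>1 0) X Y"
      and X: "\<And>b. b \<in> B\<^sub>1 0 \<Longrightarrow> one.cls (X b) = sharp\<^sub>1 0 b" and Y: "\<And>b. b \<in> B\<^sub>1 0 \<Longrightarrow> one.cls (Y b) = b"
      by (rule one.dual_bases_system[OF p1 dual1 zero]) (rule that; blast)
    have Y0: "Y b \<in> free_homog (range Fg) 0" if "b \<in> B\<^sub>1 0" for b
      using sys that by (auto simp: one.dual_system_def)
    have "Poly_Mapping.single (Word []) 1 \<in> free_homog (range Eg) (0 :: rat ^ 'i)"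
      by (rule free_homog_single) (simp_all add: word_deg_def)
    then have "(1 :: 'i falg) \<in> free_homog (range Eg) 0" by (simp flip: zero_fword_def)
    then have "one.cls 1 = one.cls (\<Sum>b\<in>B\<^sub>1 0. scalar (\<phi>\<^sub>1 (one.cls 1) (one.cls (Y b))) * X b)"
      using sys unfolding one.dual_system_def by blast
    also have "(\<Sum>b\<in>B\<^sub>1 0. scalar (\<phi>\<^sub>1 (one.cls 1) (one.cls (Y b))) * X b) = (\<Sum>b\<in>B\<^sub>1 0. scalar (counit (Y b)) * X b)"
      by (rule sum.cong) (simp_all add: one.pairing_one_left[OF p1 homog_in_neg[OF Y0]])
    finally have "free_act M 1 m = free_act M (\<Sum>b\<in>B\<^sub>1 0. scalar (counit (Y b)) * X b) m"
      by (rule M.one.free_act_cong)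
    then have m: "m = (\<Sum>b\<in>B\<^sub>1 0. counit (Y b) *\<^sub>K free_act M (X b) m)"
      by (simp add: free_act_1 free_act_sum free_act_scalar)
    have "\<Theta>\<^sub>1 0 (n \<otimes>\<^sub>K m) = (\<Sum>b\<in>B\<^sub>1 0. free_act N (Y b) n \<otimes>\<^sub>K free_act M (X b) m)"
      by (rule one.theta_part_tens[where X = X and Y = Y, OF N.one.u_module_axioms M.one.u_module_axioms])
         (simp_all add: X Y)
    also have "\<dots> = (\<Sum>b\<in>B\<^sub>1 0. n \<otimes>\<^sub>K (counit (Y b) *\<^sub>K free_act M (X b) m))"
      by (rule sum.cong) (simp_all add: free_homog_Fg_0[OF Y0] tens_simps)
    also have "\<dots> = n \<otimes>\<^sub>K m" unfolding tens_simps(8)[symmetric] m[symmetric] ..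
    finally show ?thesis .
  qed
  then show ?thesis by (rule tensor_linear_ext[OF linear_theta_part_one[OF zero] kd_linear_id])
qed

text \<open>
  The parts of nonzero degree raise the height of the weight in \<open>M\<close> by at least \<open>1\<close>, and the heights
  that occur are bounded. Hence the spans of the \<open>n \<otimes> m\<close> with \<open>m\<close> of large height form a filtration as
  in \<open>bij_unipotent\<close>.
\<close>

lemma bij_theta_one: "bij (one.theta B\<^sub>1 sharp\<^sub>1 N M)"
proof -
  let ?S = "{\<gamma>. wt M \<gamma> \<noteq> {0}}"
  have fin: "finite (height ` ?S)" using finite_weights[OF M.grading M.finite_dim] by simp
  obtain h where h: "\<And>\<gamma>. \<gamma> \<in> ?S \<Longrightarrow> h \<le> height \<gamma>"
    using bdd_below_finite[OF fin] by (auto simp: bdd_below_def)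
  obtain H where H: "\<And>\<gamma>. \<gamma> \<in> ?S \<Longrightarrow> height \<gamma> \<le> H"
    using bdd_above_finite[OF fin] by (auto simp: bdd_above_def)
  obtain k where k: "H - h < of_nat k" using reals_Archimedean2[of "H - h"] by blast
  define G where "G j = {n \<otimes>\<^sub>K m | n m \<mu> \<gamma>. \<mu> \<in> L \<and> \<gamma> \<in> L \<and> n \<in> wt N \<mu> \<and> m \<in> wt M \<gamma> \<and> h + of_nat j \<le> height \<gamma>}" for j :: nat
  define X where "X z = (\<Sum>\<nu>\<in>degrees - {0}. \<Theta>\<^sub>1 \<nu> z)" for z
  have linX: "kd_linear X"
    unfolding X_def[abs_def] by (intro kd_linear_setsum linear_theta_part_one) (use degrees_pos in auto)
  have "bij (\<lambda>z. z + X z)"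
  proof (rule bij_unipotent[OF linX])
    fix j z assume "z \<in> kd.span (G j)"
    then show "X z \<in> kd.span (G (Suc j))"
    proof (induct rule: kd.span_induct_alt)
      case base
      then show ?case by (simp add: kd_linear_0[OF linX] kd.span_zero)
    next
      case (step c x y)
      then obtain n m \<mu> \<gamma> where x: "x = n \<otimes>\<^sub>K m" and n: "\<mu> \<in> L" "n \<in> wt N \<mu>" and m: "\<gamma> \<in> L" "m \<in> wt M \<gamma>"
        and t: "h + of_nat j \<le> height \<gamma>"
        by (auto simp: G_def)
      have "\<Theta>\<^sub>1 \<nu> x \<in> kd.span (G (Suc j))" if "\<nu> \<in> degrees - {0}" for \<nu>
      proof -
        have \<nu>: "\<nu> \<in> pos_root_lattice" "\<nu> \<noteq> 0" using that degrees_pos by auto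
        obtain n' m' where *: "\<Theta>\<^sub>1 \<nu> (n \<otimes>\<^sub>K m) = (\<Sum>b\<in>B\<^sub>1 \<nu>. n' b \<otimes>\<^sub>K m' b)"
          and n': "\<And>b. b \<in> B\<^sub>1 \<nu> \<Longrightarrow> n' b \<in> wt N (\<mu> - \<nu>)" and m': "\<And>b. b \<in> B\<^sub>1 \<nu> \<Longrightarrow> m' b \<in> wt M (\<gamma> + \<nu>)"
          by (rule theta_part_one_sum[OF p1 dual1 \<nu>(1) n m]) (rule that; blast)
        have "h + of_nat (Suc j) \<le> height (\<gamma> + \<nu>)" using t height_pos_root[OF \<nu>] by (simp add: height_add)
        moreover have "\<mu> - \<nu> \<in> L" "\<gamma> + \<nu> \<in> L" using pos_root_L[OF \<nu>(1)] n m by (simp_all add: L_closed)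
        ultimately have "n' b \<otimes>\<^sub>K m' b \<in> G (Suc j)" if "b \<in> B\<^sub>1 \<nu>" for b
          unfolding G_def using n'[OF that] m'[OF that] by blast
        then show ?thesis unfolding x * by (intro kd.span_sum kd.span_base)
      qed
      then have "X x \<in> kd.span (G (Suc j))" unfolding X_def by (rule kd.span_sum)
      then show ?case
        using step by (simp add: kd_linear_add[OF linX] kd_linear_scale[OF linX] kd.span_add kd.span_scale)
    qed
  next
    fix j z assume "z \<in> kd.span (G j)"
    then show "- z \<in> kd.span (G j)" by (rule kd.span_neg)
  next
    have "n \<otimes>\<^sub>K m \<in> kd.span (G 0)" for n m
    proof -
      have "component (wt N) n \<mu> \<otimes>\<^sub>K component (wt M) m \<gamma> \<in> kd.span (G 0)"
        if "wt N \<mu> \<noteq> {0}" "wt M \<gamma> \<noteq> {0}" for \<mu> \<gamma>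
      proof (rule kd.span_base)
        have "\<mu> \<in> L" "\<gamma> \<in> L" using that N.grading M.grading by (auto simp: is_grading_def)
        moreover have "h + of_nat 0 \<le> height \<gamma>" using h that by simp
        ultimately show "component (wt N) n \<mu> \<otimes>\<^sub>K component (wt M) m \<gamma> \<in> G 0"
          unfolding G_def using component_in[OF N.grading] component_in[OF M.grading] by blast
      qed
      then have "(\<Sum>\<mu> | wt N \<mu> \<noteq> {0}. component (wt N) n \<mu>) \<otimes>\<^sub>K (\<Sum>\<gamma> | wt M \<gamma> \<noteq> {0}. component (wt M) m \<gamma>) \<in> kd.span (G 0)"
        unfolding tens_simps(7) tens_simps(8) by (intro kd.span_sum) simp
      then show ?thesis
        by (simp only: sum_all_components[OF N.grading N.finite_dim] sum_all_components[OF M.grading M.finite_dim])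
    qed
    then have "z \<in> kd.span (G 0)" for z
      by (induct z rule: tensor_induct) (auto intro: kd.span_zero kd.span_add)
    then show "kd.span (G 0) = UNIV" by blast
  next
    have "z = 0" if z: "z \<in> G k" for z
    proof -
      obtain n m \<gamma> where x: "z = n \<otimes>\<^sub>K m" and m: "m \<in> wt M \<gamma>" "h + of_nat k \<le> height \<gamma>"
        using z by (auto simp: G_def)
      then have "\<gamma> \<notin> ?S" using H[of \<gamma>] k by auto
      then show ?thesis using m x by (simp add: tens_simps)
    qed
    then have "kd.span (G k) \<subseteq> {0}" by (intro kd.span_minimal kd.subspace_single_0) auto
    then show "kd.span (G k) = {0}" using kd.span_zero[of "G k"] by blast
  qed
  moreover have "one.theta B\<^sub>1 sharp\<^sub>1 N M z = z + X z" for z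
  proof -
    have "one.theta B\<^sub>1 sharp\<^sub>1 N M z = \<Theta>\<^sub>1 0 z + (\<Sum>\<nu>\<in>degrees - {0}. \<Theta>\<^sub>1 \<nu> z)"
      unfolding theta_one_sum by (rule sum.remove[OF finite_degrees]) (simp add: degrees_def)
    then show ?thesis by (simp only: theta_part_zero X_def)
  qed
  ultimately show ?thesis by (simp add: fun_eq_iff[symmetric] cong: bij_betw_cong)
qed

lemma linear_f_scale_one: "kd_linear (one.f_scale N M)"
  unfolding one.f_scale_def by (rule linear_scale_NM)

lemma bij_checked_R_one: "bij (one.checked_R B\<^sub>1 sharp\<^sub>1 M N)"
proof -
  have "bij (one.f_scale N M)"
    unfolding one.f_scale_def
    by (rule bij_tensor_graded_scale[OF N.grading N.finite_dim M.grading M.finite_dim]) (simp add: one_tpow vpow_nonzero)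
  then show ?thesis unfolding one.checked_R_def by (intro bij_comp bij_theta_one bij_tensor_flip)
qed

lemma linear_checked_R_one: "kd_linear (one.checked_R B\<^sub>1 sharp\<^sub>1 M N)"
  unfolding one.checked_R_def comp_def
  by (rule kd_linear_compose[OF linear_theta_one kd_linear_compose[OF linear_f_scale_one kd_linear_tensor_flip]])

context
  fixes \<phi> and B and sharp
  assumes p: "is_pairing \<phi>" and dual: "dual_bases \<phi> B sharp"
begin

abbreviation "\<Theta>\<^sub>t \<equiv> theta_part B sharp (transport N) (transport M)"

lemma linear_theta_part_transport: "\<nu> \<in> pos_root_lattice \<Longrightarrow> kd_linear (\<Theta>\<^sub>t \<nu>)"
  by (rule kd_linear_theta_part[OF N.tr.u_module_axioms M.tr.u_module_axioms p dual])

lemma theta_transport_sum: "theta B sharp (transport N) (transport M) z = (\<Sum>\<nu>\<in>degrees. \<Theta>\<^sub>t \<nu> z)"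
proof (rule theta_finite_sum[OF finite_degrees degrees_pos])
  fix \<nu> assume \<nu>: "\<nu> \<in> pos_root_lattice" "\<nu> \<notin> degrees"
  show "\<Theta>\<^sub>t \<nu> z = 0"
    by (rule tensor_linear_ext_weights[OF N.grading M.grading linear_theta_part_transport[OF \<nu>(1)] kd_linear_zero])
       (simp add: theta_part_transport[OF p dual p1 dual1 \<nu>(1)] theta_part_one_vanish[OF p1 dual1 \<nu>])
qed

lemma linear_theta_transport: "kd_linear (theta B sharp (transport N) (transport M))"
  unfolding theta_transport_sum[abs_def]
  by (intro kd_linear_setsum linear_theta_part_transport) (use degrees_pos in auto)

lemma linear_checked_R_transport: "kd_linear (checked_R B sharp (transport M) (transport N))"
proof -
  have f: "kd_linear (f_scale (transport N) (transport M))"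
    unfolding f_scale_def N.wt_transport M.wt_transport by (rule linear_scale_NM)
  show ?thesis
    unfolding checked_R_def comp_def
    by (rule kd_linear_compose[OF linear_theta_transport kd_linear_compose[OF f kd_linear_tensor_flip]])
qed

lemma checked_R_comparison:
  "comparison N M (checked_R B sharp (transport M) (transport N) z) = one.checked_R B\<^sub>1 sharp\<^sub>1 M N (comparison M N z)"
proof -
  have J: "kd_linear (comparison N M)" "kd_linear (comparison M N)"
    unfolding comparison_def by (rule linear_scale_NM linear_scale_MN)+
  show ?thesis
  proof (rule tensor_linear_ext_weights[OF M.grading N.grading
        kd_linear_compose[OF J(1) linear_checked_R_transport] kd_linear_compose[OF linear_checked_R_one J(2)]])
    fix \<gamma> \<mu> m n assume m: "\<gamma> \<in> L" "m \<in> wt M \<gamma>" and n: "\<mu> \<in> L" "n \<in> wt N \<mu>"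
    let ?v = "vpow (- sdot \<Omega> \<mu> \<gamma>)" and ?f = "tpow (ang \<mu> \<gamma> - ang \<gamma> \<mu>)"
    have "checked_R B sharp (transport M) (transport N) (m \<otimes>\<^sub>K n) =
        theta B sharp (transport N) (transport M) ((?v * ?f) *\<^sub>K (n \<otimes>\<^sub>K m))"
      by (simp add: checked_R_def tensor_flip_tens f_scale_def N.wt_transport M.wt_transport scale_tens_NM[OF n(2) m(2)])
    also have "\<dots> = (?v * ?f) *\<^sub>K (\<Sum>\<nu>\<in>degrees. \<Theta>\<^sub>t \<nu> (n \<otimes>\<^sub>K m))"
      by (simp add: kd_linear_scale[OF linear_theta_transport] flip: theta_transport_sum)
    finally have "comparison N M (checked_R B sharp (transport M) (transport N) (m \<otimes>\<^sub>K n)) =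
        (\<Sum>\<nu>\<in>degrees. (?v * ?f) *\<^sub>K comparison N M (\<Theta>\<^sub>t \<nu> (n \<otimes>\<^sub>K m)))"
      by (simp add: kd_linear_scale[OF J(1)] kd_linear_sum[OF J(1)] kd.scale_sum_right)
    also have "\<dots> = (\<Sum>\<nu>\<in>degrees. (?v * tpow (ang \<mu> \<gamma>)) *\<^sub>K \<Theta>\<^sub>1 \<nu> (n \<otimes>\<^sub>K m))"
    proof (rule sum.cong[OF refl])
      fix \<nu> assume "\<nu> \<in> degrees"
      then have \<nu>: "\<nu> \<in> pos_root_lattice" using degrees_pos by blast
      let ?a = "ang \<gamma> \<nu> - ang \<nu> \<mu> + ang \<nu> \<nu>" and ?b = "ang (\<gamma> + \<nu>) (\<mu> - \<nu>)"
      \<comment> \<open>the powers of \<open>t\<close> in \<open>f\<^sub>t\<close>, in \<open>\<Theta>\<^bsub>t,\<nu>\<^esub>\<close> and in the comparison of the target\<close>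
      have "?f * tpow ?a * tpow ?b = tpow ((ang \<mu> \<gamma> - ang \<gamma> \<mu>) + ?a + ?b)"
        using pos_root_L[OF \<nu>] m(1) n(1) by (simp only: tpow_add Dint_rules L_closed)
      also have "(ang \<mu> \<gamma> - ang \<gamma> \<mu>) + ?a + ?b = ang \<mu> \<gamma>" by (simp add: angle_simps)
      finally have "?v * ?f * (tpow ?a * tpow ?b) = ?v * tpow (ang \<mu> \<gamma>)" by (simp add: mult.assoc)
      then show "(?v * ?f) *\<^sub>K comparison N M (\<Theta>\<^sub>t \<nu> (n \<otimes>\<^sub>K m)) = (?v * tpow (ang \<mu> \<gamma>)) *\<^sub>K \<Theta>\<^sub>1 \<nu> (n \<otimes>\<^sub>K m)"
        by (simp add: theta_part_transport[OF p dual p1 dual1 \<nu> n m] kd_linear_scale[OF J(1)]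
            comparison_theta_part[OF \<nu> n m] kscale_kscale mult.assoc)
    qed
    also have "\<dots> = one.checked_R B\<^sub>1 sharp\<^sub>1 M N (comparison M N (m \<otimes>\<^sub>K n))"
    proof -
      have "comparison M N (m \<otimes>\<^sub>K n) = tpow (ang \<mu> \<gamma>) *\<^sub>K (m \<otimes>\<^sub>K n)"
        unfolding comparison_def by (rule scale_tens_MN[OF m(2) n(2)])
      moreover have "one.checked_R B\<^sub>1 sharp\<^sub>1 M N (m \<otimes>\<^sub>K n) = ?v *\<^sub>K (\<Sum>\<nu>\<in>degrees. \<Theta>\<^sub>1 \<nu> (n \<otimes>\<^sub>K m))"
        by (simp add: one.checked_R_def tensor_flip_tens one.f_scale_def scale_tens_NM[OF n(2) m(2)] one_tpow
            kd_linear_scale[OF linear_theta_one] flip: theta_one_sum)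
      ultimately show ?thesis
        by (simp add: kd_linear_scale[OF linear_checked_R_one] kscale_kscale kd.scale_sum_right mult.commute)
    qed
    finally show "comparison N M (checked_R B sharp (transport M) (transport N) (m \<otimes>\<^sub>K n)) =
        one.checked_R B\<^sub>1 sharp\<^sub>1 M N (comparison M N (m \<otimes>\<^sub>K n))" .
  qed
qed

end

end

lemma bij_comparison: "bij (comparison N M)" "bij (comparison M N)"
  unfolding comparison_def
  by (rule bij_tensor_graded_scale[OF N.grading N.finite_dim M.grading M.finite_dim]
      bij_tensor_graded_scale[OF M.grading M.finite_dim N.grading N.finite_dim], rule tpow_nonzero)+

end

lemma t_root_nonzero: "t_root \<noteq> 0"
  by (simp add: t_root_def Zero_fract_def eq_fract)

theorem theorem3p5:
  fixes \<Omega> :: "'i::finite \<Rightarrow> 'i \<Rightarrow> int" and L :: "(rat ^ 'i) set" and D :: nat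
    and \<phi>\<^sub>t \<phi>\<^sub>1 :: "'i uelem \<Rightarrow> 'i uelem \<Rightarrow> KD"
    and B\<^sub>t B\<^sub>1 :: "rat ^ 'i \<Rightarrow> 'i uelem set"
    and sharp\<^sub>t sharp\<^sub>1 :: "rat ^ 'i \<Rightarrow> 'i uelem \<Rightarrow> 'i uelem"
    and M :: "('i, 'm::kd_space) wmod" and N :: "('i, 'n::kd_space) wmod"
  assumes "cartan_datum \<Omega>" and "finite_type \<Omega>"
    and "admissible_lattice L" and "common_denominator \<Omega> L D"
    and "qgroup.is_pairing \<Omega> D t_root \<phi>\<^sub>t" and "qgroup.dual_bases \<Omega> D t_root \<phi>\<^sub>t B\<^sub>t sharp\<^sub>t"
    and "qgroup.is_pairing \<Omega> D 1 \<phi>\<^sub>1" and "qgroup.dual_bases \<Omega> D 1 \<phi>\<^sub>1 B\<^sub>1 sharp\<^sub>1"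
    and "qgroup.weight_module \<Omega> D 1 L M" and "qgroup.weight_module \<Omega> D 1 L N"
  shows "let \<Phi>M = qgroup.transport \<Omega> D t_root M;
             \<Phi>N = qgroup.transport \<Omega> D t_root N;
             R\<^sub>t = qgroup.checked_R \<Omega> D t_root B\<^sub>t sharp\<^sub>t \<Phi>M \<Phi>N;
             R\<^sub>1 = qgroup.checked_R \<Omega> D 1 B\<^sub>1 sharp\<^sub>1 M N;
             J\<^sub>M\<^sub>N = qgroup.comparison \<Omega> D t_root M N;
             J\<^sub>N\<^sub>M = qgroup.comparison \<Omega> D t_root N M
         in bij R\<^sub>t \<and> bij R\<^sub>1 \<and> bij J\<^sub>M\<^sub>N \<and> bij J\<^sub>N\<^sub>M \<and>
            R\<^sub>t = inv J\<^sub>N\<^sub>M \<circ> R\<^sub>1 \<circ> J\<^sub>M\<^sub>N \<and>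
            inv R\<^sub>t = inv J\<^sub>M\<^sub>N \<circ> inv R\<^sub>1 \<circ> J\<^sub>N\<^sub>M"
proof -
  have twist: "twist \<Omega> D t_root L"
    by (rule twist.intro) (simp_all add: t_root_nonzero assms(3,4))
  have "twisted_pair \<Omega> D t_root L N M"
    by (intro twisted_pair.intro twisted_module.intro twisted_module_axioms.intro twist assms(9,10))
  then interpret twisted_pair \<Omega> D t_root L N M .
  let ?R\<^sub>t = "checked_R B\<^sub>t sharp\<^sub>t (transport M) (transport N)" and ?R\<^sub>1 = "one.checked_R B\<^sub>1 sharp\<^sub>1 M N"
  let ?J = "comparison N M" and ?J' = "comparison M N"
  note bij = bij_checked_R_one[OF assms(7,8)] bij_comparison
  have "?J \<circ> ?R\<^sub>t = ?R\<^sub>1 \<circ> ?J'"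
    using checked_R_comparison[OF assms(7,8,5,6)] by (simp add: fun_eq_iff)
  then have "inv ?J \<circ> (?J \<circ> ?R\<^sub>t) = inv ?J \<circ> ?R\<^sub>1 \<circ> ?J'" by (simp add: comp_assoc)
  then have R: "?R\<^sub>t = inv ?J \<circ> ?R\<^sub>1 \<circ> ?J'"
    using bij(2) by (simp add: o_assoc inv_o_cancel bij_is_inj)
  have bR: "bij ?R\<^sub>t" unfolding R by (intro bij_comp bij bij_imp_bij_inv)
  have "inv ?R\<^sub>t = inv ?J' \<circ> inv ?R\<^sub>1 \<circ> ?J"
    unfolding R using bij by (simp add: o_inv_distrib bij_comp bij_imp_bij_inv inv_inv_eq comp_assoc)
  then show ?thesis
    unfolding Let_def using R bR bij by (intro conjI)
qed

end
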